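(* Suppose $\mathrm{Ker}_1\phi=0$, $\dim\bar D=r<\infty$, $\sigma\in D^*$, and $V$ is a finite dimensional simple $L$-module. Then $\Gamma(V,\sigma)$ is not simple as a $W$-module if and only if one of the following holds: (1) $V\cong\wedge^i\bar D^*$ for some $i\in\{1,\dots,r-1\}$ and $\sigma(\mathrm{Ker}_2\phi)=0$; (2) $V\cong\wedge^i\bar D^*$ for some $i\in\{0,r\}$ and $\sigma\in G$, where $\wedge^0\bar D^*=\mathbb C$ is the one dimensional trivial $L$-module.
   Context: Let $G$ be a nonzero abelian group, $D$ a complex vector space, $\phi:G\times D\to\mathbb C$ additive in the first variable and $\mathbb C$-linear in the second; write $d(a)=a(d)=\phi(a,d)$. $\mathrm{Ker}_1\phi=\{a\in G\mid\phi(a,D)=0\}$, $\mathrm{Ker}_2\phi=\{d\in D\mid\phi(G,d)=0\}$, and $\bar D$ is a fixed complement: $D=\bar D\oplus\mathrm{Ker}_2\phi$. When $\mathrm{Ker}_1\phi=0$, $G$ is identified with a subgroup of $D^*$ via $a\mapsto\phi(a,-)$; $\bar D^*$ is identified with $(D/\mathrm{Ker}_2\phi)^*\subset D^*$, so $G\subset\bar D^*$. Let $A=\mathbb C[G]$ with basis $t^a$. The generalized Witt algebra $W=A\otimes_{\mathbb C}D$ has bracket $[t^ad,t^{a'}d']=t^{a+a'}(\phi(a',d)d'-\phi(a,d')d)$, where $t^ad=t^a\otimes d$. $L$ is the Lie algebra (commutator bracket) of the associative algebra $R=G\otimes_{\mathbb Z}D$ with product $(a\otimes d)(a'\otimes d')=\phi(a',d)\,a\otimes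 d'$. $\bar D^*$ is an $L$-module via $(a\otimes d)\cdot g=g(d)a$ ($a\in G$, $d\in D$, $g\in\bar D^*\subset D^*$), and $\wedge^i\bar D^*$ is its $i$-th exterior power. For an $L$-module $V$ and $\sigma\in D^*$, $\Gamma(V,\sigma)=A\otimes V$ is the $W$-module with $t^ad\cdot(t^b\otimes v)=t^{a+b}\otimes(d(b)+\sigma(d)+a\otimes d)v$. *)

theory Defs
  imports Complex_Main "HOL-Library.Poly_Mapping" "HOL-Library.Function_Algebras"
begin

section \<open>Lie algebras and their modules over the complex numbers\<close>

locale lie_algebra = vector_space scale
  for scale :: "complex \<Rightarrow> 'l::ab_group_add \<Rightarrow> 'l" +
  fixes bracket :: "'l \<Rightarrow> 'l \<Rightarrow> 'l"
  assumes bracket_linear_left: "Vector_Spaces.linear scale scale (\<lambda>x. bracket x y)"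
    and bracket_linear_right: "Vector_Spaces.linear scale scale (bracket x)"
    and bracket_self: "bracket x x = 0"
    and jacobi: "bracket x (bracket y z) + bracket y (bracket z x) + bracket z (bracket x y) = 0"

locale lie_module = lie_algebra scale bracket + V: vector_space scaleV
  for scale :: "complex \<Rightarrow> 'l::ab_group_add \<Rightarrow> 'l"
    and bracket :: "'l \<Rightarrow> 'l \<Rightarrow> 'l"
    and scaleV :: "complex \<Rightarrow> 'v::ab_group_add \<Rightarrow> 'v" +
  fixes act :: "'l \<Rightarrow> 'v \<Rightarrow> 'v"
  assumes act_linear_left: "Vector_Spaces.linear scale scaleV (\<lambda>x. act x v)"
    and act_linear_right: "Vector_Spaces.linear scaleV scaleV (act x)"
    and act_bracket: "act (bracket x y) v = act x (act y v) - act y (act x v)"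

definition lie_submodule ::
    "(complex \<Rightarrow> 'v::ab_group_add \<Rightarrow> 'v) \<Rightarrow> ('l \<Rightarrow> 'v \<Rightarrow> 'v) \<Rightarrow> 'v set \<Rightarrow> bool" where
  "lie_submodule scaleV act M \<longleftrightarrow>
     module.subspace scaleV M \<and> (\<forall>x. \<forall>v\<in>M. act x v \<in> M)"

definition simple_lie_module ::
    "(complex \<Rightarrow> 'l::ab_group_add \<Rightarrow> 'l) \<Rightarrow> ('l \<Rightarrow> 'l \<Rightarrow> 'l) \<Rightarrow>
     (complex \<Rightarrow> 'v::ab_group_add \<Rightarrow> 'v) \<Rightarrow> ('l \<Rightarrow> 'v \<Rightarrow> 'v) \<Rightarrow> bool" where
  "simple_lie_module scale bracket scaleV act \<longleftrightarrow>
     lie_module scale bracket scaleV act \<and>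
     (\<exists>v::'v. v \<noteq> 0) \<and>
     (\<forall>M. lie_submodule scaleV act M \<longrightarrow> M = {0} \<or> M = UNIV)"

text \<open>The structure maps of a module on an explicit carrier.  This is only used to speak about
  isomorphisms, since the exterior powers below live on a set of equivalence classes rather
  than on a whole type.\<close>

record ('l, 'v) module_data =
  points :: "'v set"
  madd :: "'v \<Rightarrow> 'v \<Rightarrow> 'v"
  msmult :: "complex \<Rightarrow> 'v \<Rightarrow> 'v"
  mact :: "'l \<Rightarrow> 'v \<Rightarrow> 'v"

definition lie_module_iso :: "('l, 'v) module_data \<Rightarrow> ('l, 'w) module_data \<Rightarrow> bool" where
  "lie_module_iso V W \<longleftrightarrow>
     (\<exists>f. bij_betw f (points V) (points W) \<and>
        (\<forall>u\<in>points V. \<forall>v\<in>points V. f (madd V u v) = madd W (f u) (f v)) \<and>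
        (\<forall>c. \<forall>v\<in>points V. f (msmult V c v) = msmult W c (f v)) \<and>
        (\<forall>x. \<forall>v\<in>points V. f (mact V x v) = mact W x (f v)))"


section \<open>The pairing\<close>

locale pairing = vector_space scaleD
  for scaleD :: "complex \<Rightarrow> 'd::ab_group_add \<Rightarrow> 'd" +
  fixes \<phi> :: "'g::ab_group_add \<Rightarrow> 'd \<Rightarrow> complex"
  assumes additive_left: "\<phi> (a + b) d = \<phi> a d + \<phi> b d"
    and linear_right: "Vector_Spaces.linear scaleD (*) (\<phi> a)"

definition Ker1 :: "('g \<Rightarrow> 'd \<Rightarrow> complex) \<Rightarrow> 'g set" where
  "Ker1 \<phi> = {a. \<forall>d. \<phi> a d = 0}"

definition Ker2 :: "('g \<Rightarrow> 'd \<Rightarrow> complex) \<Rightarrow> 'd set" where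
  "Ker2 \<phi> = {d. \<forall>a. \<phi> a d = 0}"

text \<open>The dual of a complement of \<^term>\<open>Ker2 \<phi>\<close>, identified with the dual of the quotient
  of the whole space by \<^term>\<open>Ker2 \<phi>\<close>, that is, with a space of linear functionals on the
  whole space.\<close>

definition bar_dual ::
    "(complex \<Rightarrow> 'd::ab_group_add \<Rightarrow> 'd) \<Rightarrow> ('g \<Rightarrow> 'd \<Rightarrow> complex) \<Rightarrow> ('d \<Rightarrow> complex) set" where
  "bar_dual scaleD \<phi> =
     {g. Vector_Spaces.linear scaleD (*) g \<and> (\<forall>d\<in>Ker2 \<phi>. g d = 0)}"


section \<open>The tensor product of abelian groups\<close>

inductive_set tensor_null :: "(('a::ab_group_add \<times> 'b::ab_group_add) \<Rightarrow>\<^sub>0 int) set" where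
  null_zero: "0 \<in> tensor_null"
| null_diff: "x \<in> tensor_null \<Longrightarrow> y \<in> tensor_null \<Longrightarrow> x - y \<in> tensor_null"
| null_left: "frag_of (a + a', b) - frag_of (a, b) - frag_of (a', b) \<in> tensor_null"
| null_right: "frag_of (a, b + b') - frag_of (a, b) - frag_of (a, b') \<in> tensor_null"

lemma null_uminus: "x \<in> tensor_null \<Longrightarrow> - x \<in> tensor_null"
  using null_diff[OF null_zero, of x] by simp

lemma null_add: "x \<in> tensor_null \<Longrightarrow> y \<in> tensor_null \<Longrightarrow> x + y \<in> tensor_null"
  using null_diff[of x "- y"] null_uminus[of y] by simp

quotient_type (overloaded) ('a, 'b) tensor =
  "('a::ab_group_add \<times> 'b::ab_group_add) \<Rightarrow>\<^sub>0 int" / "\<lambda>x y. x - y \<in> tensor_null"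
proof (rule equivpI)
  show "reflp (\<lambda>x y. x - y \<in> (tensor_null :: (('a \<times> 'b) \<Rightarrow>\<^sub>0 int) set))"
    by (simp add: reflp_def null_zero)
  show "symp (\<lambda>x y. x - y \<in> (tensor_null :: (('a \<times> 'b) \<Rightarrow>\<^sub>0 int) set))"
  proof (rule sympI)
    fix x y :: "('a \<times> 'b) \<Rightarrow>\<^sub>0 int"
    assume "x - y \<in> tensor_null"
    from null_uminus[OF this] show "y - x \<in> tensor_null" by simp
  qed
  show "transp (\<lambda>x y. x - y \<in> (tensor_null :: (('a \<times> 'b) \<Rightarrow>\<^sub>0 int) set))"
  proof (rule transpI)
    fix x y z :: "('a \<times> 'b) \<Rightarrow>\<^sub>0 int"
    assume "x - y \<in> tensor_null" "y - z \<in> tensor_null"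
    from null_add[OF this] show "x - z \<in> tensor_null" by simp
  qed
qed

instantiation tensor :: (ab_group_add, ab_group_add) ab_group_add
begin

lift_definition zero_tensor :: "('a, 'b) tensor" is 0 .

lift_definition plus_tensor :: "('a, 'b) tensor \<Rightarrow> ('a, 'b) tensor \<Rightarrow> ('a, 'b) tensor" is "(+)"
proof -
  fix x x' y y' :: "('a \<times> 'b) \<Rightarrow>\<^sub>0 int"
  assume "x - x' \<in> tensor_null" "y - y' \<in> tensor_null"
  from null_add[OF this] show "(x + y) - (x' + y') \<in> tensor_null" by (simp add: algebra_simps)
qed

lift_definition uminus_tensor :: "('a, 'b) tensor \<Rightarrow> ('a, 'b) tensor" is uminus
proof -
  fix x x' :: "('a \<times> 'b) \<Rightarrow>\<^sub>0 int"
  assume "x - x' \<in> tensor_null"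
  from null_uminus[OF this] show "- x - (- x') \<in> tensor_null" by simp
qed

lift_definition minus_tensor :: "('a, 'b) tensor \<Rightarrow> ('a, 'b) tensor \<Rightarrow> ('a, 'b) tensor" is "(-)"
proof -
  fix x x' y y' :: "('a \<times> 'b) \<Rightarrow>\<^sub>0 int"
  assume "x - x' \<in> tensor_null" "y - y' \<in> tensor_null"
  from null_diff[OF this] show "(x - y) - (x' - y') \<in> tensor_null" by (simp add: algebra_simps)
qed

instance
  by intro_classes (transfer, simp add: null_zero add_ac)+

end

lift_definition pure_tensor ::
    "'a::ab_group_add \<Rightarrow> 'b::ab_group_add \<Rightarrow> ('a, 'b) tensor"  (infixl \<open>\<otimes>\<^sub>Z\<close> 75)
  is "\<lambda>a b. frag_of (a, b)" .


section \<open>The Lie algebra L\<close>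

text \<open>The next three operations on tensors are computed on representatives.  Their values do not
  depend on the representatives when \<^term>\<open>pairing scaleD \<phi>\<close> holds (and, for
  \<open>L_dual_act\<close>, when the functional is additive).\<close>

definition L_scale ::
    "(complex \<Rightarrow> 'd::ab_group_add \<Rightarrow> 'd) \<Rightarrow> complex \<Rightarrow> ('g::ab_group_add, 'd) tensor \<Rightarrow> ('g, 'd) tensor"
  where
  "L_scale scaleD c x =
     abs_tensor (frag_extend (\<lambda>(a, d). frag_of (a, scaleD c d)) (rep_tensor x))"

text \<open>The associative product is \<open>(a \<otimes> d) (a' \<otimes> d') = \<phi> a' d \<cdot> (a \<otimes> d')\<close>.\<close>

definition R_mult ::
    "(complex \<Rightarrow> 'd::ab_group_add \<Rightarrow> 'd) \<Rightarrow> ('g::ab_group_add \<Rightarrow> 'd \<Rightarrow> complex) \<Rightarrow>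
     ('g, 'd) tensor \<Rightarrow> ('g, 'd) tensor \<Rightarrow> ('g, 'd) tensor" where
  "R_mult scaleD \<phi> x y =
     abs_tensor (frag_extend (\<lambda>(a, d).
       frag_extend (\<lambda>(a', d'). frag_of (a, scaleD (\<phi> a' d) d')) (rep_tensor y)) (rep_tensor x))"

definition L_bracket ::
    "(complex \<Rightarrow> 'd::ab_group_add \<Rightarrow> 'd) \<Rightarrow> ('g::ab_group_add \<Rightarrow> 'd \<Rightarrow> complex) \<Rightarrow>
     ('g, 'd) tensor \<Rightarrow> ('g, 'd) tensor \<Rightarrow> ('g, 'd) tensor" where
  "L_bracket scaleD \<phi> x y = R_mult scaleD \<phi> x y - R_mult scaleD \<phi> y x"

text \<open>\<open>(a \<otimes> d) \<cdot> g = g d \<cdot> \<phi> a\<close>, extended additively.\<close>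

definition L_dual_act ::
    "('g::ab_group_add \<Rightarrow> 'd::ab_group_add \<Rightarrow> complex) \<Rightarrow>
     ('g, 'd) tensor \<Rightarrow> ('d \<Rightarrow> complex) \<Rightarrow> ('d \<Rightarrow> complex)" where
  "L_dual_act \<phi> x g = (\<lambda>e. \<Sum>(a, d)\<in>Poly_Mapping.keys (rep_tensor x).
     of_int (Poly_Mapping.lookup (rep_tensor x) (a, d)) * (g d * \<phi> a e))"


section \<open>Finitely supported functions\<close>

text \<open>The tensor product of the group algebra \<open>\<complex>[G]\<close> with a complex vector space \<open>X\<close> is the
  direct sum of the \<open>t\<^sup>a \<otimes> X\<close> over \<open>a \<in> G\<close>, so it is taken to be the type \<open>G \<Rightarrow>\<^sub>0 X\<close>;
  the element \<open>t\<^sup>a \<otimes> x\<close> is \<^term>\<open>Poly_Mapping.single a x\<close>.\<close>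

definition fscale ::
    "(complex \<Rightarrow> 'x::ab_group_add \<Rightarrow> 'x) \<Rightarrow> complex \<Rightarrow> ('k \<Rightarrow>\<^sub>0 'x) \<Rightarrow> ('k \<Rightarrow>\<^sub>0 'x)" where
  "fscale s c p = Poly_Mapping.map (s c) p"


section \<open>Exterior powers\<close>

text \<open>The \<open>i\<close>-th exterior power of a subspace \<open>U\<close> is the free vector space on \<open>i\<close>-tuples of
  elements of \<open>U\<close> modulo the relations of multilinearity and alternation.\<close>

definition tuples :: "nat \<Rightarrow> 'u set \<Rightarrow> 'u list set" where
  "tuples i U = {us. length us = i \<and> set us \<subseteq> U}"

definition wedge_free :: "nat \<Rightarrow> 'u set \<Rightarrow> ('u list \<Rightarrow>\<^sub>0 complex) set" where
  "wedge_free i U = {p. Poly_Mapping.keys p \<subseteq> tuples i U}"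

definition wedge_null ::
    "(complex \<Rightarrow> 'u::ab_group_add \<Rightarrow> 'u) \<Rightarrow> nat \<Rightarrow> 'u set \<Rightarrow> ('u list \<Rightarrow>\<^sub>0 complex) set" where
  "wedge_null s i U = module.span (fscale (*))
     ({Poly_Mapping.single (us[k := u + v]) 1
         - Poly_Mapping.single (us[k := u]) 1 - Poly_Mapping.single (us[k := v]) 1
         | us k u v. us \<in> tuples i U \<and> k < i \<and> u \<in> U \<and> v \<in> U} \<union>
      {Poly_Mapping.single (us[k := s c u]) 1 - Poly_Mapping.single (us[k := u]) c
         | us k c u. us \<in> tuples i U \<and> k < i \<and> u \<in> U} \<union>
      {Poly_Mapping.single us 1 | us. us \<in> tuples i U \<and> \<not> distinct us})"

definition wedge_rel ::
    "(complex \<Rightarrow> 'u::ab_group_add \<Rightarrow> 'u) \<Rightarrow> nat \<Rightarrow> 'u set \<Rightarrow>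
     (('u list \<Rightarrow>\<^sub>0 complex) \<times> ('u list \<Rightarrow>\<^sub>0 complex)) set" where
  "wedge_rel s i U =
     {(p, q). p \<in> wedge_free i U \<and> q \<in> wedge_free i U \<and> p - q \<in> wedge_null s i U}"

text \<open>\<open>x \<cdot> (u\<^sub>1 \<and> \<dots> \<and> u\<^sub>i) = (\<Sum>k. u\<^sub>1 \<and> \<dots> \<and> x \<cdot> u\<^sub>k \<and> \<dots> \<and> u\<^sub>i)\<close>, on representatives.
  For \<open>i = 0\<close> the sum is empty, and the exterior power is the trivial one-dimensional module.\<close>

definition wedge_act ::
    "('l \<Rightarrow> 'u \<Rightarrow> 'u) \<Rightarrow> 'l \<Rightarrow> ('u list \<Rightarrow>\<^sub>0 complex) \<Rightarrow> ('u list \<Rightarrow>\<^sub>0 complex)" where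
  "wedge_act act x p = (\<Sum>us\<in>Poly_Mapping.keys p. \<Sum>k<length us.
     Poly_Mapping.single (us[k := act x (us ! k)]) (Poly_Mapping.lookup p us))"

definition exterior_power ::
    "(complex \<Rightarrow> 'u::ab_group_add \<Rightarrow> 'u) \<Rightarrow> ('l \<Rightarrow> 'u \<Rightarrow> 'u) \<Rightarrow> nat \<Rightarrow> 'u set \<Rightarrow>
     ('l, ('u list \<Rightarrow>\<^sub>0 complex) set) module_data" where
  "exterior_power s act i U =
     (let r = wedge_rel s i U in
      \<lparr>points = wedge_free i U // r,
       madd = (\<lambda>P Q. \<Union>p\<in>P. \<Union>q\<in>Q. r `` {p + q}),
       msmult = (\<lambda>c P. \<Union>p\<in>P. r `` {fscale (*) c p}),
       mact = (\<lambda>x P. \<Union>p\<in>P. r `` {wedge_act act x p})\<rparr>)"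

definition exterior_bar_dual ::
    "(complex \<Rightarrow> 'd::ab_group_add \<Rightarrow> 'd) \<Rightarrow> ('g::ab_group_add \<Rightarrow> 'd \<Rightarrow> complex) \<Rightarrow> nat \<Rightarrow>
     (('g, 'd) tensor, (('d \<Rightarrow> complex) list \<Rightarrow>\<^sub>0 complex) set) module_data" where
  "exterior_bar_dual scaleD \<phi> i =
     exterior_power (\<lambda>c g d. c * g d) (L_dual_act \<phi>) i (bar_dual scaleD \<phi>)"


section \<open>The generalized Witt algebra and its modules\<close>

text \<open>\<open>[t\<^sup>a d, t\<^sup>b e] = t\<^sup>a\<^sup>+\<^sup>b (\<phi> b d \<cdot> e - \<phi> a e \<cdot> d)\<close>.\<close>

definition W_bracket ::
    "(complex \<Rightarrow> 'd::ab_group_add \<Rightarrow> 'd) \<Rightarrow> ('g::ab_group_add \<Rightarrow> 'd \<Rightarrow> complex) \<Rightarrow>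
     ('g \<Rightarrow>\<^sub>0 'd) \<Rightarrow> ('g \<Rightarrow>\<^sub>0 'd) \<Rightarrow> ('g \<Rightarrow>\<^sub>0 'd)" where
  "W_bracket scaleD \<phi> p q =
     (\<Sum>a\<in>Poly_Mapping.keys p. \<Sum>b\<in>Poly_Mapping.keys q.
        (let d = Poly_Mapping.lookup p a; e = Poly_Mapping.lookup q b in
         Poly_Mapping.single (a + b) (scaleD (\<phi> b d) e - scaleD (\<phi> a e) d)))"

text \<open>\<open>t\<^sup>a d \<cdot> (t\<^sup>b \<otimes> v) = t\<^sup>a\<^sup>+\<^sup>b \<otimes> ((\<phi> b d + \<sigma> d) \<cdot> v + (a \<otimes> d) \<cdot> v)\<close>.\<close>

definition Gamma_act ::
    "('g::ab_group_add \<Rightarrow> 'd::ab_group_add \<Rightarrow> complex) \<Rightarrow> (complex \<Rightarrow> 'v::ab_group_add \<Rightarrow> 'v) \<Rightarrow>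
     (('g, 'd) tensor \<Rightarrow> 'v \<Rightarrow> 'v) \<Rightarrow> ('d \<Rightarrow> complex) \<Rightarrow>
     ('g \<Rightarrow>\<^sub>0 'd) \<Rightarrow> ('g \<Rightarrow>\<^sub>0 'v) \<Rightarrow> ('g \<Rightarrow>\<^sub>0 'v)" where
  "Gamma_act \<phi> scaleV \<rho> \<sigma> p x =
     (\<Sum>a\<in>Poly_Mapping.keys p. \<Sum>b\<in>Poly_Mapping.keys x.
        (let d = Poly_Mapping.lookup p a; v = Poly_Mapping.lookup x b in
         Poly_Mapping.single (a + b) (scaleV (\<phi> b d + \<sigma> d) v + \<rho> (a \<otimes>\<^sub>Z d) v)))"

section \<open>Consistency of the definitions\<close>

text \<open>The operations given above on representatives and by sums over supports have the intended
  values on generators, \<open>L\<close> and \<open>W\<close> are Lie algebras, and \<open>\<Gamma>(V, \<sigma>)\<close> is a \<open>W\<close>-module.\<close>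

lemma frag_extend_diff_fun:
  fixes f g :: "'a \<Rightarrow> 'b \<Rightarrow>\<^sub>0 int"
  shows "frag_extend (\<lambda>x. f x - g x) z = frag_extend f z - frag_extend g z"
proof -
  have "frag_cmul c (x - y) = frag_cmul c x - frag_cmul c y" for c and x y :: "'b \<Rightarrow>\<^sub>0 int"
    by (rule poly_mapping_eqI) (simp add: lookup_minus algebra_simps)
  then show ?thesis by (simp add: frag_extend_def sum_subtractf)
qed

lemma tensor_induct [case_names zero pure diff]:
  fixes x :: "('a::ab_group_add, 'b::ab_group_add) tensor"
  assumes "P 0" "\<And>a b. P (a \<otimes>\<^sub>Z b)" "\<And>x y. P x \<Longrightarrow> P y \<Longrightarrow> P (x - y)"
  shows "P x"
proof -
  have "P (abs_tensor p)" for p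
    using subset_UNIV[of "Poly_Mapping.keys p"]
  proof (induction p rule: frag_induction)
    case zero
    then show ?case using assms(1) by (simp add: zero_tensor_def)
  next
    case (one x)
    then show ?case using assms(2)[of "fst x" "snd x"] by (simp add: pure_tensor_def)
  next
    case (diff a b)
    then show ?case using assms(3)[of "abs_tensor a" "abs_tensor b"]
      by (simp only: minus_tensor.abs_eq)
  qed
  from this[of "rep_tensor x"] show ?thesis
    by (simp only: Quotient3_abs_rep[OF Quotient3_tensor])
qed

lemma abs_tensor_eq_iff: "abs_tensor p = abs_tensor q \<longleftrightarrow> p - q \<in> tensor_null"
  using Quotient3_rel[OF Quotient3_tensor, of p q] by (simp add: null_zero)

lemma rep_tensor_diff: "rep_tensor (abs_tensor p) - p \<in> tensor_null"
  by (simp only: Quotient3_abs_rep[OF Quotient3_tensor] flip: abs_tensor_eq_iff)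

lemma abs_tensor_diff: "abs_tensor (p - q) = abs_tensor p - abs_tensor q"
  by (simp add: minus_tensor.abs_eq)

lemma abs_tensor_null: "abs_tensor p = 0 \<longleftrightarrow> p \<in> tensor_null"
  using abs_tensor_eq_iff[of p 0] by (simp add: zero_tensor_def)

lemma frag_extend_null:
  assumes "p \<in> tensor_null"
    and "\<And>a a' b. f (a + a', b) - f (a, b) - f (a', b) \<in> tensor_null"
    and "\<And>a b b'. f (a, b + b') - f (a, b) - f (a, b') \<in> tensor_null"
  shows "frag_extend f p \<in> tensor_null"
  using assms(1)
  by induction (simp_all add: frag_extend_diff null_zero null_diff assms(2,3))

lemma null_frag_extend_fun:
  assumes "\<And>x. f x \<in> tensor_null"
  shows "frag_extend f p \<in> tensor_null"
  using subset_UNIV[of "Poly_Mapping.keys p"]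
  by (induction p rule: frag_induction) (simp_all add: frag_extend_diff null_zero null_diff assms)

lemma pure_tensor_add_left: "(a + a') \<otimes>\<^sub>Z b = a \<otimes>\<^sub>Z b + a' \<otimes>\<^sub>Z b"
  by transfer (metis diff_diff_add null_left)

lemma pure_tensor_add_right: "a \<otimes>\<^sub>Z (b + b') = a \<otimes>\<^sub>Z b + a \<otimes>\<^sub>Z b'"
  by transfer (metis diff_diff_add null_right)

text \<open>The induced map on a tensor product.\<close>

lemma tensor_map:
  assumes "\<And>a a' b. f (a + a', b) - f (a, b) - f (a', b) \<in> tensor_null"
    and "\<And>a b b'. f (a, b + b') - f (a, b) - f (a, b') \<in> tensor_null"
  defines "F \<equiv> \<lambda>x. abs_tensor (frag_extend f (rep_tensor x))"
  shows "F (a \<otimes>\<^sub>Z b) = abs_tensor (f (a, b))" and "F (x - y) = F x - F y"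
proof -
  have F_abs: "F (abs_tensor p) = abs_tensor (frag_extend f p)" for p
    using frag_extend_null[OF rep_tensor_diff[of p] assms(1,2)]
    by (simp add: F_def abs_tensor_eq_iff frag_extend_diff)
  then show "F (a \<otimes>\<^sub>Z b) = abs_tensor (f (a, b))"
    by (simp add: pure_tensor_def)
  have "F (abs_tensor p - abs_tensor q) = F (abs_tensor p) - F (abs_tensor q)" for p q
    by (simp add: F_abs frag_extend_diff flip: abs_tensor_diff)
  from this[of "rep_tensor x" "rep_tensor y"] show "F (x - y) = F x - F y"
    by (simp only: Quotient3_abs_rep[OF Quotient3_tensor])
qed

lemma frag_of_null_right:
  assumes "b = b' + b''"
  shows "frag_of (a, b) - frag_of (a, b') - frag_of (a, b'') \<in> tensor_null"
  using null_right[of a b' b''] assms by simp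

context pairing
begin

lemma pair_add: "\<phi> a (d + e) = \<phi> a d + \<phi> a e"
  using linear_right[of a] by (simp add: Vector_Spaces.linear_iff)

lemma pair_scale: "\<phi> a (scaleD c d) = c * \<phi> a d"
  using linear_right[of a] by (simp add: Vector_Spaces.linear_iff)

lemma L_scale_pure: "L_scale scaleD c (a \<otimes>\<^sub>Z d) = a \<otimes>\<^sub>Z scaleD c d"
  and L_scale_diff: "L_scale scaleD c (x - y) = L_scale scaleD c x - L_scale scaleD c y"
  unfolding L_scale_def
  by (subst tensor_map; auto intro!: null_left frag_of_null_right
        simp: scale_right_distrib pure_tensor_def)+

lemma R_mult_diff_left: "R_mult scaleD \<phi> (x - y) z = R_mult scaleD \<phi> x z - R_mult scaleD \<phi> y z"
  and R_mult_pure_left: "R_mult scaleD \<phi> (a \<otimes>\<^sub>Z d) z =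
    abs_tensor (frag_extend (\<lambda>(a', d'). frag_of (a, scaleD (\<phi> a' d) d')) (rep_tensor z))"
  unfolding R_mult_def
  by (subst tensor_map; auto intro!: null_frag_extend_fun null_left frag_of_null_right
        simp: scale_left_distrib pair_add simp flip: frag_extend_diff_fun)+

lemma R_mult_pure:
  "R_mult scaleD \<phi> (a \<otimes>\<^sub>Z d) (a' \<otimes>\<^sub>Z d') = a \<otimes>\<^sub>Z scaleD (\<phi> a' d) d'"
  unfolding R_mult_pure_left
  by (subst tensor_map; auto intro!: frag_of_null_right
        simp: scale_left_distrib scale_right_distrib additive_left pure_tensor_def)

lemma R_mult_diff_right: "R_mult scaleD \<phi> z (x - y) = R_mult scaleD \<phi> z x - R_mult scaleD \<phi> z y"
proof (induction z rule: tensor_induct)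
  case zero
  show ?case using R_mult_diff_left[of 0 0] by simp
next
  case (pure a d)
  show ?case unfolding R_mult_pure_left
    by (subst tensor_map; auto intro!: frag_of_null_right
          simp: scale_left_distrib scale_right_distrib additive_left)
next
  case (diff u v)
  then show ?case by (simp add: R_mult_diff_left)
qed

lemma R_mult_zero: "R_mult scaleD \<phi> 0 x = 0" "R_mult scaleD \<phi> x 0 = 0" "L_scale scaleD c 0 = 0"
  using R_mult_diff_left[of 0 0] R_mult_diff_right[of _ 0 0] L_scale_diff[of _ 0 0] by simp_all

lemma R_mult_add:
  "R_mult scaleD \<phi> (x + y) z = R_mult scaleD \<phi> x z + R_mult scaleD \<phi> y z"
  "R_mult scaleD \<phi> z (x + y) = R_mult scaleD \<phi> z x + R_mult scaleD \<phi> z y"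
  "L_scale scaleD c (x + y) = L_scale scaleD c x + L_scale scaleD c y"
  using R_mult_diff_left[of x "- y"] R_mult_diff_left[of 0 y]
    R_mult_diff_right[of _ x "- y"] R_mult_diff_right[of _ 0 y]
    L_scale_diff[of _ x "- y"] L_scale_diff[of _ 0 y] by (simp_all add: R_mult_zero)

lemma vector_space_L: "vector_space (L_scale scaleD :: complex \<Rightarrow> ('g, 'd) tensor \<Rightarrow> _)"
proof
  fix c c' and x y :: "('g, 'd) tensor"
  show "L_scale scaleD c (x + y) = L_scale scaleD c x + L_scale scaleD c y"
    by (rule R_mult_add)
  show "L_scale scaleD (c + c') x = L_scale scaleD c x + L_scale scaleD c' x"
    by (induction x rule: tensor_induct)
       (simp_all add: R_mult_zero L_scale_pure L_scale_diff scale_left_distrib pure_tensor_add_right)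
  show "L_scale scaleD c (L_scale scaleD c' x) = L_scale scaleD (c * c') x"
    by (induction x rule: tensor_induct) (simp_all add: R_mult_zero L_scale_pure L_scale_diff)
  show "L_scale scaleD 1 x = x"
    by (induction x rule: tensor_induct) (simp_all add: R_mult_zero L_scale_pure L_scale_diff)
qed

lemma R_mult_scale:
  "R_mult scaleD \<phi> (L_scale scaleD c x) y = L_scale scaleD c (R_mult scaleD \<phi> x y)"
  "R_mult scaleD \<phi> x (L_scale scaleD c y) = L_scale scaleD c (R_mult scaleD \<phi> x y)"
proof -
  have 1: "R_mult scaleD \<phi> (a \<otimes>\<^sub>Z scaleD c d) y = L_scale scaleD c (R_mult scaleD \<phi> (a \<otimes>\<^sub>Z d) y)" for a d
    by (induction y rule: tensor_induct)
       (simp_all add: R_mult_zero R_mult_pure R_mult_diff_right L_scale_diff L_scale_pure pair_scale)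
  show "R_mult scaleD \<phi> (L_scale scaleD c x) y = L_scale scaleD c (R_mult scaleD \<phi> x y)"
    by (induction x rule: tensor_induct)
       (simp_all add: R_mult_zero 1 R_mult_diff_left L_scale_diff L_scale_pure)
  have 2: "R_mult scaleD \<phi> (a \<otimes>\<^sub>Z d) (L_scale scaleD c y) = L_scale scaleD c (R_mult scaleD \<phi> (a \<otimes>\<^sub>Z d) y)" for a d
    by (induction y rule: tensor_induct)
       (simp_all add: R_mult_zero R_mult_pure R_mult_diff_right L_scale_diff L_scale_pure mult.commute)
  show "R_mult scaleD \<phi> x (L_scale scaleD c y) = L_scale scaleD c (R_mult scaleD \<phi> x y)"
    by (induction x rule: tensor_induct)
       (simp_all add: R_mult_zero 2 R_mult_diff_left L_scale_diff)
qed

lemma R_mult_assoc: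
  "R_mult scaleD \<phi> (R_mult scaleD \<phi> x y) z = R_mult scaleD \<phi> x (R_mult scaleD \<phi> y z)"
proof (induction x rule: tensor_induct)
  case (pure a d)
  show ?case
  proof (induction y rule: tensor_induct)
    case (pure b e)
    show ?case
      by (induction z rule: tensor_induct)
         (simp_all add: R_mult_zero R_mult_pure R_mult_diff_right pair_scale mult.commute)
  qed (simp_all add: R_mult_zero R_mult_diff_left R_mult_diff_right)
qed (simp_all add: R_mult_zero R_mult_diff_left)

theorem lie_algebra_L: "lie_algebra (L_scale scaleD) (L_bracket scaleD \<phi>)"
proof -
  interpret L: vector_space "L_scale scaleD :: complex \<Rightarrow> ('g, 'd) tensor \<Rightarrow> _"
    by (rule vector_space_L)
  show ?thesis
    by unfold_locales
       (simp_all add: L_bracket_def R_mult_add R_mult_scale R_mult_assoc R_mult_diff_left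
         R_mult_diff_right L.scale_right_diff_distrib)
qed

end

text \<open>Bilinear extension on finitely supported functions.\<close>

lemma pm_induct [case_names zero single diff]:
  fixes p :: "'k \<Rightarrow>\<^sub>0 'x::ab_group_add"
  assumes zero: "P 0" and single: "\<And>k x. P (Poly_Mapping.single k x)"
    and diff: "\<And>p q. P p \<Longrightarrow> P q \<Longrightarrow> P (p - q)"
  shows "P p"
proof -
  have add: "P (p + q)" if "P p" "P q" for p q
    using diff[OF that(1) diff[OF zero that(2)]] by simp
  have "P (\<Sum>k\<in>K. Poly_Mapping.single k (Poly_Mapping.lookup p k))" if "finite K" for K
    using that by induction (simp_all add: zero single add)
  moreover have "(\<Sum>k\<in>Poly_Mapping.keys p. Poly_Mapping.single k (Poly_Mapping.lookup p k)) = p"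
    by (rule poly_mapping_eqI) (simp add: lookup_sum lookup_single when_def in_keys_iff)
  ultimately show ?thesis by (metis finite_keys)
qed

lemma pm_sum_keys:
  fixes h :: "'k \<Rightarrow> 'x::ab_group_add \<Rightarrow> 'y::ab_group_add"
  assumes "\<And>k. h k 0 = 0" "finite K" "Poly_Mapping.keys p \<subseteq> K"
  shows "(\<Sum>k\<in>Poly_Mapping.keys p. h k (Poly_Mapping.lookup p k)) = (\<Sum>k\<in>K. h k (Poly_Mapping.lookup p k))"
  using assms by (intro sum.mono_neutral_left) (auto simp: in_keys_iff)

lemma pm_ext:
  fixes h :: "'k \<Rightarrow> 'x::ab_group_add \<Rightarrow> 'y::ab_group_add"
  assumes h: "\<And>k x y. h k (x - y) = h k x - h k y"
  defines "F \<equiv> \<lambda>p. \<Sum>k\<in>Poly_Mapping.keys p. h k (Poly_Mapping.lookup p k)"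
  shows "F (Poly_Mapping.single k x) = h k x" "F (p - q) = F p - F q"
proof -
  have h0: "h k 0 = 0" for k using h[of k 0 0] by simp
  show "F (Poly_Mapping.single k x) = h k x"
    unfolding F_def by (subst pm_sum_keys[where K = "{k}"]) (auto simp: h0)
  let ?K = "Poly_Mapping.keys p \<union> Poly_Mapping.keys q"
  have "Poly_Mapping.keys (p - q) \<subseteq> ?K" by (auto simp: in_keys_iff lookup_minus)
  then have "F (p - q) = (\<Sum>k\<in>?K. h k (Poly_Mapping.lookup (p - q) k))"
    unfolding F_def by (intro pm_sum_keys h0) auto
  also have "\<dots> = (\<Sum>k\<in>?K. h k (Poly_Mapping.lookup p k)) - (\<Sum>k\<in>?K. h k (Poly_Mapping.lookup q k))"
    by (simp add: lookup_minus h sum_subtractf)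
  also have "\<dots> = F p - F q"
    unfolding F_def by (intro arg_cong2[where f = "(-)"] pm_sum_keys[symmetric] h0) auto
  finally show "F (p - q) = F p - F q" .
qed

lemma single_diff:
  "Poly_Mapping.single k (x - y) = Poly_Mapping.single k x - Poly_Mapping.single k (y::'x::ab_group_add)"
  by (rule poly_mapping_eqI) (simp add: lookup_minus lookup_single when_def)

lemma pm_ext2:
  fixes h :: "'k \<Rightarrow> 'l \<Rightarrow> 'x::ab_group_add \<Rightarrow> 'z::ab_group_add \<Rightarrow> 'y::ab_group_add"
  assumes 1: "\<And>k l x y z. h k l (x - y) z = h k l x z - h k l y z"
    and 2: "\<And>k l x y z. h k l z (x - y) = h k l z x - h k l z y"
  defines "F \<equiv> \<lambda>p q. \<Sum>k\<in>Poly_Mapping.keys p. \<Sum>l\<in>Poly_Mapping.keys q.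
      h k l (Poly_Mapping.lookup p k) (Poly_Mapping.lookup q l)"
  shows "F (Poly_Mapping.single k x) (Poly_Mapping.single l z) = h k l x z"
    "F (p - p') q = F p q - F p' q" "F p (q - q') = F p q - F p q'"
proof -
  show A: "F (p - p') q = F p q - F p' q" for p p' q
    unfolding F_def by (subst pm_ext(2)[where h = "\<lambda>k x. \<Sum>l\<in>Poly_Mapping.keys q. h k l x (Poly_Mapping.lookup q l)"])
      (simp_all add: 1 sum_subtractf)
  have B: "F (Poly_Mapping.single k x) q = (\<Sum>l\<in>Poly_Mapping.keys q. h k l x (Poly_Mapping.lookup q l))" for k x q
    unfolding F_def by (subst pm_ext(1)[where h = "\<lambda>k x. \<Sum>l\<in>Poly_Mapping.keys q. h k l x (Poly_Mapping.lookup q l)"])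
      (simp_all add: 1 sum_subtractf)
  show "F (Poly_Mapping.single k x) (Poly_Mapping.single l z) = h k l x z"
    unfolding B by (rule pm_ext(1)) (rule 2)
  have C: "F (Poly_Mapping.single k x) (q - q') = F (Poly_Mapping.single k x) q - F (Poly_Mapping.single k x) q'" for k x
    unfolding B by (rule pm_ext(2)) (rule 2)
  have Z: "F 0 r = 0" for r using A[of 0 0] by simp
  show "F p (q - q') = F p q - F p q'"
    by (induction p rule: pm_induct) (simp_all add: Z C A)
qed

lemma fscale_lookup:
  assumes "s c 0 = 0"
  shows "Poly_Mapping.lookup (fscale s c p) k = s c (Poly_Mapping.lookup p k)"
  using assms by (simp add: fscale_def Poly_Mapping.map.rep_eq when_def)

lemma vector_space_fscale:
  assumes "vector_space s"
  shows "vector_space (fscale s)"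
proof -
  interpret vector_space s by fact
  show ?thesis
    by unfold_locales (auto intro!: poly_mapping_eqI simp: fscale_lookup lookup_add
      scale_right_distrib scale_left_distrib)
qed

lemma fscale_single: "s c 0 = 0 \<Longrightarrow> fscale s c (Poly_Mapping.single k x) = Poly_Mapping.single k (s c x)"
  by (simp add: fscale_def Poly_Mapping.map_single)

context pairing
begin

lemma pair_diff: "\<phi> a (d - e) = \<phi> a d - \<phi> a e"
  using pair_add[of a "d - e" e] by (simp add: algebra_simps)

lemma W_bracket_single: "W_bracket scaleD \<phi> (Poly_Mapping.single a d) (Poly_Mapping.single b e) =
    Poly_Mapping.single (a + b) (scaleD (\<phi> b d) e - scaleD (\<phi> a e) d)"
  and W_bracket_diff:
    "W_bracket scaleD \<phi> (p - p') q = W_bracket scaleD \<phi> p q - W_bracket scaleD \<phi> p' q"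
    "W_bracket scaleD \<phi> p (q - q') = W_bracket scaleD \<phi> p q - W_bracket scaleD \<phi> p q'"
  unfolding W_bracket_def Let_def
  by (rule pm_ext2[where h = "\<lambda>a b d e. Poly_Mapping.single (a + b) (scaleD (\<phi> b d) e - scaleD (\<phi> a e) d)"];
      simp add: pair_diff scale_left_diff_distrib scale_right_diff_distrib algebra_simps
        flip: single_diff)+

lemma W_bracket_zero: "W_bracket scaleD \<phi> 0 p = 0" "W_bracket scaleD \<phi> p 0 = 0"
  using W_bracket_diff(1)[of 0 0] W_bracket_diff(2)[of _ 0 0] by simp_all

lemma W_bracket_add:
    "W_bracket scaleD \<phi> (p + p') q = W_bracket scaleD \<phi> p q + W_bracket scaleD \<phi> p' q"
    "W_bracket scaleD \<phi> p (q + q') = W_bracket scaleD \<phi> p q + W_bracket scaleD \<phi> p q'"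
  using W_bracket_diff(1)[of p "- p'"] W_bracket_diff(1)[of 0 p']
    W_bracket_diff(2)[of p q "- q'"] W_bracket_diff(2)[of p 0 q'] by (simp_all add: W_bracket_zero)

lemma W_bracket_anti: "W_bracket scaleD \<phi> q p = - W_bracket scaleD \<phi> p q"
proof (induction p rule: pm_induct)
  case (single a d)
  show ?case
    by (induction q rule: pm_induct)
      (simp_all add: W_bracket_zero W_bracket_single W_bracket_diff add.commute flip: single_uminus)
qed (simp_all add: W_bracket_zero W_bracket_diff)

theorem lie_algebra_W: "lie_algebra (fscale scaleD) (W_bracket scaleD \<phi>)"
proof -
  interpret F: vector_space "fscale scaleD :: complex \<Rightarrow> ('g \<Rightarrow>\<^sub>0 'd) \<Rightarrow> _"
    by (rule vector_space_fscale) unfold_locales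
  have sc: "W_bracket scaleD \<phi> (fscale scaleD c p) q = fscale scaleD c (W_bracket scaleD \<phi> p q)" for c p q
  proof (induction p rule: pm_induct)
    case (single a d)
    show ?case
      by (induction q rule: pm_induct)
        (simp_all add: W_bracket_zero W_bracket_single W_bracket_diff fscale_single pair_scale
          F.scale_right_diff_distrib scale_right_diff_distrib mult.commute)
  qed (simp_all add: W_bracket_zero W_bracket_diff F.scale_right_diff_distrib)
  have sc': "W_bracket scaleD \<phi> q (fscale scaleD c p) = fscale scaleD c (W_bracket scaleD \<phi> q p)" for c p q
    using sc[of c p q] W_bracket_anti[of q p] W_bracket_anti[of q "fscale scaleD c p"]
    by (simp add: F.scale_minus_right)
  have self: "W_bracket scaleD \<phi> p p = 0" for p
  proof (induction p rule: pm_induct)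
    case (diff p q)
    then show ?case using W_bracket_anti[of p q] by (simp add: W_bracket_diff)
  qed (simp_all add: W_bracket_zero W_bracket_single)
  have jac: "W_bracket scaleD \<phi> x (W_bracket scaleD \<phi> y z) + W_bracket scaleD \<phi> y (W_bracket scaleD \<phi> z x)
       + W_bracket scaleD \<phi> z (W_bracket scaleD \<phi> x y) = 0" (is "?J x y z = 0") for x y z
  proof -
    have J1: "?J (x - x') y z = ?J x y z - ?J x' y z" for x x' y z by (simp add: W_bracket_diff)
    have J2: "?J x (y - y') z = ?J x y z - ?J x y' z" for x y' y z by (simp add: W_bracket_diff)
    have J3: "?J x y (z - z') = ?J x y z - ?J x y z'" for x z' y z by (simp add: W_bracket_diff)
    show ?thesis
    proof (induction x rule: pm_induct)
      case (single a d)
      show ?case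
      proof (induction y rule: pm_induct)
        case (single b e)
        show ?case
        proof (induction z rule: pm_induct)
          case (single c f)
          have *: "c + (a + b) = a + (b + c)" "b + (c + a) = a + (b + c)" by (simp_all add: add_ac)
          show ?case
            by (simp add: W_bracket_single * pair_diff pair_scale additive_left
               scale_left_distrib scale_right_diff_distrib scale_left_diff_distrib
               mult.commute algebra_simps flip: single_add)
        qed (simp only: J3 W_bracket_zero diff_self add_0; simp)+
      qed (simp only: J2 W_bracket_zero diff_self add_0; simp)+
    qed (simp only: J1 W_bracket_zero diff_self add_0; simp)+
  qed
  show ?thesis
    by unfold_locales (simp_all add: W_bracket_add sc sc' self jac)
qed

lemma L_bracket_pure: "L_bracket scaleD \<phi> (a \<otimes>\<^sub>Z d) (b \<otimes>\<^sub>Z e) =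
    a \<otimes>\<^sub>Z scaleD (\<phi> b d) e - b \<otimes>\<^sub>Z scaleD (\<phi> a e) d"
  by (simp add: L_bracket_def R_mult_pure)

theorem lie_module_Gamma:
  fixes scaleV :: "complex \<Rightarrow> 'v::ab_group_add \<Rightarrow> 'v"
  assumes V: "lie_module (L_scale scaleD) (L_bracket scaleD \<phi>) scaleV \<rho>"
    and \<sigma>: "Vector_Spaces.linear scaleD (*) \<sigma>"
  shows "lie_module (fscale scaleD) (W_bracket scaleD \<phi>) (fscale scaleV) (Gamma_act \<phi> scaleV \<rho> \<sigma>)"
proof -
  interpret V: lie_module "L_scale scaleD" "L_bracket scaleD \<phi>" scaleV \<rho> by fact
  interpret W: lie_algebra "fscale scaleD" "W_bracket scaleD \<phi>" by (rule lie_algebra_W)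
  interpret F: vector_space "fscale scaleV :: complex \<Rightarrow> ('g \<Rightarrow>\<^sub>0 'v) \<Rightarrow> _"
    by (rule vector_space_fscale) unfold_locales
  interpret \<sigma>: Vector_Spaces.linear scaleD "(*)" \<sigma> by fact
  have l: "\<rho> (x + y) v = \<rho> x v + \<rho> y v" "\<rho> (x - y) v = \<rho> x v - \<rho> y v"
      "\<rho> (L_scale scaleD c x) v = scaleV c (\<rho> x v)" "\<rho> 0 v = 0" for x y v c
  proof -
    interpret A: Vector_Spaces.linear "L_scale scaleD" scaleV "\<lambda>x. \<rho> x v" by (rule V.act_linear_left)
    show "\<rho> (x + y) v = \<rho> x v + \<rho> y v" "\<rho> (x - y) v = \<rho> x v - \<rho> y v"
      "\<rho> (L_scale scaleD c x) v = scaleV c (\<rho> x v)" "\<rho> 0 v = 0"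
      by (rule A.add A.diff A.scale A.zero)+
  qed
  have r: "\<rho> x (v + w) = \<rho> x v + \<rho> x w" "\<rho> x (v - w) = \<rho> x v - \<rho> x w"
      "\<rho> x (scaleV c v) = scaleV c (\<rho> x v)" "\<rho> x 0 = 0" for x v w c
  proof -
    interpret A: Vector_Spaces.linear scaleV scaleV "\<rho> x" by (rule V.act_linear_right)
    show "\<rho> x (v + w) = \<rho> x v + \<rho> x w" "\<rho> x (v - w) = \<rho> x v - \<rho> x w"
      "\<rho> x (scaleV c v) = scaleV c (\<rho> x v)" "\<rho> x 0 = 0"
      by (rule A.add A.diff A.scale A.zero)+
  qed
  have tz: "a \<otimes>\<^sub>Z (0::'d) = 0" for a :: 'g using pure_tensor_add_right[of a 0 0] by simp
  have td: "a \<otimes>\<^sub>Z (d - e) = a \<otimes>\<^sub>Z d - a \<otimes>\<^sub>Z (e::'d)" for a :: 'g and d e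
    using pure_tensor_add_right[of a "d - e" e] by (simp add: algebra_simps)
  let ?G = "Gamma_act \<phi> scaleV \<rho> \<sigma>"
  have G: "?G (Poly_Mapping.single a d) (Poly_Mapping.single b v) =
      Poly_Mapping.single (a + b) (scaleV (\<phi> b d + \<sigma> d) v + \<rho> (a \<otimes>\<^sub>Z d) v)"
    "?G (p - p') q = ?G p q - ?G p' q" "?G p (q - q') = ?G p q - ?G p q'" for a b d v p p' q q'
    unfolding Gamma_act_def Let_def
    by (rule pm_ext2[where h = "\<lambda>a b d v. Poly_Mapping.single (a + b) (scaleV (\<phi> b d + \<sigma> d) v + \<rho> (a \<otimes>\<^sub>Z d) v)"];
        simp add: pair_diff \<sigma>.diff l r td V.V.scale_left_diff_distrib V.V.scale_right_diff_distrib
          V.V.scale_left_distrib V.V.scale_right_distrib algebra_simps flip: single_diff)+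
  have Gz: "?G 0 q = 0" "?G p 0 = 0" for p q
    using G(2)[of 0 0] G(3)[of _ 0 0] by simp_all
  have Ga: "?G (p + p') q = ?G p q + ?G p' q" "?G p (q + q') = ?G p q + ?G p q'" for p p' q q'
    using G(2)[of p "- p'"] G(2)[of 0 p'] G(3)[of p q "- q'"] G(3)[of p 0 q'] by (simp_all add: Gz)
  have s1: "?G (fscale scaleD c p) q = fscale scaleV c (?G p q)" for c p q
  proof (induction p rule: pm_induct)
    case (single a d)
    show ?case
      by (induction q rule: pm_induct)
        (simp_all add: G Gz fscale_single F.scale_right_diff_distrib V.V.scale_right_distrib
          pair_scale \<sigma>.scale l flip: L_scale_pure distrib_left)
  qed (simp_all add: G Gz F.scale_right_diff_distrib W.scale_right_diff_distrib)
  have s2: "?G p (fscale scaleV c q) = fscale scaleV c (?G p q)" for c p q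
  proof (induction p rule: pm_induct)
    case (single a d)
    show ?case
      by (induction q rule: pm_induct)
        (simp_all add: G Gz fscale_single F.scale_right_diff_distrib V.V.scale_right_distrib
          r mult.commute)
  qed (simp_all add: G Gz F.scale_right_diff_distrib)
  have br: "?G (W_bracket scaleD \<phi> x y) z = ?G x (?G y z) - ?G y (?G x z)" for x y z
  proof (induction x rule: pm_induct)
    case (single a d)
    show ?case
    proof (induction y rule: pm_induct)
      case (single b e)
      show ?case
      proof (induction z rule: pm_induct)
        case (single c v)
        have *: "b + (a + c) = a + (b + c)" "a + b + c = a + (b + c)" by (simp_all add: add_ac)
        have "scaleV (\<phi> c (scaleD (\<phi> b d) e - scaleD (\<phi> a e) d) + \<sigma> (scaleD (\<phi> b d) e - scaleD (\<phi> a e) d)) v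
            + \<rho> ((a + b) \<otimes>\<^sub>Z (scaleD (\<phi> b d) e - scaleD (\<phi> a e) d)) v =
           (scaleV (\<phi> (b + c) d + \<sigma> d) (scaleV (\<phi> c e + \<sigma> e) v + \<rho> (b \<otimes>\<^sub>Z e) v)
              + \<rho> (a \<otimes>\<^sub>Z d) (scaleV (\<phi> c e + \<sigma> e) v + \<rho> (b \<otimes>\<^sub>Z e) v)) -
           (scaleV (\<phi> (a + c) e + \<sigma> e) (scaleV (\<phi> c d + \<sigma> d) v + \<rho> (a \<otimes>\<^sub>Z d) v)
              + \<rho> (b \<otimes>\<^sub>Z e) (scaleV (\<phi> c d + \<sigma> d) v + \<rho> (a \<otimes>\<^sub>Z d) v))"
          using V.act_bracket[of "a \<otimes>\<^sub>Z d" "b \<otimes>\<^sub>Z e" v]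
          by (simp add: L_bracket_pure pair_diff pair_scale \<sigma>.diff \<sigma>.scale additive_left
             pure_tensor_add_left td l r
             V.V.scale_left_diff_distrib V.V.scale_right_diff_distrib
             V.V.scale_left_distrib V.V.scale_right_distrib algebra_simps flip: L_scale_pure)
        then show ?case
          by (simp add: W_bracket_single G * flip: single_diff)
      qed (simp_all add: G Gz)
    qed (simp_all add: G Gz W_bracket_diff W_bracket_zero)
  qed (simp_all add: G Gz W_bracket_diff W_bracket_zero)
  show ?thesis
    by unfold_locales (simp_all add: Ga s1 s2 br)
qed

text \<open>The action on functionals.\<close>

lemma L_dual_act:
  assumes "\<And>d e. g (d + e) = g d + g e"
  shows "L_dual_act \<phi> (a \<otimes>\<^sub>Z d) g = (\<lambda>e. g d * \<phi> a e)"
    and "L_dual_act \<phi> (x - y) g = L_dual_act \<phi> x g - L_dual_act \<phi> y g"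
proof -
  define H where "H p e = (\<Sum>z\<in>Poly_Mapping.keys p. of_int (Poly_Mapping.lookup p z) * (g (snd z) * \<phi> (fst z) e))"
    for p :: "('g \<times> 'd) \<Rightarrow>\<^sub>0 int" and e
  have H1: "H (frag_of z) e = g (snd z) * \<phi> (fst z) e" for z e
    by (simp add: H_def keys_frag_of)
  have H2: "H (p - q) e = H p e - H q e" for p q e
    unfolding H_def
    by (rule pm_ext(2)[where h = "\<lambda>z n. of_int n * (g (snd z) * \<phi> (fst z) e)"])
       (simp add: algebra_simps)
  have H0: "H p e = 0" if "p \<in> tensor_null" for p e
    using that
  proof induction
    case null_zero
    then show ?case by (simp add: H_def)
  qed (simp_all add: H2 H1 assms additive_left ring_distribs)
  have L: "L_dual_act \<phi> (abs_tensor p) g = H p" for p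
  proof
    fix e
    have "L_dual_act \<phi> (abs_tensor p) g e = H (rep_tensor (abs_tensor p)) e"
      by (simp add: L_dual_act_def H_def case_prod_beta)
    also have "\<dots> = H p e"
      using H0[OF rep_tensor_diff[of p], of e] by (simp add: H2)
    finally show "L_dual_act \<phi> (abs_tensor p) g e = H p e" .
  qed
  show "L_dual_act \<phi> (a \<otimes>\<^sub>Z d) g = (\<lambda>e. g d * \<phi> a e)"
    by (simp add: pure_tensor_def L fun_eq_iff H1)
  have "L_dual_act \<phi> (abs_tensor p - abs_tensor q) g = L_dual_act \<phi> (abs_tensor p) g - L_dual_act \<phi> (abs_tensor q) g" for p q
    by (simp add: L H2 fun_eq_iff flip: abs_tensor_diff)
  from this[of "rep_tensor x" "rep_tensor y"]
  show "L_dual_act \<phi> (x - y) g = L_dual_act \<phi> x g - L_dual_act \<phi> y g"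
    by (simp only: Quotient3_abs_rep[OF Quotient3_tensor])
qed

end

end

theory Submission
  imports Defs "HOL-Library.Multiset"
begin

text \<open>
  The weights of \<open>t\<^sup>0 D\<close> separate the degrees, so a submodule is a family of subspaces
  \<open>M\<^sub>b \<subseteq> V\<close>, and the intersection of these subspaces is an \<open>L\<close>-submodule of \<open>V\<close>.

  If \<open>V\<close> is an exterior power, spanned by \<open>H(x\<^sub>1, \<dots>, x\<^sub>i)\<close>, then for \<open>i > 0\<close> the
  spaces \<open>M\<^sub>b = (b + \<sigma>) \<and> \<dots>\<close> define a proper submodule.  If all of them were zero, then
  \<open>H = 0\<close> since \<open>G\<close> spans the dual space.  If \<open>M\<^sub>b = V\<close> for all \<open>b\<close>, then \<open>a \<otimes> d\<close> acts as the scalar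
  \<open>a(d)\<close>, and the action of \<open>\<Sum>\<^sub>j a\<^sub>j \<otimes> d\<^sub>j\<close> for dual bases shows \<open>i = r\<close>; and for
  \<open>\<sigma> \<in> G\<close> the space \<open>M\<^sub>b\<close> vanishes at \<open>b = - \<sigma>\<close>.

  Conversely, let a proper nonzero submodule be given.  Moving from degree \<open>b\<close> to degree \<open>c\<close> by
  \<open>t\<^sup>x d \<cdot> t\<^sup>c\<^sup>-\<^sup>b\<^sup>-\<^sup>x d'\<close> is quadratic in \<open>x\<close>, and its leading part maps every \<open>M\<^sub>b\<close> into the
  intersection of all \<open>M\<^sub>c\<close>, which is zero.  The common kernel of these leading parts is an
  \<open>L\<close>-submodule of \<open>V\<close>, so \<open>(x \<otimes> d - x(d)) (x \<otimes> d') = 0\<close> holds on \<open>V\<close>.  This relation makes the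
  normally ordered products of the operators \<open>x \<otimes> d\<close> alternating in the \<open>x\<close>, and those of
  maximal length that do not vanish on a vector of \<open>V\<close> give an isomorphism with an exterior
  power.  On the kernel of \<open>L \<rightarrow> gl\<^sub>r\<close> the relation yields ideals that act by commuting operators
  of square zero, and hence by zero, because \<open>V\<close> has finite dimension.  The conditions on
  \<open>\<sigma>\<close> exclude operators that map every \<open>M\<^sub>b\<close> to \<open>M\<^sub>c\<close> by a nonzero scalar, which would make
  all \<open>M\<^sub>b\<close> equal to their intersection.
\<close>

section \<open>Linear algebra\<close>

text \<open>Induction on the number of components: if \<open>i\<close> separates \<open>j\<close>
  from \<open>l\<close>, then \<open>D i - w i l\<close> preserves \<open>M\<close>, kills the
  component \<open>l\<close> and multiplies the component \<open>j\<close> by a nonzero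
  scalar.\<close>

lemma (in vector_space) weight_components_mem:
  assumes M: "subspace M" and inv: "\<And>i w. i \<in> I \<Longrightarrow> w \<in> M \<Longrightarrow> D i w \<in> M"
    and D: "\<And>i. i \<in> I \<Longrightarrow> Vector_Spaces.linear scale scale (D i)"
    and J: "finite J" and sep: "\<And>j l. j \<in> J \<Longrightarrow> l \<in> J \<Longrightarrow> j \<noteq> l \<Longrightarrow> \<exists>i\<in>I. w i j \<noteq> w i l"
    and eig: "\<And>i j. i \<in> I \<Longrightarrow> j \<in> J \<Longrightarrow> D i (v j) = scale (w i j) (v j)"
    and sum: "sum v J \<in> M" and j: "j \<in> J"
  shows "v j \<in> M"
  using J sep eig sum j
proof (induction "card J" arbitrary: J v)
  case 0
  then show ?case by simp
next
  case (Suc n)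
  show ?case
  proof (cases "J = {j}")
    case True
    then show ?thesis using Suc.prems by simp
  next
    case False
    then obtain l where l: "l \<in> J" "l \<noteq> j" using Suc.prems by blast
    then obtain i where i: "i \<in> I" "w i j \<noteq> w i l" using Suc.prems(2) \<open>j \<in> J\<close> by metis
    interpret D: Vector_Spaces.linear scale scale "D i" by (rule D[OF i(1)])
    define v' where "v' m = scale (w i m - w i l) (v m)" for m
    have "sum v' (J - {l}) = sum v' J"
      using l Suc.prems(1) by (intro sum.mono_neutral_left) (auto simp: v'_def)
    also have "\<dots> = D i (sum v J) - scale (w i l) (sum v J)"
      using Suc.prems(3)[OF i(1)]
      by (simp add: v'_def scale_left_diff_distrib sum_subtractf D.sum scale_sum_right)
    also have "\<dots> \<in> M"
      using Suc.prems(4) by (intro subspace_diff M inv i(1) subspace_scale)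
    finally have s: "sum v' (J - {l}) \<in> M" .
    have "v' j \<in> M"
    proof (rule Suc.hyps(1)[OF _ _ _ _ s])
      show "n = card (J - {l})" using Suc.hyps(2) l by (simp add: Suc.prems(1))
      show "finite (J - {l})" using Suc.prems(1) by simp
      show "\<exists>i\<in>I. w i ja \<noteq> w i la" if "ja \<in> J - {l}" "la \<in> J - {l}" "ja \<noteq> la" for ja la
        using that Suc.prems(2) by simp
      show "D i (v' j) = scale (w i j) (v' j)" if i: "i \<in> I" and j: "j \<in> J - {l}" for i j
      proof -
        interpret Di: Vector_Spaces.linear scale scale "D i" by (rule D[OF i])
        show ?thesis using i j Suc.prems(3) by (simp add: v'_def Di.scale mult.commute)
      qed
      show "j \<in> J - {l}" using l Suc.prems by simp
    qed
    then have "scale (inverse (w i j - w i l)) (v' j) \<in> M"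
      by (rule subspace_scale[OF M])
    then show ?thesis using i(2) by (simp add: v'_def)
  qed
qed

text \<open>In a nonzero \<open>T\<close>-stable subspace of least dimension the kernel of each
  \<open>t\<close> is again nonzero, because \<open>t\<close> squares to zero, and stable, because
  the operators commute. Minimality makes this kernel the whole subspace.\<close>

lemma (in finite_dimensional_vector_space) commuting_square_zero_common_kernel:
  assumes lin: "\<And>t. t \<in> T \<Longrightarrow> Vector_Spaces.linear scale scale t"
    and comm: "\<And>s t v. s \<in> T \<Longrightarrow> t \<in> T \<Longrightarrow> s (t v) = t (s v)"
    and sq: "\<And>t v. t \<in> T \<Longrightarrow> t (t v) = 0"
    and nz: "(v0 :: 'b) \<noteq> 0"
  shows "\<exists>v. v \<noteq> 0 \<and> (\<forall>t\<in>T. t v = 0)"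
proof -
  define P where "P W \<longleftrightarrow> subspace W \<and> W \<noteq> {0} \<and> (\<forall>t\<in>T. \<forall>w\<in>W. t w \<in> W)" for W
  have "UNIV \<noteq> {0 :: 'b}" using nz by (metis UNIV_I singletonD)
  then have "P UNIV" by (simp add: P_def)
  then obtain W where W: "P W" and min: "\<And>W'. P W' \<Longrightarrow> dim W \<le> dim W'"
    using ex_has_least_nat[of P UNIV dim] by blast
  have sub: "subspace W" using W by (simp add: P_def)
  obtain w where w: "w \<in> W" "w \<noteq> 0"
    using W subspace_0[OF sub] unfolding P_def by blast
  have "t w = 0" if t: "t \<in> T" for t
  proof -
    interpret t: Vector_Spaces.linear scale scale t by (rule lin[OF t])
    let ?W = "W \<inter> {v. t v = 0}"
    have s: "subspace ?W"
      using sub by (auto simp: subspace_def t.add t.scale t.zero)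
    have "\<exists>u\<in>?W. u \<noteq> 0"
    proof (cases "t w = 0")
      case False
      then show ?thesis using W w t sq by (intro bexI[of _ "t w"]) (auto simp: P_def)
    qed (use w in auto)
    moreover have "\<forall>s\<in>T. \<forall>u\<in>?W. s u \<in> ?W"
    proof (intro ballI IntI CollectI)
      fix s u assume s: "s \<in> T" and u: "u \<in> ?W"
      interpret s: Vector_Spaces.linear scale scale s by (rule lin[OF s])
      show "s u \<in> W" using W s u by (auto simp: P_def)
      show "t (s u) = 0" using comm[OF t s] u s.zero by simp
    qed
    ultimately have "P ?W" using s unfolding P_def by blast
    from min[OF this] have "?W = W" by (intro subspace_dim_equal s sub) auto
    then show ?thesis using w by blast
  qed
  then show ?thesis using w by blast
qed

section \<open>Alternating multilinear maps modulo a subspace\<close>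

lemma not_distinct_if_nth_eq:
  "i < length xs \<Longrightarrow> j < length xs \<Longrightarrow> i \<noteq> j \<Longrightarrow> xs ! i = xs ! j \<Longrightarrow> \<not> distinct xs"
  by (auto simp: nth_eq_iff_index_eq)

text \<open>Working modulo \<open>N\<close> covers both honest alternating maps, where
  \<open>N = {0}\<close>, and the generators of the free space, which are alternating only up to the
  relations of the exterior power.\<close>

locale alternating_mod = X: vector_space sX + U: vector_space sU
  for sX :: "complex \<Rightarrow> 'x::ab_group_add \<Rightarrow> 'x"
    and sU :: "complex \<Rightarrow> 'u::ab_group_add \<Rightarrow> 'u" +
  fixes U :: "'u set" and n :: nat and N :: "'x set" and B :: "'u list \<Rightarrow> 'x"
  assumes U: "U.subspace U" and N: "X.subspace N"
    and add_slot: "us \<in> tuples n U \<Longrightarrow> k < n \<Longrightarrow> u \<in> U \<Longrightarrow> v \<in> U \<Longrightarrow>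
      B (us[k := u + v]) - B (us[k := u]) - B (us[k := v]) \<in> N"
    and scale_slot: "us \<in> tuples n U \<Longrightarrow> k < n \<Longrightarrow> u \<in> U \<Longrightarrow>
      B (us[k := sU c u]) - sX c (B (us[k := u])) \<in> N"
    and alt: "us \<in> tuples n U \<Longrightarrow> \<not> distinct us \<Longrightarrow> B us \<in> N"
begin

lemma update_mem: "us \<in> tuples n U \<Longrightarrow> u \<in> U \<Longrightarrow> us[k := u] \<in> tuples n U"
  by (auto simp: tuples_def dest: set_update_subset_insert[THEN subsetD])

lemma nth_mem_U: "us \<in> tuples n U \<Longrightarrow> k < n \<Longrightarrow> us ! k \<in> U"
  by (auto simp: tuples_def)

lemma mem_cong: "x - y \<in> N \<Longrightarrow> x \<in> N \<longleftrightarrow> y \<in> N"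
  using X.subspace_add[OF N, of "x - y" y] X.subspace_diff[OF N, of x "x - y"] by auto

lemma zero_slot: "us \<in> tuples n U \<Longrightarrow> k < n \<Longrightarrow> B (us[k := 0]) \<in> N"
  using scale_slot[of us k 0 0] U.subspace_0[OF U] by simp

lemma sum_slot:
  assumes us: "us \<in> tuples n U" "k < n" and w: "finite I" "\<And>j. j \<in> I \<Longrightarrow> w j \<in> U"
  shows "B (us[k := (\<Sum>j\<in>I. sU (c j) (w j))]) - (\<Sum>j\<in>I. sX (c j) (B (us[k := w j]))) \<in> N"
  using w
proof induction
  case empty
  then show ?case using zero_slot[OF us] by simp
next
  case (insert i I)
  have "sU (c i) (w i) \<in> U" "(\<Sum>j\<in>I. sU (c j) (w j)) \<in> U"
    using insert.prems by (auto intro!: U.subspace_scale[OF U] U.subspace_sum[OF U])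
  from X.subspace_add[OF N X.subspace_add[OF N add_slot[OF us this] scale_slot[OF us, of "w i" "c i"]]
      insert.IH]
  show ?case using insert by (simp add: algebra_simps)
qed

text \<open>Polarisation: with \<open>u + v\<close> in both slots the value lies in
  \<open>N\<close>, and additivity splits it into the two mixed terms and two terms with a repeated
  entry.\<close>

lemma swap_slots:
  assumes us: "us \<in> tuples n U" and ij: "i < n" "j < n" "i \<noteq> j" and u: "u \<in> U" "v \<in> U"
  shows "B (us[i := u, j := v]) + B (us[i := v, j := u]) \<in> N"
proof -
  have uv: "u + v \<in> U" using U.subspace_add[OF U] u .
  have nd: "B (us[i := w, j := w]) \<in> N" if "w \<in> U" for w
    using that us ij
    by (intro alt update_mem not_distinct_if_nth_eq[of i _ j]) (auto simp: tuples_def)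
  note t = update_mem[OF us]
  have A: "B (us[i := u + v, j := u + v]) - B (us[i := u + v, j := u]) - B (us[i := u + v, j := v]) \<in> N"
    using add_slot[OF t[OF uv] ij(2) u] .
  have C: "B (us[i := u + v, j := w]) - B (us[i := u, j := w]) - B (us[i := v, j := w]) \<in> N"
    if "w \<in> U" for w
    using add_slot[OF t[OF that, of j] ij(1) u] ij(3) by (simp add: list_update_swap)
  have "B (us[i := u, j := v]) + B (us[i := v, j := u]) =
     B (us[i := u + v, j := u + v])
     - (B (us[i := u + v, j := u + v]) - B (us[i := u + v, j := u]) - B (us[i := u + v, j := v]))
     - (B (us[i := u + v, j := u]) - B (us[i := u, j := u]) - B (us[i := v, j := u]))
     - (B (us[i := u + v, j := v]) - B (us[i := u, j := v]) - B (us[i := v, j := v]))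
     - B (us[i := u, j := u]) - B (us[i := v, j := v])"
    by simp
  also have "\<dots> \<in> N"
    by (intro X.subspace_diff N nd uv u A C)
  finally show ?thesis .
qed

text \<open>Modulo \<open>N\<close> a transposition only changes the sign, which membership in
  \<open>N\<close> does not see. The prefix \<open>pre\<close> collects the entries that already
  agree, and one swap brings the wanted entry to the next place.\<close>

lemma permute_mem:
  assumes "mset xs = mset ys" "pre @ xs \<in> tuples n U" "B (pre @ xs) \<in> N"
  shows "B (pre @ ys) \<in> N"
  using assms
proof (induction ys arbitrary: xs pre)
  case (Cons y ys)
  have "y \<in> set xs" using Cons.prems(1) by (metis list.set_intros(1) mset_eq_setD)
  show ?case
  proof (cases xs)
    case Nil
    then show ?thesis using Cons.prems by simp
  next
    case (Cons x xs')
    note xs = this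
    show ?thesis
    proof (cases "x = y")
      case True
      then show ?thesis using Cons.IH[of xs' "pre @ [y]"] Cons.prems xs by simp
    next
      case False
      then obtain l r where xs': "xs' = l @ y # r"
        using \<open>y \<in> set xs\<close> xs by (auto dest: split_list)
      let ?i = "length pre" and ?j = "length pre + Suc (length l)"
      have us: "pre @ x # l @ y # r \<in> tuples n U" using Cons.prems(2) xs xs' by simp
      then have "?i < n" "?j < n" "x \<in> U" "y \<in> U" by (auto simp: tuples_def)
      from swap_slots[OF us this(1,2) _ this(3,4)]
      have "B (pre @ x # l @ y # r) + B (pre @ y # l @ x # r) \<in> N"
        by (simp add: list_update_append)
      moreover have "B (pre @ x # l @ y # r) \<in> N" using Cons.prems(3) xs xs' by simp
      ultimately have "B (pre @ y # l @ x # r) \<in> N"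
        using X.subspace_diff[OF N] by fastforce
      then show ?thesis using Cons.IH[of "l @ x # r" "pre @ [y]"] Cons.prems(1) us xs xs'
        by (auto simp: tuples_def)
    qed
  qed
qed simp

text \<open>Multilinearity reduces every entry to elements of \<open>E\<close>; tuples from
  \<open>E\<close> with a repetition are settled by alternation.\<close>

lemma mem_if_basis_mem:
  assumes E: "finite E" "E \<subseteq> U" "U \<subseteq> U.span E"
    and B: "\<And>xs. distinct xs \<Longrightarrow> set xs \<subseteq> E \<Longrightarrow> length xs = n \<Longrightarrow> B xs \<in> N"
    and us: "us \<in> tuples n U"
  shows "B us \<in> N"
proof -
  \<comment> \<open>The first \<open>m\<close> entries are still arbitrary and the others already
    lie in \<open>E\<close>; the last arbitrary entry is expanded first.\<close>
  have "B us \<in> N" if "m \<le> n" "us \<in> tuples n U" "set (drop m us) \<subseteq> E" for m us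
    using that
  proof (induction m arbitrary: us)
    case 0
    then show ?case using alt B by (cases "distinct us") (auto simp: tuples_def)
  next
    case (Suc m)
    have "us ! m \<in> U.span E" using nth_mem_U[of us m] Suc.prems E by auto
    then obtain c where c: "us ! m = (\<Sum>e\<in>E. sU (c e) e)"
      using U.span_finite[OF E(1)] by auto
    have "B (us[m := e]) \<in> N" if "e \<in> E" for e
    proof (rule Suc.IH)
      show "us[m := e] \<in> tuples n U" using that E Suc.prems by (intro update_mem) auto
      have "drop m (us[m := e]) = e # drop (Suc m) us"
        using Suc.prems by (simp add: tuples_def flip: Cons_nth_drop_Suc)
      then show "set (drop m (us[m := e])) \<subseteq> E" using that Suc.prems by simp
    qed (use Suc.prems in simp)
    then have "(\<Sum>e\<in>E. sX (c e) (B (us[m := e]))) \<in> N"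
      by (intro X.subspace_sum X.subspace_scale N) auto
    moreover have "B (us[m := us ! m]) - (\<Sum>e\<in>E. sX (c e) (B (us[m := e]))) \<in> N"
      unfolding c using Suc.prems E by (intro sum_slot) auto
    ultimately show ?case using mem_cong by simp
  qed
  from this[of n us] us show ?thesis by (simp add: tuples_def)
qed

lemma comp_linear:
  assumes L: "Vector_Spaces.linear sX sY L"
  shows "alternating_mod sY sU U n (L ` N) (\<lambda>us. L (B us))"
proof -
  interpret L: Vector_Spaces.linear sX sY L by fact
  show ?thesis
    by unfold_locales
      (auto intro!: imageI alt add_slot scale_slot U N L.subspace_image simp flip: L.diff L.scale)
qed

text \<open>If the entries \<open>i\<close> and \<open>j\<close> coincide, every summand that alters
  another slot still has a repetition, and the summands for \<open>i\<close> and \<open>j\<close>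
  cancel modulo \<open>N\<close> by antisymmetry.\<close>

lemma derivation:
  assumes XU: "\<And>u. u \<in> U \<Longrightarrow> X u \<in> U" and Xadd: "\<And>u v. u \<in> U \<Longrightarrow> v \<in> U \<Longrightarrow> X (u + v) = X u + X v"
    and Xscale: "\<And>c u. u \<in> U \<Longrightarrow> X (sU c u) = sU c (X u)"
  shows "alternating_mod sX sU U n N (\<lambda>us. \<Sum>l<n. B (us[l := X (us ! l)]))"
proof
  fix us k u v assume us: "us \<in> tuples n U" and k: "k < n" and u: "u \<in> U" and v: "v \<in> U"
  have len: "length us = n" using us by (simp add: tuples_def)
  have "B (us[k := u + v, l := X (us[k := u + v] ! l)]) - B (us[k := u, l := X (us[k := u] ! l)])
      - B (us[k := v, l := X (us[k := v] ! l)]) \<in> N" if l: "l < n" for l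
  proof (cases "l = k")
    case True
    then show ?thesis using add_slot[OF us k XU[OF u] XU[OF v]] k len by (simp add: Xadd[OF u v])
  next
    case False
    then show ?thesis
      using add_slot[OF update_mem[OF us XU[OF nth_mem_U[OF us l]]] k u v, of l] len l
      by (simp add: list_update_swap[of k l])
  qed
  then show "(\<Sum>l<n. B (us[k := u + v, l := X (us[k := u + v] ! l)])) -
      (\<Sum>l<n. B (us[k := u, l := X (us[k := u] ! l)])) -
      (\<Sum>l<n. B (us[k := v, l := X (us[k := v] ! l)])) \<in> N"
    by (auto intro!: X.subspace_sum[OF N] simp flip: sum_subtractf)
next
  fix us k u c assume us: "us \<in> tuples n U" and k: "k < n" and u: "u \<in> U"
  have len: "length us = n" using us by (simp add: tuples_def)
  have "B (us[k := sU c u, l := X (us[k := sU c u] ! l)]) - sX c (B (us[k := u, l := X (us[k := u] ! l)])) \<in> N"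
    if l: "l < n" for l
  proof (cases "l = k")
    case True
    then show ?thesis using scale_slot[OF us k XU[OF u]] k len by (simp add: Xscale[OF u])
  next
    case False
    then show ?thesis
      using scale_slot[OF update_mem[OF us XU[OF nth_mem_U[OF us l]]] k u, of l c] len l
      by (simp add: list_update_swap[of k l])
  qed
  then show "(\<Sum>l<n. B (us[k := sU c u, l := X (us[k := sU c u] ! l)])) -
      sX c (\<Sum>l<n. B (us[k := u, l := X (us[k := u] ! l)])) \<in> N"
    by (auto intro!: X.subspace_sum[OF N] simp: X.scale_sum_right simp flip: sum_subtractf)
next
  fix us assume us: "us \<in> tuples n U" and "\<not> distinct us"
  have len: "length us = n" using us by (simp add: tuples_def)
  obtain i j where ij: "i < n" "j < n" "i \<noteq> j" "us ! i = us ! j"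
    using \<open>\<not> distinct us\<close> len by (auto simp: distinct_conv_nth)
  let ?f = "\<lambda>l. B (us[l := X (us ! l)])"
  have "(\<Sum>l<n. ?f l) = ?f i + ?f j + (\<Sum>l\<in>{..<n} - {i, j}. ?f l)"
  proof -
    have "{..<n} = {i, j} \<union> ({..<n} - {i, j})" using ij by auto
    then have "(\<Sum>l<n. ?f l) = (\<Sum>l\<in>{i, j} \<union> ({..<n} - {i, j}). ?f l)" by simp
    also have "\<dots> = (\<Sum>l\<in>{i, j}. ?f l) + (\<Sum>l\<in>{..<n} - {i, j}. ?f l)"
      by (rule sum.union_disjoint) auto
    finally show ?thesis using ij by simp
  qed
  moreover have "?f l \<in> N" if "l \<in> {..<n} - {i, j}" for l
  proof (rule alt)
    show "us[l := X (us ! l)] \<in> tuples n U" using that us by (auto intro!: update_mem XU nth_mem_U)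
    show "\<not> distinct (us[l := X (us ! l)])"
      using that ij len by (intro not_distinct_if_nth_eq[of i _ j]) auto
  qed
  moreover have "?f i + ?f j \<in> N"
    using swap_slots[OF us ij(1,2,3) XU[OF nth_mem_U[OF us ij(2)]] nth_mem_U[OF us ij(2)]] ij len
    by (metis list_update_id list_update_swap)
  ultimately show "(\<Sum>l<n. ?f l) \<in> N"
    by (auto intro!: X.subspace_add[OF N] X.subspace_sum[OF N])
qed (rule U N)+

end

lemma alternating_mod_diff:
  assumes "alternating_mod sX sU U n N B" "alternating_mod sX sU U n N B'"
  shows "alternating_mod sX sU U n N (\<lambda>us. B us - B' us)"
proof -
  interpret A: alternating_mod sX sU U n N B by fact
  interpret A': alternating_mod sX sU U n N B' by fact
  show ?thesis
  proof
    fix us k u v assume *: "us \<in> tuples n U" "k < n" "u \<in> U" "v \<in> U"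
    from A.X.subspace_diff[OF A.N A.add_slot[OF *] A'.add_slot[OF *]]
    show "B (us[k := u + v]) - B' (us[k := u + v]) - (B (us[k := u]) - B' (us[k := u]))
        - (B (us[k := v]) - B' (us[k := v])) \<in> N" by (simp add: algebra_simps)
  next
    fix us k u c assume *: "us \<in> tuples n U" "k < n" "u \<in> U"
    from A.X.subspace_diff[OF A.N A.scale_slot[OF *, of c] A'.scale_slot[OF *, of c]]
    show "B (us[k := sU c u]) - B' (us[k := sU c u]) - sX c (B (us[k := u]) - B' (us[k := u])) \<in> N"
      by (simp add: A.X.scale_right_diff_distrib algebra_simps)
  next
    fix us assume "us \<in> tuples n U" "\<not> distinct us"
    then show "B us - B' us \<in> N" by (intro A.X.subspace_diff[OF A.N] A.alt A'.alt)
  qed (rule A.U A.N)+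
qed

section \<open>Dual systems for the pairing\<close>

lemma sum_fun_apply: "(\<Sum>i\<in>I. f i) x = (\<Sum>i\<in>I. f i x)"
  by (induction I rule: infinite_finite_induct) simp_all

abbreviation (input) fun_scale :: "complex \<Rightarrow> ('d \<Rightarrow> complex) \<Rightarrow> 'd \<Rightarrow> complex" where
  "fun_scale \<equiv> \<lambda>c g d. c * g d"

lemma vector_space_fun_scale: "vector_space fun_scale"
  by unfold_locales (auto simp: fun_eq_iff algebra_simps)

text \<open>The functionals are taken from \<open>G\<close> itself, so that
  \<open>a i \<otimes>\<^sub>Z d\<close> is an element of \<open>L\<close>. By \<open>expand\<close>
  the vectors \<open>e i\<close> span \<open>D\<close> modulo \<open>Ker2 \<phi>\<close>.\<close>

locale dual_system = pairing scaleD \<phi>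
  for scaleD :: "complex \<Rightarrow> 'd::ab_group_add \<Rightarrow> 'd"
    and \<phi> :: "'g::ab_group_add \<Rightarrow> 'd \<Rightarrow> complex" +
  fixes r :: nat and a :: "nat \<Rightarrow> 'g" and e :: "nat \<Rightarrow> 'd"
  assumes dual: "i < r \<Longrightarrow> j < r \<Longrightarrow> \<phi> (a i) (e j) = of_bool (i = j)"
    and expand: "\<phi> g d = (\<Sum>i<r. \<phi> g (e i) * \<phi> (a i) d)"

context pairing
begin

lemma pair_zero [simp]: "\<phi> 0 d = 0" "\<phi> g 0 = 0"
  using additive_left[of 0 0 d] pair_scale[of g 0 0] by simp_all

lemma pair_sum: "\<phi> g (\<Sum>i\<in>I. f i) = (\<Sum>i\<in>I. \<phi> g (f i))"
  by (induction I rule: infinite_finite_induct) (simp_all add: pair_add)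

lemma pair_uminus: "\<phi> (- g) d = - \<phi> g d"
  using additive_left[of g "- g" d] by (simp add: eq_neg_iff_add_eq_0 add.commute)

lemma pair_diff_left: "\<phi> (g - h) d = \<phi> g d - \<phi> h d"
  using additive_left[of g "- h" d] by (simp add: pair_uminus)

text \<open>A dual system of maximal size expands every pairing: otherwise the difference of both
  sides at some \<open>g\<close> and \<open>d\<close> would allow to enlarge the system.\<close>

lemma ex_dual_system:
  assumes Dbar: "subspace Dbar" "Dbar \<inter> Ker2 \<phi> = {0}" "{x + y | x y. x \<in> Dbar \<and> y \<in> Ker2 \<phi>} = UNIV"
    and fin: "finite B" "span B = Dbar" and dim: "dim Dbar = r"
  shows "\<exists>a e. dual_system scaleD \<phi> r a e"
proof -
  define Q where "Q n a e \<longleftrightarrow> (\<forall>i<n. e i \<in> Dbar) \<and> (\<forall>i<n. \<forall>j<n. \<phi> (a i) (e j) = of_bool (i = j))"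
    for n :: nat and a e
  have ind: "independent (e ` {..<n}) \<and> card (e ` {..<n}) = n" if Q: "Q n a e" for n a e
  proof -
    have dl: "\<phi> (a i) (e j) = of_bool (i = j)" if "i < n" "j < n" for i j
      using Q that by (simp add: Q_def)
    have inj: "inj_on e {..<n}"
    proof (rule inj_onI)
      fix i j assume ij: "i \<in> {..<n}" "j \<in> {..<n}" "e i = e j"
      then have "\<phi> (a i) (e i) = \<phi> (a i) (e j)" by simp
      then show "i = j" using ij(1,2) by (simp add: dl)
    qed
    have "c v = 0" if s: "(\<Sum>v\<in>e ` {..<n}. scaleD (c v) v) = 0" and v: "v \<in> e ` {..<n}" for c v
    proof -
      obtain j where j: "j < n" "v = e j" using v by auto
      have "0 = \<phi> (a j) (\<Sum>i<n. scaleD (c (e i)) (e i))"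
        using s by (simp add: sum.reindex[OF inj])
      also have "\<dots> = (\<Sum>i<n. c (e i) * of_bool (j = i))"
        by (simp add: pair_sum pair_scale dl j)
      also have "\<dots> = c v" using j by (simp add: of_bool_def if_distrib cong: if_cong)
      finally show ?thesis by simp
    qed
    then show ?thesis by (auto simp: dependent_finite card_image[OF inj])
  qed
  \<comment> \<open>Duality makes the \<open>e i\<close> independent, so their number is at most the
    size of a spanning set, and a largest system exists.\<close>
  have bound: "n \<le> card B" if "Q n a e" for n a e
  proof -
    have "e ` {..<n} \<subseteq> span B" using that fin by (auto simp: Q_def)
    from independent_span_bound[OF fin(1) _ this] ind[OF that] show ?thesis by simp
  qed
  define n where "n = (GREATEST n. \<exists>a e. Q n a e)"
  have Q0: "\<exists>a e. Q 0 a e" by (simp add: Q_def)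
  have "\<exists>a e. Q n a e"
    unfolding n_def by (rule GreatestI_nat[of "\<lambda>n. \<exists>a e. Q n a e", OF Q0]) (use bound in blast)
  moreover have max: "m \<le> n" if "Q m a e" for m a e
    unfolding n_def by (rule Greatest_le_nat[of "\<lambda>n. \<exists>a e. Q n a e"]) (use that bound in blast)+
  ultimately obtain a e where Q: "Q n a e" by blast
  have dl: "\<phi> (a i) (e j) = of_bool (i = j)" if "i < n" "j < n" for i j
    using Q that by (simp add: Q_def)
  have eD: "e i \<in> Dbar" if "i < n" for i using Q that by (simp add: Q_def)
  have ex0: "\<phi> g d = (\<Sum>i<n. \<phi> g (e i) * \<phi> (a i) d)" if d: "d \<in> Dbar" for g d
  proof (rule ccontr)
    assume ne: "\<not> ?thesis"
    define d0 where "d0 = d - (\<Sum>i<n. scaleD (\<phi> (a i) d) (e i))"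
    have ad0: "\<phi> (a j) d0 = 0" if "j < n" for j
      using that by (simp add: d0_def pair_diff pair_sum pair_scale dl of_bool_def if_distrib cong: if_cong)
    have gd0: "\<phi> g d0 \<noteq> 0"
      using ne by (simp add: d0_def pair_diff pair_sum pair_scale mult.commute)
    define d1 where "d1 = scaleD (inverse (\<phi> g d0)) d0"
    have d1: "\<phi> g d1 = 1" "\<And>j. j < n \<Longrightarrow> \<phi> (a j) d1 = 0"
      using gd0 ad0 by (simp_all add: d1_def pair_scale)
    have d1D: "d1 \<in> Dbar"
      unfolding d0_def d1_def using d eD by (intro subspace_diff subspace_sum subspace_scale Dbar) auto
    \<comment> \<open>The new pair is \<open>g\<close> and \<open>d1\<close>. Subtracting multiples
      of \<open>d1\<close> makes \<open>g\<close> vanish on the old vectors; their duality with the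
      old \<open>a j\<close> survives since these vanish on \<open>d1\<close>.\<close>
    have "Q (Suc n) (a(n := g)) (\<lambda>i. if i < n then e i - scaleD (\<phi> g (e i)) d1 else d1)"
      unfolding Q_def
      by (auto simp: less_Suc_eq dl d1 pair_diff pair_scale intro!: subspace_diff subspace_scale Dbar eD d1D)
    from max[OF this] show False by simp
  qed
  have ex: "\<phi> g d = (\<Sum>i<n. \<phi> g (e i) * \<phi> (a i) d)" for g d
  proof -
    obtain x y where xy: "d = x + y" "x \<in> Dbar" "y \<in> Ker2 \<phi>" using Dbar(3) by blast
    have "\<phi> h d = \<phi> h x" for h using xy(1,3) by (simp add: pair_add Ker2_def)
    then show ?thesis using ex0[OF xy(2), of g] by simp
  qed
  \<comment> \<open>The defect \<open>d - ?s\<close> lies in both \<open>Dbar\<close> and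
    \<open>Ker2 \<phi>\<close>, hence is zero. So the \<open>e i\<close> form a basis of
    \<open>Dbar\<close>, and the maximal size is its dimension.\<close>
  have "d \<in> span (e ` {..<n})" if d: "d \<in> Dbar" for d
  proof -
    let ?s = "\<Sum>i<n. scaleD (\<phi> (a i) d) (e i)"
    have "d - ?s \<in> Dbar" using d eD by (intro subspace_diff subspace_sum subspace_scale Dbar) auto
    moreover have "d - ?s \<in> Ker2 \<phi>"
      unfolding Ker2_def mem_Collect_eq
    proof
      show "\<phi> g (d - ?s) = 0" for g
        using ex[of g d] by (simp add: pair_diff pair_sum pair_scale mult.commute)
    qed
    ultimately have "d - ?s = 0" using Dbar(2) by blast
    then have "d = ?s" by simp
    also have "?s \<in> span (e ` {..<n})" by (intro span_sum span_scale span_base) auto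
    finally show ?thesis .
  qed
  then have "span (e ` {..<n}) = Dbar" using eD Dbar(1) by (intro span_eq[THEN iffD1] antisym span_minimal) auto
  then have "dim Dbar = n"
    using ind[OF Q] dim_eq_card[of "e ` {..<n}" Dbar] Dbar(1) by (simp add: span_eq_iff[THEN iffD2])
  then have r: "r = n" using dim by simp
  have "dual_system scaleD \<phi> r a e"
    unfolding r by unfold_locales (rule dl, assumption+, rule ex)
  then show ?thesis by blast
qed

end

context dual_system
begin

abbreviation "U \<equiv> bar_dual scaleD \<phi>"

lemma subspace_U: "module.subspace fun_scale U"
proof -
  interpret F: vector_space "fun_scale :: _ \<Rightarrow> ('d \<Rightarrow> complex) \<Rightarrow> _" by (rule vector_space_fun_scale)
  show ?thesis
    unfolding F.subspace_def bar_dual_def Vector_Spaces.linear_iff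
    by (auto simp: algebra_simps intro: vector_space_axioms) (unfold_locales, auto simp: algebra_simps)
qed

lemma U_linear:
  assumes "u \<in> U"
  shows "u (d + d') = u d + u d'" "u (scaleD c d) = c * u d" "d \<in> Ker2 \<phi> \<Longrightarrow> u d = 0"
    "u (d - d') = u d - u d'" "u 0 = 0" "u (\<Sum>i\<in>I. f i) = (\<Sum>i\<in>I. u (f i))"
proof -
  interpret u: Vector_Spaces.linear scaleD "(*)" u using assms by (simp add: bar_dual_def)
  show "u (d + d') = u d + u d'" "u (scaleD c d) = c * u d" "u (d - d') = u d - u d'" "u 0 = 0"
    "u (\<Sum>i\<in>I. f i) = (\<Sum>i\<in>I. u (f i))"
    by (simp_all add: u.add u.scale u.diff u.zero u.sum)
  show "d \<in> Ker2 \<phi> \<Longrightarrow> u d = 0" using assms by (simp add: bar_dual_def)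
qed

lemma pair_mem_U: "\<phi> g \<in> U"
  by (simp add: bar_dual_def linear_right Ker2_def)

lemma U_expand_apply:
  assumes "u \<in> U"
  shows "u d = (\<Sum>i<r. u (e i) * \<phi> (a i) d)"
proof -
  have "d - (\<Sum>i<r. scaleD (\<phi> (a i) d) (e i)) \<in> Ker2 \<phi>"
    unfolding Ker2_def mem_Collect_eq
  proof
    show "\<phi> g (d - (\<Sum>i<r. scaleD (\<phi> (a i) d) (e i))) = 0" for g
      using expand[of g d] by (simp add: pair_diff pair_sum pair_scale mult.commute)
  qed
  from U_linear(3)[OF assms this] show ?thesis
    by (simp add: U_linear[OF assms] mult.commute)
qed

lemma U_expand: "u \<in> U \<Longrightarrow> u = (\<Sum>i<r. fun_scale (u (e i)) (\<phi> (a i)))"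
  by (rule ext, subst U_expand_apply) (simp_all add: sum_fun_apply)

definition E :: "('d \<Rightarrow> complex) set" where "E = (\<lambda>i. \<phi> (a i)) ` {..<r}"

lemma inj_a: "inj_on (\<lambda>i. \<phi> (a i)) {..<r}"
proof (rule inj_onI)
  fix i j assume ij: "i \<in> {..<r}" "j \<in> {..<r}" "\<phi> (a i) = \<phi> (a j)"
  then have "\<phi> (a i) (e i) = \<phi> (a j) (e i)" by simp
  then show "i = j" using ij(1,2) by (simp add: dual)
qed

lemma card_E: "card E = r" and finite_E: "finite E" and E_subset: "E \<subseteq> U"
  by (auto simp: E_def card_image[OF inj_a] pair_mem_U)

lemma U_span: "U \<subseteq> module.span fun_scale E"
proof
  interpret F: vector_space "fun_scale :: _ \<Rightarrow> ('d \<Rightarrow> complex) \<Rightarrow> _" by (rule vector_space_fun_scale)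
  fix u assume "u \<in> U"
  then show "u \<in> F.span E"
    by (subst U_expand, assumption)
      (rule F.span_sum, rule F.span_scale, rule F.span_base, simp add: E_def)
qed

end

section \<open>Equivariant alternating maps and exterior powers\<close>

locale witt_rep = dual_system scaleD \<phi> r a e +
    L: lie_module "L_scale scaleD" "L_bracket scaleD \<phi>" scaleV \<rho>
  for scaleD :: "complex \<Rightarrow> 'd::ab_group_add \<Rightarrow> 'd"
    and \<phi> :: "'g::ab_group_add \<Rightarrow> 'd \<Rightarrow> complex"
    and r :: nat and a :: "nat \<Rightarrow> 'g" and e :: "nat \<Rightarrow> 'd"
    and scaleV :: "complex \<Rightarrow> 'v::ab_group_add \<Rightarrow> 'v"
    and \<rho> :: "('g, 'd) tensor \<Rightarrow> 'v \<Rightarrow> 'v"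
begin

lemma linear_act: "Vector_Spaces.linear scaleV scaleV (\<rho> x)"
  by (rule L.act_linear_right)

lemma act_simps:
  "\<rho> x (v + w) = \<rho> x v + \<rho> x w" "\<rho> x (v - w) = \<rho> x v - \<rho> x w" "\<rho> x (scaleV c v) = scaleV c (\<rho> x v)"
  "\<rho> x 0 = 0" "\<rho> x (- v) = - \<rho> x v" "\<rho> x (\<Sum>i\<in>I. f i) = (\<Sum>i\<in>I. \<rho> x (f i))"
proof -
  interpret R: Vector_Spaces.linear scaleV scaleV "\<rho> x" by (rule linear_act)
  show "\<rho> x (v + w) = \<rho> x v + \<rho> x w" "\<rho> x (v - w) = \<rho> x v - \<rho> x w" "\<rho> x (scaleV c v) = scaleV c (\<rho> x v)"
    "\<rho> x 0 = 0" "\<rho> x (- v) = - \<rho> x v" "\<rho> x (\<Sum>i\<in>I. f i) = (\<Sum>i\<in>I. \<rho> x (f i))"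
    by (simp_all add: R.add R.diff R.scale R.zero R.neg R.sum)
qed

lemma act_left_simps:
  "\<rho> (x + y) v = \<rho> x v + \<rho> y v" "\<rho> (x - y) v = \<rho> x v - \<rho> y v" "\<rho> 0 v = 0"
  "\<rho> (- x) v = - \<rho> x v" "\<rho> (g \<otimes>\<^sub>Z scaleD c d) v = scaleV c (\<rho> (g \<otimes>\<^sub>Z d) v)"
proof -
  interpret R: Vector_Spaces.linear "L_scale scaleD" scaleV "\<lambda>x. \<rho> x v" by (rule L.act_linear_left)
  show "\<rho> (x + y) v = \<rho> x v + \<rho> y v" "\<rho> (x - y) v = \<rho> x v - \<rho> y v" "\<rho> 0 v = 0"
    "\<rho> (- x) v = - \<rho> x v" "\<rho> (g \<otimes>\<^sub>Z scaleD c d) v = scaleV c (\<rho> (g \<otimes>\<^sub>Z d) v)"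
    by (simp_all add: R.add R.diff R.zero R.neg R.scale flip: L_scale_pure)
qed

lemma act_pure_comm:
  "\<rho> (x \<otimes>\<^sub>Z d) (\<rho> (y \<otimes>\<^sub>Z d') v) = \<rho> (y \<otimes>\<^sub>Z d') (\<rho> (x \<otimes>\<^sub>Z d) v)
     + scaleV (\<phi> y d) (\<rho> (x \<otimes>\<^sub>Z d') v) - scaleV (\<phi> x d') (\<rho> (y \<otimes>\<^sub>Z d) v)"
  using L.act_bracket[of "x \<otimes>\<^sub>Z d" "y \<otimes>\<^sub>Z d'" v]
  by (simp add: L_bracket_pure act_left_simps algebra_simps)

text \<open>These are the \<open>L\<close>-module maps from the \<open>k\<close>-th exterior power
  of \<open>U\<close> to \<open>V\<close>, given by their values on decomposable elements. Pure
  tensors suffice for equivariance because they generate \<open>L\<close> additively.\<close>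

definition equivariant_alternating :: "nat \<Rightarrow> (('d \<Rightarrow> complex) list \<Rightarrow> 'v) \<Rightarrow> bool" where
  "equivariant_alternating k H \<longleftrightarrow> alternating_mod scaleV fun_scale U k {0} H \<and>
     (\<forall>us\<in>tuples k U. \<forall>g d. \<rho> (g \<otimes>\<^sub>Z d) (H us) = (\<Sum>l<k. H (us[l := fun_scale ((us ! l) d) (\<phi> g)])))"

section \<open>Exterior powers as quotients of free spaces\<close>

abbreviation "wfree k \<equiv> wedge_free k U"
abbreviation "wnull k \<equiv> wedge_null fun_scale k U"
abbreviation "wcls k \<equiv> Image (wedge_rel fun_scale k U)"

lemma vector_space_wedge: "vector_space (fscale (*) :: complex \<Rightarrow> ('k \<Rightarrow>\<^sub>0 complex) \<Rightarrow> _)"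
  by (rule vector_space_fscale) (unfold_locales, simp_all add: algebra_simps)

lemma fscale_lookup_complex: "Poly_Mapping.lookup (fscale (*) c p) k = c * Poly_Mapping.lookup p (k :: 'k)"
  by (rule fscale_lookup) simp

lemma subspace_wfree: "module.subspace (fscale (*)) (wfree k)"
proof -
  interpret P: vector_space "fscale (*) :: complex \<Rightarrow> (('d \<Rightarrow> complex) list \<Rightarrow>\<^sub>0 complex) \<Rightarrow> _"
    by (rule vector_space_wedge)
  have "Poly_Mapping.keys (fscale (*) c p) \<subseteq> Poly_Mapping.keys p" for c and p :: "('d \<Rightarrow> complex) list \<Rightarrow>\<^sub>0 complex"
    by (auto simp: in_keys_iff fscale_lookup_complex)
  moreover have "Poly_Mapping.keys (p + q) \<subseteq> Poly_Mapping.keys p \<union> Poly_Mapping.keys q"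
    for p q :: "('d \<Rightarrow> complex) list \<Rightarrow>\<^sub>0 complex" by (rule keys_add)
  ultimately show ?thesis
    unfolding P.subspace_def wedge_free_def by (simp add: subset_iff) blast
qed

lemma subspace_wnull: "module.subspace (fscale (*)) (wnull k)"
proof -
  interpret P: vector_space "fscale (*) :: complex \<Rightarrow> (('d \<Rightarrow> complex) list \<Rightarrow>\<^sub>0 complex) \<Rightarrow> _"
    by (rule vector_space_wedge)
  show ?thesis unfolding wedge_null_def by (rule P.subspace_span)
qed

lemma single_mem_wfree: "us \<in> tuples k U \<Longrightarrow> Poly_Mapping.single us c \<in> wfree k"
  by (auto simp: wedge_free_def)

lemma wfree_induct [consumes 1, case_names zero single add]:
  assumes p: "p \<in> wfree k" and zero: "P 0"
    and single: "\<And>us c. us \<in> tuples k U \<Longrightarrow> P (Poly_Mapping.single us c)"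
    and add: "\<And>p q. p \<in> wfree k \<Longrightarrow> q \<in> wfree k \<Longrightarrow> P p \<Longrightarrow> P q \<Longrightarrow> P (p + q)"
  shows "P p"
proof -
  interpret P: vector_space "fscale (*) :: complex \<Rightarrow> (('d \<Rightarrow> complex) list \<Rightarrow>\<^sub>0 complex) \<Rightarrow> _"
    by (rule vector_space_wedge)
  let ?s = "\<lambda>K. \<Sum>us\<in>K. Poly_Mapping.single us (Poly_Mapping.lookup p us)"
  have "?s K \<in> wfree k \<and> P (?s K)" if "finite K" "K \<subseteq> tuples k U" for K
    using that
  proof induction
    case empty
    then show ?case using zero P.subspace_0[OF subspace_wfree] by simp
  next
    case (insert us K)
    then show ?case
      using add[of "Poly_Mapping.single us (Poly_Mapping.lookup p us)" "?s K"] single[of us]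
        single_mem_wfree[of us k] P.subspace_add[OF subspace_wfree]
      by simp
  qed
  moreover have "?s (Poly_Mapping.keys p) = p"
    by (rule poly_mapping_eqI) (simp add: lookup_sum lookup_single when_def in_keys_iff)
  moreover have "Poly_Mapping.keys p \<subseteq> tuples k U" using p by (simp add: wedge_free_def)
  ultimately show ?thesis by (metis finite_keys)
qed

lemma wcls_eq:
  assumes "p \<in> wfree k"
  shows "wcls k {p} = {q \<in> wfree k. p - q \<in> wnull k}"
  using assms by (auto simp: wedge_rel_def)

lemma wnull_rel:
  shows "p - p \<in> wnull k" "p - q \<in> wnull k \<Longrightarrow> q - p \<in> wnull k"
    "p - q \<in> wnull k \<Longrightarrow> q - s \<in> wnull k \<Longrightarrow> p - s \<in> wnull k"
proof -
  interpret P: vector_space "fscale (*) :: complex \<Rightarrow> (('d \<Rightarrow> complex) list \<Rightarrow>\<^sub>0 complex) \<Rightarrow> _"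
    by (rule vector_space_wedge)
  note s = subspace_wnull[of k]
  show "p - p \<in> wnull k" using P.subspace_0[OF s] by simp
  show "p - q \<in> wnull k \<Longrightarrow> q - p \<in> wnull k" using P.subspace_neg[OF s, of "p - q"] by simp
  show "p - q \<in> wnull k \<Longrightarrow> q - s \<in> wnull k \<Longrightarrow> p - s \<in> wnull k"
    using P.subspace_add[OF s, of "p - q" "q - s"] by simp
qed

lemma wcls_cong:
  assumes "p \<in> wfree k" "q \<in> wcls k {p}"
  shows "wcls k {q} = wcls k {p}"
proof -
  have q: "q \<in> wfree k" "p - q \<in> wnull k" using assms by (auto simp: wcls_eq)
  show ?thesis unfolding wcls_eq[OF assms(1)] wcls_eq[OF q(1)]
    using q wnull_rel by blast
qed

lemma wedge_act_single:
  "wedge_act X x (Poly_Mapping.single us c) = (\<Sum>l<length us. Poly_Mapping.single (us[l := X x (us ! l)]) c)"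
  and wedge_act_diff: "wedge_act X x (p - q) = wedge_act X x p - wedge_act X x q"
  unfolding wedge_act_def
  by (rule pm_ext[where h = "\<lambda>us c. \<Sum>l<length us. Poly_Mapping.single (us[l := X x (us ! l)]) c"];
      simp add: single_diff sum_subtractf)+

lemma wedge_act_add: "wedge_act X x (p + q) = wedge_act X x p + wedge_act X x q" "wedge_act X x 0 = 0"
  using wedge_act_diff[of X x "p + q" q] wedge_act_diff[of X x 0 0] by simp_all

lemma L_dual_act_mem_U: "L_dual_act \<phi> x g \<in> U"
proof -
  have "Vector_Spaces.linear scaleD (*) (L_dual_act \<phi> x g)"
    unfolding Vector_Spaces.linear_iff
    by (auto simp: L_dual_act_def case_prod_beta sum_distrib_left sum.distrib[symmetric] algebra_simps
      pair_add pair_scale intro: vector_space_axioms) (unfold_locales, simp_all add: algebra_simps)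
  moreover have "\<forall>d\<in>Ker2 \<phi>. L_dual_act \<phi> x g d = 0"
    by (simp add: L_dual_act_def Ker2_def case_prod_beta)
  ultimately show ?thesis by (simp add: bar_dual_def)
qed

lemma wedge_act_mem_wfree: "p \<in> wfree k \<Longrightarrow> wedge_act (L_dual_act \<phi>) x p \<in> wfree k"
proof -
  interpret P: vector_space "fscale (*) :: complex \<Rightarrow> (('d \<Rightarrow> complex) list \<Rightarrow>\<^sub>0 complex) \<Rightarrow> _"
    by (rule vector_space_wedge)
  show ?thesis if "p \<in> wfree k"
    using that
  proof (induction p rule: wfree_induct)
    case (single us c)
    have "us[l := L_dual_act \<phi> x (us ! l)] \<in> tuples k U" for l
      using single L_dual_act_mem_U by (auto simp: tuples_def dest: set_update_subset_insert[THEN subsetD])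
    then show ?case unfolding wedge_act_single
      by (intro P.subspace_sum subspace_wfree single_mem_wfree)
  qed (auto simp: wedge_act_add intro!: P.subspace_0 P.subspace_add subspace_wfree)
qed

text \<open>The inverse of the isomorphism, composed with the quotient map, is a linear map
  \<open>\<gamma>\<close> on the free space; \<open>H\<close> is its value on single tuples.\<close>

lemma equivariant_alternating_if_iso:
  assumes iso: "lie_module_iso \<lparr>points = UNIV, madd = (+), msmult = scaleV, mact = \<rho>\<rparr>
          (exterior_bar_dual scaleD \<phi> k)"
  obtains H where "equivariant_alternating k H" "L.V.span (H ` tuples k U) = UNIV"
proof -
  interpret P: vector_space "fscale (*) :: complex \<Rightarrow> (('d \<Rightarrow> complex) list \<Rightarrow>\<^sub>0 complex) \<Rightarrow> _"
    by (rule vector_space_wedge)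
  obtain f where bij: "bij_betw f UNIV (wfree k // wedge_rel fun_scale k U)"
    and fadd: "\<And>u v. f (u + v) = (\<Union>p\<in>f u. \<Union>q\<in>f v. wcls k {p + q})"
    and fscale: "\<And>c v. f (scaleV c v) = (\<Union>p\<in>f v. wcls k {fscale (*) c p})"
    and fact: "\<And>x v. f (\<rho> x v) = (\<Union>p\<in>f v. wcls k {wedge_act (L_dual_act \<phi>) x p})"
    using iso unfolding lie_module_iso_def exterior_bar_dual_def exterior_power_def Let_def by auto
  have f_pts: "f v \<in> wfree k // wedge_rel fun_scale k U" for v
    using bij by (auto simp: bij_betw_def)
  have inj: "f u = f v \<Longrightarrow> u = v" for u v using bij by (auto simp: bij_betw_def inj_on_def)
  have ex: "\<exists>v. f v = wcls k {p}" if "p \<in> wfree k" for p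
  proof -
    have "wcls k {p} \<in> wfree k // wedge_rel fun_scale k U" using that by (rule quotientI)
    then show ?thesis using bij unfolding bij_betw_def by (metis imageE)
  qed
  define \<gamma> where "\<gamma> p = (SOME v. f v = wcls k {p})" for p
  have f\<gamma>: "f (\<gamma> p) = wcls k {p}" if "p \<in> wfree k" for p
    unfolding \<gamma>_def using ex[OF that] by (rule someI_ex)
  \<comment> \<open>\<open>\<gamma> p\<close> is the only vector whose class contains
    \<open>p\<close>, so each property of \<open>\<gamma>\<close> reduces to membership of a
    representative in a class.\<close>
  have key: "\<gamma> p = v" if "p \<in> wfree k" "p \<in> f v" for p v
  proof -
    obtain q where q: "q \<in> wfree k" "f v = wcls k {q}"
      using f_pts[of v] by (auto elim: quotientE)
    have "wcls k {p} = wcls k {q}" using wcls_cong[OF q(1)] that q by simp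
    then show ?thesis using f\<gamma>[OF that(1)] q inj by metis
  qed
  have self: "p \<in> wcls k {p}" if "p \<in> wfree k" for p using that wnull_rel(1) by (simp add: wcls_eq)
  have mem: "p \<in> f (\<gamma> p)" if "p \<in> wfree k" for p using self[OF that] f\<gamma>[OF that] by simp
  have \<gamma>add: "\<gamma> (p + q) = \<gamma> p + \<gamma> q" if p: "p \<in> wfree k" and q: "q \<in> wfree k" for p q
  proof (rule key)
    show pq: "p + q \<in> wfree k" by (rule P.subspace_add[OF subspace_wfree p q])
    show "p + q \<in> f (\<gamma> p + \<gamma> q)" unfolding fadd using mem[OF p] mem[OF q] self[OF pq] by blast
  qed
  have \<gamma>scale: "\<gamma> (fscale (*) c p) = scaleV c (\<gamma> p)" if p: "p \<in> wfree k" for p c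
  proof (rule key)
    show cp: "fscale (*) c p \<in> wfree k" by (rule P.subspace_scale[OF subspace_wfree p])
    show "fscale (*) c p \<in> f (scaleV c (\<gamma> p))" unfolding fscale using mem[OF p] self[OF cp] by blast
  qed
  have \<gamma>act: "\<gamma> (wedge_act (L_dual_act \<phi>) x p) = \<rho> x (\<gamma> p)" if p: "p \<in> wfree k" for p x
  proof (rule key)
    show xp: "wedge_act (L_dual_act \<phi>) x p \<in> wfree k" by (rule wedge_act_mem_wfree[OF p])
    show "wedge_act (L_dual_act \<phi>) x p \<in> f (\<rho> x (\<gamma> p))" unfolding fact using mem[OF p] self[OF xp] by blast
  qed
  have \<gamma>0: "\<gamma> 0 = 0" using \<gamma>add[of 0 0] P.subspace_0[OF subspace_wfree] by simp
  have \<gamma>diff: "\<gamma> (p - q) = \<gamma> p - \<gamma> q" if "p \<in> wfree k" "q \<in> wfree k" for p q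
    using \<gamma>add[OF P.subspace_diff[OF subspace_wfree that] that(2)] by simp
  have \<gamma>null: "\<gamma> p = 0" if "p \<in> wfree k" "p \<in> wnull k" for p
    using key[of 0 "\<gamma> p"] that \<gamma>0 P.subspace_0[OF subspace_wfree] by (simp add: f\<gamma> wcls_eq)
  have \<gamma>sum: "\<gamma> (\<Sum>i\<in>I. h i) = (\<Sum>i\<in>I. \<gamma> (h i))" if "\<And>i. i \<in> I \<Longrightarrow> h i \<in> wfree k"
    for h and I :: "nat set"
    using that by (induction I rule: infinite_finite_induct)
      (simp_all add: \<gamma>0 \<gamma>add P.subspace_sum[OF subspace_wfree])
  define H where "H us = \<gamma> (Poly_Mapping.single us 1)" for us
  have single_scale: "Poly_Mapping.single us c = fscale (*) c (Poly_Mapping.single us 1)" for us :: "('d \<Rightarrow> complex) list" and c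
    by (simp add: fscale_single)
  have upd: "us[l := u] \<in> tuples k U" if "us \<in> tuples k U" "u \<in> U" for us l u
    using that by (auto simp: tuples_def dest: set_update_subset_insert[THEN subsetD])
  have "alternating_mod scaleV fun_scale U k {0} H"
  proof -
    interpret F: vector_space "fun_scale :: _ \<Rightarrow> ('d \<Rightarrow> complex) \<Rightarrow> _" by (rule vector_space_fun_scale)
    show ?thesis
    proof
      show "F.subspace U" by (rule subspace_U)
      show "L.V.subspace {0}" by simp
      fix us assume us: "us \<in> tuples k U"
      note mem = single_mem_wfree[OF upd[OF us]]
      {
        fix l u v assume l: "l < k" and u: "u \<in> U" and v: "v \<in> U"
        let ?p = "Poly_Mapping.single (us[l := u + v]) 1 - Poly_Mapping.single (us[l := u]) 1
          - Poly_Mapping.single (us[l := v]) (1 :: complex)"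
        have "u + v \<in> U" using F.subspace_add[OF subspace_U u v] .
        moreover have "?p \<in> wnull k"
          unfolding wedge_null_def using us l u v by (intro P.span_base) blast
        ultimately show "H (us[l := u + v]) - H (us[l := u]) - H (us[l := v]) \<in> {0}"
          using \<gamma>null[of ?p] u v by (simp add: H_def \<gamma>diff mem P.subspace_diff[OF subspace_wfree])
      }
      {
        fix l u c assume l: "l < k" and u: "u \<in> U"
        let ?p = "Poly_Mapping.single (us[l := fun_scale c u]) 1 - Poly_Mapping.single (us[l := u]) c"
        have cu: "fun_scale c u \<in> U" using F.subspace_scale[OF subspace_U u] .
        have "?p \<in> wnull k"
          unfolding wedge_null_def using us l u by (intro P.span_base) blast
        with mem[OF cu] mem[OF u] have "\<gamma> ?p = 0"
          by (intro \<gamma>null P.subspace_diff[OF subspace_wfree])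
        moreover have "\<gamma> (Poly_Mapping.single (us[l := u]) c) = scaleV c (H (us[l := u]))"
          unfolding H_def single_scale[of _ c] by (rule \<gamma>scale[OF mem[OF u]])
        ultimately show "H (us[l := fun_scale c u]) - scaleV c (H (us[l := u])) \<in> {0}"
          using \<gamma>diff[OF mem[OF cu] mem[OF u]] by (simp add: H_def)
      }
      assume nd: "\<not> distinct us"
      have "Poly_Mapping.single us 1 \<in> wnull k"
        unfolding wedge_null_def using us nd by (intro P.span_base) blast
      then show "H us \<in> {0}" using \<gamma>null single_mem_wfree[OF us] by (simp add: H_def)
    qed
  qed
  moreover have "\<rho> (g \<otimes>\<^sub>Z d) (H us) = (\<Sum>l<k. H (us[l := fun_scale ((us ! l) d) (\<phi> g)]))"
    if us: "us \<in> tuples k U" for us g d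
  proof -
    have "\<rho> (g \<otimes>\<^sub>Z d) (H us) = (\<Sum>l<k. \<gamma> (Poly_Mapping.single (us[l := L_dual_act \<phi> (g \<otimes>\<^sub>Z d) (us ! l)]) 1))"
      unfolding H_def \<gamma>act[OF single_mem_wfree[OF us], symmetric] wedge_act_single
      using us by (subst \<gamma>sum)
        (simp_all add: single_mem_wfree upd[OF us] L_dual_act_mem_U, simp add: tuples_def)
    also have "\<dots> = (\<Sum>l<k. H (us[l := fun_scale ((us ! l) d) (\<phi> g)]))"
    proof (intro sum.cong refl)
      fix l assume "l \<in> {..<k}"
      then have "us ! l \<in> U" using us by (auto simp: tuples_def)
      then show "\<gamma> (Poly_Mapping.single (us[l := L_dual_act \<phi> (g \<otimes>\<^sub>Z d) (us ! l)]) 1) =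
          H (us[l := fun_scale ((us ! l) d) (\<phi> g)])"
        by (simp add: H_def L_dual_act(1)[OF U_linear(1)])
    qed
    finally show ?thesis .
  qed
  ultimately have H: "equivariant_alternating k H" by (simp add: equivariant_alternating_def)
  have "\<gamma> p \<in> L.V.span (H ` tuples k U)" if "p \<in> wfree k" for p
    using that
  proof (induction p rule: wfree_induct)
    case (single us c)
    have "\<gamma> (Poly_Mapping.single us c) = scaleV c (H us)"
      using \<gamma>scale[OF single_mem_wfree[OF single], of c 1] by (simp add: H_def single_scale[of us c])
    moreover have "scaleV c (H us) \<in> L.V.span (H ` tuples k U)"
      by (intro L.V.span_scale L.V.span_base imageI single)
    ultimately show ?case by simp
  qed (auto simp: \<gamma>0 \<gamma>add L.V.span_zero L.V.span_add)
  moreover have "\<exists>p\<in>wfree k. \<gamma> p = v" for v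
  proof -
    obtain q where q: "q \<in> wfree k" "f v = wcls k {q}"
      using f_pts[of v] by (auto elim: quotientE)
    have "\<gamma> q = v" by (rule key[OF q(1)]) (unfold q(2), rule self[OF q(1)])
    then show ?thesis using q(1) by blast
  qed
  ultimately have "v \<in> L.V.span (H ` tuples k U)" for v by metis
  then have "L.V.span (H ` tuples k U) = UNIV" by blast
  with H show ?thesis by (rule that)
qed

section \<open>Basis tuples and their weights\<close>

lemma equivariant_alternatingD:
  assumes "equivariant_alternating k H"
  shows "alternating_mod scaleV fun_scale U k {0} H"
    and "us \<in> tuples k U \<Longrightarrow>
      \<rho> (g \<otimes>\<^sub>Z d) (H us) = (\<Sum>l<k. H (us[l := fun_scale ((us ! l) d) (\<phi> g)]))"
  using assms by (auto simp: equivariant_alternating_def)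

lemma tuples_update: "us \<in> tuples k U \<Longrightarrow> u \<in> U \<Longrightarrow> us[l := u] \<in> tuples k U"
  by (auto simp: tuples_def dest: set_update_subset_insert[THEN subsetD])

lemma alternating_eqs:
  assumes "alternating_mod scaleV fun_scale U k {0} H" and us: "us \<in> tuples k U"
  shows "l < k \<Longrightarrow> u \<in> U \<Longrightarrow> v \<in> U \<Longrightarrow> H (us[l := u + v]) = H (us[l := u]) + H (us[l := v])"
    and "l < k \<Longrightarrow> u \<in> U \<Longrightarrow> H (us[l := fun_scale c u]) = scaleV c (H (us[l := u]))"
    and "\<not> distinct us \<Longrightarrow> H us = 0"
    and "l < k \<Longrightarrow> H (us[l := 0]) = 0"
    and "l < k \<Longrightarrow> u \<in> U \<Longrightarrow> v \<in> U \<Longrightarrow> H (us[l := u - v]) = H (us[l := u]) - H (us[l := v])"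
proof -
  interpret H: alternating_mod scaleV fun_scale U k "{0}" H by fact
  show add: "H (us[l := u + v]) = H (us[l := u]) + H (us[l := v])" if "l < k" "u \<in> U" "v \<in> U" for u v
    using H.add_slot[OF us that] by (simp add: algebra_simps)
  show "l < k \<Longrightarrow> u \<in> U \<Longrightarrow> H (us[l := fun_scale c u]) = scaleV c (H (us[l := u]))"
    using H.scale_slot[OF us, of l u c] by simp
  show "\<not> distinct us \<Longrightarrow> H us = 0" using H.alt[OF us] by simp
  show "l < k \<Longrightarrow> H (us[l := 0]) = 0" using H.zero_slot[OF us] by simp
  show "H (us[l := u - v]) = H (us[l := u]) - H (us[l := v])" if "l < k" "u \<in> U" "v \<in> U"
    using add[OF that(1) H.U.subspace_diff[OF subspace_U that(2,3)] that(3)] by simp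
qed

lemma E_nth:
  assumes "set xs \<subseteq> E" "l < length xs"
  obtains j where "j < r" "xs ! l = \<phi> (a j)"
proof -
  have "xs ! l \<in> (\<lambda>i. \<phi> (a i)) ` {..<r}" using nth_mem[OF assms(2)] assms(1) by (auto simp: E_def)
  then show ?thesis using that by blast
qed

text \<open>The entries of \<open>xs\<close> are distinct members of the dual basis, so
  \<open>e i\<close> takes the value one at slot \<open>l\<close> and zero at the other slots, and a
  single summand of the derivation survives.\<close>

lemma replace_basis_vector:
  assumes H: "equivariant_alternating k H" and xs: "distinct xs" "set xs \<subseteq> E" "length xs = k"
    and l: "l < k" "xs ! l = \<phi> (a i)" "i < r"
  shows "\<rho> (g \<otimes>\<^sub>Z e i) (H xs) = H (xs[l := \<phi> g])"
proof -
  note A = equivariant_alternatingD(1)[OF H]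
  have tup: "xs \<in> tuples k U" using xs E_subset by (auto simp: tuples_def)
  have "\<rho> (g \<otimes>\<^sub>Z e i) (H xs) = (\<Sum>m<k. if m = l then H (xs[l := \<phi> g]) else 0)"
    unfolding equivariant_alternatingD(2)[OF H tup]
  proof (intro sum.cong refl)
    fix m assume m: "m \<in> {..<k}"
    then obtain j where j: "j < r" "xs ! m = \<phi> (a j)" using E_nth[OF xs(2), of m] xs(3) by auto
    have "j = i \<longleftrightarrow> m = l"
      using j l m xs(1,3) by (metis lessThan_iff nth_eq_iff_index_eq inj_a inj_onD)
    then have "H (xs[m := fun_scale ((xs ! m) (e i)) (\<phi> g)]) = scaleV (of_bool (m = l)) (H (xs[m := \<phi> g]))"
      using alternating_eqs(2)[OF A tup, of m "\<phi> g"] m j l by (simp add: pair_mem_U dual)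
    then show "H (xs[m := fun_scale ((xs ! m) (e i)) (\<phi> g)]) = (if m = l then H (xs[l := \<phi> g]) else 0)"
      by simp
  qed
  then show ?thesis using l by simp
qed

text \<open>The action can exchange one basis vector for another, so vanishing at one basis tuple
  spreads to all basis tuples and then, by multilinearity, to all tuples.\<close>

lemma H_basis_nonzero:
  assumes H: "equivariant_alternating k H" and nz: "us \<in> tuples k U" "H us \<noteq> 0"
    and xs: "distinct xs" "set xs \<subseteq> E" "length xs = k"
  shows "H xs \<noteq> 0"
proof
  assume H0: "H xs = 0"
  interpret A: alternating_mod scaleV fun_scale U k "{0}" H by (rule equivariant_alternatingD(1)[OF H])
  have H0: "H ys = 0" if ys: "distinct ys" "set ys \<subseteq> E" "length ys = k" for ys
    using xs H0
  \<comment> \<open>The entries of \<open>xs\<close> outside \<open>ys\<close> are exchanged one at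
    a time; when none is left, the two tuples are permutations of each other.\<close>
  proof (induction "card (set xs - set ys)" arbitrary: xs rule: less_induct)
    case less
    note xs = less.prems
    have cards: "card (set xs) = card (set ys)" using xs ys by (simp add: distinct_card)
    have tup: "xs \<in> tuples k U" using xs E_subset by (auto simp: tuples_def)
    show ?case
    proof (cases "set xs \<subseteq> set ys")
      case True
      then have "set xs = set ys" using cards by (intro card_subset_eq) auto
      then have "mset xs = mset ys" using xs ys by (simp add: set_eq_iff_mset_eq_distinct)
      then show ?thesis using A.permute_mem[of xs ys "[]"] tup xs by simp
    next
      case False
      then obtain l where l: "l < k" "xs ! l \<notin> set ys"
        using xs by (auto simp: in_set_conv_nth subset_iff)
      have "\<not> set ys \<subseteq> set xs"
        using cards False by (metis List.finite_set card_subset_eq order_refl)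
      then obtain y where y: "y \<in> set ys" "y \<notin> set xs" by blast
      obtain i where i: "i < r" "xs ! l = \<phi> (a i)" using E_nth[OF xs(2), of l] l xs(3) by auto
      obtain j where j: "y = \<phi> (a j)" using y ys by (auto simp: E_def)
      have "H (xs[l := y]) = 0"
        using replace_basis_vector[OF H xs(1-3) l(1) i(2,1), of "a j"] xs(4) j by (simp add: act_simps)
      moreover have set: "set (xs[l := y]) = insert y (set xs - {xs ! l})"
        using xs l by (simp add: set_update_distinct)
      moreover have "distinct (xs[l := y])"
        using xs y by (intro distinct_list_update) auto
      moreover have "set (xs[l := y]) - set ys \<subset> set xs - set ys"
        using set y l xs(3) nth_mem[of l xs] by auto
      ultimately show ?thesis
        using less.hyps[of "xs[l := y]"] xs ys y by (auto intro!: psubset_card_mono)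
    qed
  qed
  have "H us \<in> {0}"
    by (rule A.mem_if_basis_mem[OF finite_E E_subset U_span _ nz(1)]) (simp add: H0)
  then show False using nz by simp
qed

text \<open>\<open>a i \<otimes>\<^sub>Z e i\<close> counts the occurrences of
  \<open>\<phi> (a i)\<close>; these eigenvalues separate the wedges of different subsets of
  \<open>E\<close>.\<close>

lemma H_basis_weight:
  assumes H: "equivariant_alternating k H" and xs: "distinct xs" "set xs \<subseteq> E" "length xs = k" and i: "i < r"
  shows "\<rho> (a i \<otimes>\<^sub>Z e i) (H xs) = scaleV (of_bool (\<phi> (a i) \<in> set xs)) (H xs)"
proof (cases "\<phi> (a i) \<in> set xs")
  case True
  then obtain l where "l < k" "xs ! l = \<phi> (a i)" using xs by (auto simp: in_set_conv_nth)
  then show ?thesis using replace_basis_vector[OF H xs _ _ i, of l "a i"] True by (metis list_update_id of_bool_eq(2) L.V.scale_one)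
next
  case False
  have tup: "xs \<in> tuples k U" using xs E_subset by (auto simp: tuples_def)
  have "H (xs[l := fun_scale ((xs ! l) (e i)) (\<phi> (a i))]) = 0" if l: "l < k" for l
  proof -
    obtain j where j: "j < r" "xs ! l = \<phi> (a j)" using E_nth[OF xs(2), of l] l xs(3) by auto
    then have "j \<noteq> i" using False l xs by (metis nth_mem)
    then show ?thesis
      using alternating_eqs(2)[OF equivariant_alternatingD(1)[OF H] tup l pair_mem_U, of "0" "a i"] j i
      by (simp add: dual)
  qed
  then show ?thesis using False by (simp add: equivariant_alternatingD(2)[OF H tup])
qed

section \<open>From equivariant alternating maps to isomorphisms\<close>

lemma act_equivariant_alternating:
  assumes H: "equivariant_alternating k H" and us: "us \<in> tuples k U"
  shows "\<rho> x (H us) = (\<Sum>l<k. H (us[l := L_dual_act \<phi> x (us ! l)]))"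
proof (induction x rule: tensor_induct)
  have nth: "us ! l \<in> U" if "l < k" for l using us that by (auto simp: tuples_def)
  note A = alternating_eqs[OF equivariant_alternatingD(1)[OF H] us]
  have pure_act: "L_dual_act \<phi> (g \<otimes>\<^sub>Z d) (us ! l) = fun_scale ((us ! l) d) (\<phi> g)" if "l < k" for l g d
    by (rule L_dual_act(1)) (rule U_linear(1)[OF nth[OF that]])
  {
    case zero
    have z: "L_dual_act \<phi> 0 (us ! l) = 0" if "l < k" for l
      using L_dual_act(2)[of "us ! l" 0 0] U_linear(1)[OF nth[OF that]] by simp
    have "H (us[l := L_dual_act \<phi> 0 (us ! l)]) = 0" if "l < k" for l
      unfolding z[OF that] by (rule A(4)[OF that])
    then show ?case by (simp add: act_left_simps)
  next
    case (pure g d)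
    show ?case unfolding equivariant_alternatingD(2)[OF H us] by (intro sum.cong) (simp_all add: pure_act)
  next
    case (diff x y)
    have "H (us[l := L_dual_act \<phi> (x - y) (us ! l)]) =
        H (us[l := L_dual_act \<phi> x (us ! l)]) - H (us[l := L_dual_act \<phi> y (us ! l)])" if "l < k" for l
      using L_dual_act(2)[of "us ! l" x y] U_linear(1)[OF nth[OF that]] A(5)[OF that]
      by (simp add: L_dual_act_mem_U)
    then show ?case using diff by (simp add: act_left_simps sum_subtractf)
  }
qed

text \<open>Since \<open>N\<close> may be larger than the relations, membership in such an
  \<open>N\<close> can be tested on basis tuples alone.\<close>

lemma alternating_mod_wedge:
  assumes N: "module.subspace (fscale (*)) N" "wnull k \<subseteq> N"
  shows "alternating_mod (fscale (*)) fun_scale U k N (\<lambda>us. Poly_Mapping.single us 1)"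
proof -
  interpret P: vector_space "fscale (*) :: complex \<Rightarrow> (('d \<Rightarrow> complex) list \<Rightarrow>\<^sub>0 complex) \<Rightarrow> _"
    by (rule vector_space_wedge)
  interpret F: vector_space "fun_scale :: _ \<Rightarrow> ('d \<Rightarrow> complex) \<Rightarrow> _" by (rule vector_space_fun_scale)
  show ?thesis
  proof
    fix us assume us: "us \<in> tuples k U"
    {
      fix l u v assume l: "l < k" and u: "u \<in> U" and v: "v \<in> U"
      have "Poly_Mapping.single (us[l := u + v]) 1 - Poly_Mapping.single (us[l := u]) 1
          - Poly_Mapping.single (us[l := v]) (1 :: complex) \<in> wnull k"
        unfolding wedge_null_def using us l u v by (intro P.span_base) blast
      then show "Poly_Mapping.single (us[l := u + v]) 1 - Poly_Mapping.single (us[l := u]) 1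
          - Poly_Mapping.single (us[l := v]) (1 :: complex) \<in> N" using N(2) by blast
    }
    {
      fix l u c assume l: "l < k" and u: "u \<in> U"
      have "Poly_Mapping.single (us[l := fun_scale c u]) 1 - Poly_Mapping.single (us[l := u]) c \<in> wnull k"
        unfolding wedge_null_def using us l u by (intro P.span_base) blast
      then show "Poly_Mapping.single (us[l := fun_scale c u]) 1
          - fscale (*) c (Poly_Mapping.single (us[l := u]) 1) \<in> N"
        using N(2) by (auto simp: fscale_single)
    }
    assume nd: "\<not> distinct us"
    have "Poly_Mapping.single us 1 \<in> wnull k"
      unfolding wedge_null_def using us nd by (intro P.span_base) blast
    then show "Poly_Mapping.single us 1 \<in> N" using N(2) by blast
  qed (rule N subspace_U)+
qed

text \<open>Fixing one order for each subset of \<open>E\<close> leaves one wedge per subset, so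
  that no signs have to be recorded.\<close>

definition enum :: "('d \<Rightarrow> complex) set \<Rightarrow> ('d \<Rightarrow> complex) list" where
  "enum S = (SOME xs. distinct xs \<and> set xs = S)"

lemma enum: "finite S \<Longrightarrow> distinct (enum S)" "finite S \<Longrightarrow> set (enum S) = S"
  "finite S \<Longrightarrow> length (enum S) = card S"
proof -
  assume "finite S"
  then have *: "distinct (enum S) \<and> set (enum S) = S"
    unfolding enum_def by (metis (mono_tags, lifting) finite_distinct_list someI_ex)
  then show "distinct (enum S)" "set (enum S) = S" by simp_all
  then show "length (enum S) = card S" by (metis distinct_card)
qed

text \<open>The elements with such an expansion form a subspace \<open>N\<close> containing the
  relations. Tuples are alternating modulo \<open>N\<close>, so it is enough to treat distinct
  tuples from \<open>E\<close>, which are the chosen \<open>enum S\<close> up to order.\<close>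

lemma wfree_basis:
  assumes "p \<in> wfree k"
  shows "\<exists>c. p - (\<Sum>S | S \<subseteq> E \<and> card S = k. fscale (*) (c S) (Poly_Mapping.single (enum S) 1)) \<in> wnull k"
proof -
  interpret P: vector_space "fscale (*) :: complex \<Rightarrow> (('d \<Rightarrow> complex) list \<Rightarrow>\<^sub>0 complex) \<Rightarrow> _"
    by (rule vector_space_wedge)
  let ?S = "{S. S \<subseteq> E \<and> card S = k}"
  let ?b = "\<lambda>c. \<Sum>S\<in>?S. fscale (*) (c S) (Poly_Mapping.single (enum S) (1 :: complex))"
  define N where "N = {p. \<exists>c. p - ?b c \<in> wnull k}"
  note wn = subspace_wnull[of k]
  have finS: "finite ?S" using finite_E by simp
  have NI: "p \<in> N" if "p - ?b c \<in> wnull k" for p c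
    unfolding N_def mem_Collect_eq by (rule exI[where x = c]) (rule that)
  have null: "wnull k \<subseteq> N"
    by (rule subsetI, rule NI[of _ "\<lambda>_. 0"]) simp
  have N: "P.subspace N"
    unfolding P.subspace_def
  proof (intro conjI ballI allI)
    show "0 \<in> N" using null P.subspace_0[OF wn] by blast
    fix p assume "p \<in> N"
    then obtain c where c: "p - ?b c \<in> wnull k" by (auto simp: N_def)
    show "fscale (*) z p \<in> N" for z
    proof -
      have eq: "fscale (*) z p - ?b (\<lambda>S. z * c S) = fscale (*) z (p - ?b c)"
        by (simp add: P.scale_right_diff_distrib P.scale_sum_right)
      show ?thesis
        by (rule NI[of _ "\<lambda>S. z * c S"], unfold eq, rule P.subspace_scale[OF wn c])
    qed
    fix q assume "q \<in> N"
    then obtain c' where c': "q - ?b c' \<in> wnull k" by (auto simp: N_def)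
    have eq: "p + q - ?b (\<lambda>S. c S + c' S) = (p - ?b c) + (q - ?b c')"
      by (simp add: P.scale_left_distrib sum.distrib)
    show "p + q \<in> N"
      by (rule NI[of _ "\<lambda>S. c S + c' S"], unfold eq, rule P.subspace_add[OF wn c c'])
  qed
  interpret A: alternating_mod "fscale (*)" fun_scale U k N "\<lambda>us. Poly_Mapping.single us 1"
    by (rule alternating_mod_wedge[OF N null])
  have enumN: "Poly_Mapping.single (enum S) 1 \<in> N" if "S \<in> ?S" for S
  proof -
    have "?b (\<lambda>S'. of_bool (S' = S)) = (\<Sum>S'\<in>?S. if S' = S then Poly_Mapping.single (enum S) 1 else 0)"
      by (intro sum.cong refl) simp
    also have "\<dots> = Poly_Mapping.single (enum S) 1" using finS that by simp
    finally have "Poly_Mapping.single (enum S) 1 - ?b (\<lambda>S'. of_bool (S' = S)) \<in> wnull k"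
      using P.subspace_0[OF wn] by simp
    then show ?thesis by (rule NI)
  qed
  have "Poly_Mapping.single us 1 \<in> N" if us: "us \<in> tuples k U" for us
  proof (rule A.mem_if_basis_mem[OF finite_E E_subset U_span _ us])
    fix xs assume xs: "distinct xs" "set xs \<subseteq> E" "length xs = k"
    then have S: "set xs \<in> ?S" by (simp add: distinct_card)
    have m: "mset (enum (set xs)) = mset xs"
      using xs by (subst set_eq_iff_mset_eq_distinct[symmetric]) (simp_all add: enum)
    have "[] @ enum (set xs) \<in> tuples k U"
      using S xs E_subset by (simp add: tuples_def enum)
    from A.permute_mem[OF m this] enumN[OF S] show "Poly_Mapping.single xs 1 \<in> N" by simp
  qed
  then have "Poly_Mapping.single us c \<in> N" if "us \<in> tuples k U" for us c
    using P.subspace_scale[OF N, of "Poly_Mapping.single us 1" c] that by (simp add: fscale_single)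
  with assms have "p \<in> N"
    by (induction p rule: wfree_induct) (auto intro: P.subspace_0[OF N] P.subspace_add[OF N])
  then show ?thesis by (simp add: N_def)
qed

lemma span_equivariant_alternating:
  assumes simple: "simple_lie_module (L_scale scaleD) (L_bracket scaleD \<phi>) scaleV \<rho>"
    and H: "equivariant_alternating k H" and nz: "us \<in> tuples k U" "H us \<noteq> 0"
  shows "L.V.span (H ` tuples k U) = UNIV"
proof -
  let ?M = "L.V.span (H ` tuples k U)"
  have "\<rho> x v \<in> ?M" if "v \<in> ?M" for x v
    using that
  proof (induction rule: L.V.span_induct_alt)
    case base
    then show ?case by (simp add: act_simps L.V.span_zero)
  next
    case (step c v w)
    then obtain ws where ws: "ws \<in> tuples k U" "v = H ws" by blast
    have "\<rho> x v \<in> ?M" unfolding ws(2) act_equivariant_alternating[OF H ws(1)]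
      using ws(1) by (intro L.V.span_sum L.V.span_base imageI tuples_update L_dual_act_mem_U)
    then show ?case using step by (simp add: act_simps L.V.span_add L.V.span_scale)
  qed
  then have "lie_submodule scaleV \<rho> ?M" by (simp add: lie_submodule_def)
  moreover have "H us \<in> ?M" using nz by (intro L.V.span_base imageI)
  ultimately show ?thesis using simple nz(2) unfolding simple_lie_module_def by blast
qed

text \<open>The linear extension \<open>\<gamma>\<close> of \<open>H\<close> is onto because
  \<open>V\<close> is simple. Its kernel on the free space consists of the relations: modulo these,
  every element is a combination of wedges of subsets of \<open>E\<close>, whose images are nonzero
  and have different weights.\<close>

lemma iso_if_equivariant_alternating:
  assumes simple: "simple_lie_module (L_scale scaleD) (L_bracket scaleD \<phi>) scaleV \<rho>"
    and H: "equivariant_alternating k H" and nz: "us \<in> tuples k U" "H us \<noteq> 0"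
  shows "lie_module_iso \<lparr>points = UNIV, madd = (+), msmult = scaleV, mact = \<rho>\<rparr>
          (exterior_bar_dual scaleD \<phi> k)"
proof -
  interpret P: vector_space "fscale (*) :: complex \<Rightarrow> (('d \<Rightarrow> complex) list \<Rightarrow>\<^sub>0 complex) \<Rightarrow> _"
    by (rule vector_space_wedge)
  define \<gamma> where "\<gamma> p = (\<Sum>us\<in>Poly_Mapping.keys p. scaleV (Poly_Mapping.lookup p us) (H us))"
    for p
  have \<gamma>single: "\<gamma> (Poly_Mapping.single us c) = scaleV c (H us)"
    and \<gamma>diff: "\<gamma> (p - q) = \<gamma> p - \<gamma> q" for us c p q
    unfolding \<gamma>_def
    by (rule pm_ext[where h = "\<lambda>us c. scaleV c (H us)"]; simp add: L.V.scale_left_diff_distrib)+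
  have \<gamma>0: "\<gamma> 0 = 0" using \<gamma>diff[of 0 0] by simp
  have \<gamma>add: "\<gamma> (p + q) = \<gamma> p + \<gamma> q" for p q using \<gamma>diff[of "p + q" q] by simp
  have \<gamma>scale: "\<gamma> (fscale (*) c p) = scaleV c (\<gamma> p)" for c p
    by (induction p rule: pm_induct)
      (simp_all add: \<gamma>0 \<gamma>diff \<gamma>single fscale_single P.scale_right_diff_distrib L.V.scale_right_diff_distrib)
  have \<gamma>sum: "\<gamma> (\<Sum>i\<in>I. h i) = (\<Sum>i\<in>I. \<gamma> (h i))" for h and I :: "'i set"
    by (induction I rule: infinite_finite_induct) (simp_all add: \<gamma>0 \<gamma>add)
  have \<gamma>null: "\<gamma> p = 0" if "p \<in> wnull k" for p
  proof -
    have "P.subspace {p. \<gamma> p = 0}" by (simp add: P.subspace_def \<gamma>0 \<gamma>add \<gamma>scale)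
    note A = alternating_eqs[OF equivariant_alternatingD(1)[OF H]]
    have "wnull k \<subseteq> {p. \<gamma> p = 0}"
      unfolding wedge_null_def
      by (rule P.span_minimal[OF _ \<open>P.subspace {p. \<gamma> p = 0}\<close>]) (auto simp: \<gamma>diff \<gamma>single A)
    then show ?thesis using that by blast
  qed
  have \<gamma>act: "\<gamma> (wedge_act (L_dual_act \<phi>) x p) = \<rho> x (\<gamma> p)" if "p \<in> wfree k" for p x
    using that
  proof (induction p rule: wfree_induct)
    case zero
    then show ?case by (simp add: wedge_act_add \<gamma>0 act_simps)
  next
    case (single us c)
    have "length us = k" using single by (simp add: tuples_def)
    then show ?case
      by (simp add: wedge_act_single \<gamma>sum \<gamma>single act_simps act_equivariant_alternating[OF H single] L.V.scale_sum_right)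
  next
    case (add p q)
    then show ?case by (simp add: wedge_act_add \<gamma>add act_simps)
  qed
  have surj: "\<exists>p\<in>wfree k. \<gamma> p = v" for v
  proof -
    let ?M = "\<gamma> ` wfree k"
    have "H us \<in> ?M" if "us \<in> tuples k U" for us
      using single_mem_wfree[OF that, of 1] \<gamma>single[of us 1] by (metis L.V.scale_one imageI)
    moreover have "L.V.subspace ?M"
      unfolding L.V.subspace_def
      by (auto simp flip: \<gamma>add \<gamma>scale intro!: imageI P.subspace_add P.subspace_scale subspace_wfree)
        (metis \<gamma>0 P.subspace_0 imageI subspace_wfree)
    ultimately have "L.V.span (H ` tuples k U) \<subseteq> ?M" by (intro L.V.span_minimal) auto
    then have "v \<in> ?M" unfolding span_equivariant_alternating[OF simple H nz] by (rule subsetD) (rule UNIV_I)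
    then show ?thesis by blast
  qed
  have inj: "p \<in> wnull k" if p: "p \<in> wfree k" "\<gamma> p = 0" for p
  proof -
    let ?S = "{S. S \<subseteq> E \<and> card S = k}"
    obtain c where c: "p - (\<Sum>S\<in>?S. fscale (*) (c S) (Poly_Mapping.single (enum S) 1)) \<in> wnull k"
      using wfree_basis[OF p(1)] by blast
    have finS: "finite ?S" using finite_E by simp
    have en: "distinct (enum S)" "set (enum S) = S" "length (enum S) = k" if "S \<in> ?S" for S
      using that finite_subset[OF _ finite_E, of S] by (simp_all add: enum)
    have sum0: "(\<Sum>S\<in>?S. scaleV (c S) (H (enum S))) = 0"
      using \<gamma>null[OF c] p(2) by (simp add: \<gamma>diff \<gamma>sum \<gamma>scale \<gamma>single)
    have "scaleV (c S) (H (enum S)) \<in> {0}" if S: "S \<in> ?S" for S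
    proof (rule L.V.weight_components_mem[where D = "\<lambda>i. \<rho> (a i \<otimes>\<^sub>Z e i)" and I = "{..<r}"
          and w = "\<lambda>i S. of_bool (\<phi> (a i) \<in> S)" and J = ?S])
      show "L.V.subspace {0}" by simp
      show "\<rho> (a i \<otimes>\<^sub>Z e i) w \<in> {0}" if "w \<in> {0}" for i w using that by (simp add: act_simps)
      show "Vector_Spaces.linear scaleV scaleV (\<rho> (a i \<otimes>\<^sub>Z e i))" for i by (rule linear_act)
      show "finite ?S" by (rule finS)
      show "(\<Sum>S\<in>?S. scaleV (c S) (H (enum S))) \<in> {0}" using sum0 by simp
      show "S \<in> ?S" by (rule S)
      show "\<rho> (a i \<otimes>\<^sub>Z e i) (scaleV (c S) (H (enum S))) =
          scaleV (of_bool (\<phi> (a i) \<in> S)) (scaleV (c S) (H (enum S)))"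
        if i: "i \<in> {..<r}" and S: "S \<in> ?S" for i S
        using H_basis_weight[OF H en(1)[OF S] _ en(3)[OF S], of i] en(2)[OF S] i S
        by (simp add: act_simps mult.commute)
      show "\<exists>i\<in>{..<r}. of_bool (\<phi> (a i) \<in> S) \<noteq> (of_bool (\<phi> (a i) \<in> S') :: complex)"
        if SS: "S \<in> ?S" "S' \<in> ?S" "S \<noteq> S'" for S S'
      proof -
        obtain x where "x \<in> E" "x \<in> S \<longleftrightarrow> x \<notin> S'" using SS by blast
        then show ?thesis by (auto simp: E_def)
      qed
    qed
    moreover have "H (enum S) \<noteq> 0" if "S \<in> ?S" for S
      using H_basis_nonzero[OF H nz en(1)[OF that] _ en(3)[OF that]] en(2)[OF that] that by simp
    ultimately have "c S = 0" if "S \<in> ?S" for S using that by (metis L.V.scale_eq_0_iff singletonD)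
    then show ?thesis using c by simp
  qed
  \<comment> \<open>The fibres of \<open>\<gamma>\<close> are the equivalence classes, so sending a
    vector to its fibre inverts the map induced on the quotient.\<close>
  define f where "f v = {p \<in> wfree k. \<gamma> p = v}" for v
  have cls: "wcls k {p} = f (\<gamma> p)" if "p \<in> wfree k" for p
  proof -
    have "p - q \<in> wnull k \<longleftrightarrow> \<gamma> q = \<gamma> p" if "q \<in> wfree k" for q
      using \<gamma>null[of "p - q"] inj[of "p - q"] P.subspace_diff[OF subspace_wfree \<open>p \<in> wfree k\<close> that]
      by (auto simp: \<gamma>diff)
    then show ?thesis unfolding wcls_eq[OF that] f_def by blast
  qed
  have ne: "\<exists>p. p \<in> f v" for v using surj[of v] by (auto simp: f_def)
  have "bij_betw f UNIV (wfree k // wedge_rel fun_scale k U)"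
    unfolding bij_betw_def
  proof
    show "inj f"
    proof (rule injI)
      fix u v assume "f u = f v"
      moreover obtain p where "p \<in> f u" using ne by blast
      ultimately show "u = v" by (auto simp: f_def)
    qed
    show "range f = wfree k // wedge_rel fun_scale k U"
    proof (intro equalityI subsetI)
      fix P assume "P \<in> range f"
      then obtain v where "P = f v" by blast
      moreover obtain p where "p \<in> wfree k" "\<gamma> p = v" using surj by blast
      ultimately show "P \<in> wfree k // wedge_rel fun_scale k U" using cls[of p] by (metis quotientI)
    next
      fix P assume "P \<in> wfree k // wedge_rel fun_scale k U"
      then obtain p where "p \<in> wfree k" "P = wcls k {p}" by (rule quotientE)
      then show "P \<in> range f" using cls by blast
    qed
  qed
  moreover have "f (u + v) = (\<Union>p\<in>f u. \<Union>q\<in>f v. wcls k {p + q})" for u v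
  proof -
    have "wcls k {p + q} = f (u + v)" if "p \<in> f u" "q \<in> f v" for p q
      using that cls[of "p + q"] P.subspace_add[OF subspace_wfree, of p k q] by (auto simp: f_def \<gamma>add)
    then show ?thesis using ne[of u] ne[of v] by blast
  qed
  moreover have "f (scaleV c v) = (\<Union>p\<in>f v. wcls k {fscale (*) c p})" for c v
  proof -
    have "wcls k {fscale (*) c p} = f (scaleV c v)" if "p \<in> f v" for p
      using that cls[of "fscale (*) c p"] P.subspace_scale[OF subspace_wfree, of p k c] by (auto simp: f_def \<gamma>scale)
    then show ?thesis using ne[of v] by blast
  qed
  moreover have "f (\<rho> x v) = (\<Union>p\<in>f v. wcls k {wedge_act (L_dual_act \<phi>) x p})" for x v
  proof -
    have "wcls k {wedge_act (L_dual_act \<phi>) x p} = f (\<rho> x v)" if "p \<in> f v" for p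
      using that cls[of "wedge_act (L_dual_act \<phi>) x p"] wedge_act_mem_wfree[of p k x] by (auto simp: f_def \<gamma>act)
    then show ?thesis using ne[of v] by blast
  qed
  ultimately show ?thesis
    unfolding lie_module_iso_def exterior_bar_dual_def exterior_power_def Let_def by auto
qed

end

section \<open>Submodules of the tensor modules\<close>

locale witt_gamma = witt_rep scaleD \<phi> r a e scaleV \<rho>
  for scaleD :: "complex \<Rightarrow> 'd::ab_group_add \<Rightarrow> 'd"
    and \<phi> :: "'g::ab_group_add \<Rightarrow> 'd \<Rightarrow> complex"
    and r :: nat and a :: "nat \<Rightarrow> 'g" and e :: "nat \<Rightarrow> 'd"
    and scaleV :: "complex \<Rightarrow> 'v::ab_group_add \<Rightarrow> 'v"
    and \<rho> :: "('g, 'd) tensor \<Rightarrow> 'v \<Rightarrow> 'v" +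
  fixes \<sigma> :: "'d \<Rightarrow> complex"
  assumes linear_\<sigma>: "Vector_Spaces.linear scaleD (*) \<sigma>"
begin

abbreviation "\<Gamma> \<equiv> Gamma_act \<phi> scaleV \<rho> \<sigma>"
abbreviation "simple_\<Gamma> \<equiv> simple_lie_module (fscale scaleD) (W_bracket scaleD \<phi>) (fscale scaleV) \<Gamma>"

lemma \<sigma>_simps: "\<sigma> (d + d') = \<sigma> d + \<sigma> d'" "\<sigma> (d - d') = \<sigma> d - \<sigma> d'" "\<sigma> (scaleD c d) = c * \<sigma> d"
proof -
  interpret s: Vector_Spaces.linear scaleD "(*)" \<sigma> by (rule linear_\<sigma>)
  show "\<sigma> (d + d') = \<sigma> d + \<sigma> d'" "\<sigma> (d - d') = \<sigma> d - \<sigma> d'" "\<sigma> (scaleD c d) = c * \<sigma> d"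
    by (simp_all add: s.add s.diff s.scale)
qed

sublocale G: lie_module "fscale scaleD" "W_bracket scaleD \<phi>" "fscale scaleV" \<Gamma>
  by (rule lie_module_Gamma[OF L.lie_module_axioms linear_\<sigma>])

lemma pure_tensor_diff: "x \<otimes>\<^sub>Z (d - d') = x \<otimes>\<^sub>Z d - x \<otimes>\<^sub>Z (d' :: 'd)" for x :: 'g
  using pure_tensor_add_right[of x "d - d'" d'] by (simp add: algebra_simps)

lemma \<Gamma>_single: "\<Gamma> (Poly_Mapping.single x d) (Poly_Mapping.single b v) =
    Poly_Mapping.single (x + b) (scaleV (\<phi> b d + \<sigma> d) v + \<rho> (x \<otimes>\<^sub>Z d) v)"
  and \<Gamma>_diff: "\<Gamma> (p - p') q = \<Gamma> p q - \<Gamma> p' q" "\<Gamma> p (q - q') = \<Gamma> p q - \<Gamma> p q'"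
  unfolding Gamma_act_def Let_def
  by (rule pm_ext2[where h = "\<lambda>a b d v. Poly_Mapping.single (a + b) (scaleV (\<phi> b d + \<sigma> d) v + \<rho> (a \<otimes>\<^sub>Z d) v)"];
      simp add: pair_diff \<sigma>_simps act_simps act_left_simps pure_tensor_diff L.V.scale_left_diff_distrib
        L.V.scale_right_diff_distrib L.V.scale_left_distrib L.V.scale_right_distrib algebra_simps
        flip: single_diff)+

lemma \<Gamma>_zero: "\<Gamma> 0 q = 0" "\<Gamma> p 0 = 0"
  using \<Gamma>_diff(1)[of 0 0] \<Gamma>_diff(2)[of _ 0 0] by simp_all

lemma lookup_\<Gamma>_single: "Poly_Mapping.lookup (\<Gamma> (Poly_Mapping.single x d) p) c =
    scaleV (\<phi> (c - x) d + \<sigma> d) (Poly_Mapping.lookup p (c - x)) + \<rho> (x \<otimes>\<^sub>Z d) (Poly_Mapping.lookup p (c - x))"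
proof (induction p rule: pm_induct)
  case zero
  then show ?case by (simp add: \<Gamma>_zero act_simps)
next
  case (single k v)
  have "x + k = c \<longleftrightarrow> k = c - x" by auto
  then show ?case by (auto simp: \<Gamma>_single lookup_single when_def act_simps)
next
  case (diff p q)
  then show ?case by (simp add: \<Gamma>_diff lookup_minus act_simps L.V.scale_right_diff_distrib)
qed

lemma lookup_fscale: "Poly_Mapping.lookup (fscale scaleV c p) b = scaleV c (Poly_Mapping.lookup p b)"
  by (rule fscale_lookup) simp

text \<open>Taking the coefficient at each \<open>b\<close> from \<open>M b\<close> gives a
  submodule; \<open>v\<close> and \<open>w\<close> show that it is neither zero nor
  everything.\<close>

lemma not_simple_if_graded:
  assumes sub: "\<And>b. L.V.subspace (M b)"
    and step: "\<And>b x d v. v \<in> M b \<Longrightarrow> scaleV (\<phi> b d + \<sigma> d) v + \<rho> (x \<otimes>\<^sub>Z d) v \<in> M (x + b)"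
    and v: "v \<in> M b" "v \<noteq> 0" and w: "w \<notin> M c"
  shows "\<not> simple_\<Gamma>"
proof
  assume simple: simple_\<Gamma>
  define S where "S = {p. \<forall>b. Poly_Mapping.lookup p b \<in> M b}"
  have S: "G.V.subspace S"
    unfolding G.V.subspace_def S_def
    by (auto simp: lookup_add lookup_fscale L.V.subspace_0[OF sub] L.V.subspace_add[OF sub] L.V.subspace_scale[OF sub])
  have "\<Gamma> x p \<in> S" if p: "p \<in> S" for x p
  proof (induction x rule: pm_induct)
    case zero
    then show ?case by (simp add: \<Gamma>_zero G.V.subspace_0[OF S])
  next
    case (single x d)
    have "Poly_Mapping.lookup (\<Gamma> (Poly_Mapping.single x d) p) c \<in> M c" for c
      unfolding lookup_\<Gamma>_single using step[of "Poly_Mapping.lookup p (c - x)" "c - x" d x] p by (simp add: S_def)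
    then show ?case by (simp add: S_def)
  next
    case (diff p q)
    then show ?case by (simp add: \<Gamma>_diff G.V.subspace_diff[OF S])
  qed
  then have "lie_submodule (fscale scaleV) \<Gamma> S" using S by (simp add: lie_submodule_def)
  then have "S = {0} \<or> S = UNIV" using simple unfolding simple_lie_module_def by blast
  moreover have "Poly_Mapping.single b v \<in> S"
    using v by (auto simp: S_def lookup_single when_def L.V.subspace_0[OF sub])
  moreover have "Poly_Mapping.single b v \<noteq> 0" using v(2) by (metis lookup_single_eq lookup_zero)
  moreover have "Poly_Mapping.single c w \<notin> S"
    using w unfolding S_def by (metis lookup_single_eq mem_Collect_eq)
  ultimately show False by blast
qed

section \<open>Submodules when \<open>V\<close> is an exterior power\<close>

lemma tuples_Cons: "u # ws \<in> tuples (Suc k) U \<longleftrightarrow> u \<in> U \<and> ws \<in> tuples k U"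
  by (auto simp: tuples_def)

lemma equivariant_alternating_Cons:
  assumes H: "equivariant_alternating (Suc k) H" and ws: "ws \<in> tuples k U"
  shows "u \<in> U \<Longrightarrow> v \<in> U \<Longrightarrow> H ((u + v) # ws) = H (u # ws) + H (v # ws)"
    and "u \<in> U \<Longrightarrow> v \<in> U \<Longrightarrow> H ((u - v) # ws) = H (u # ws) - H (v # ws)"
    and "u \<in> U \<Longrightarrow> H (fun_scale c u # ws) = scaleV c (H (u # ws))"
    and "H (0 # ws) = 0" and "u \<in> set ws \<Longrightarrow> u \<in> U \<Longrightarrow> H (u # ws) = 0"
    and "u \<in> U \<Longrightarrow> \<rho> (g \<otimes>\<^sub>Z d) (H (u # ws)) =
      scaleV (u d) (H (\<phi> g # ws)) + (\<Sum>l<k. scaleV ((ws ! l) d) (H (u # ws[l := \<phi> g])))"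
proof -
  note A = equivariant_alternatingD(1)[OF H]
  have t: "\<phi> 0 # ws \<in> tuples (Suc k) U" using ws pair_mem_U by (simp add: tuples_Cons)
  note B = alternating_eqs[OF A t]
  show "u \<in> U \<Longrightarrow> v \<in> U \<Longrightarrow> H ((u + v) # ws) = H (u # ws) + H (v # ws)" using B(1)[of 0 u v] by simp
  show "u \<in> U \<Longrightarrow> v \<in> U \<Longrightarrow> H ((u - v) # ws) = H (u # ws) - H (v # ws)" using B(5)[of 0 u v] by simp
  show scale: "u \<in> U \<Longrightarrow> H (fun_scale c u # ws) = scaleV c (H (u # ws))" for c u using B(2)[of 0 u c] by simp
  show "H (0 # ws) = 0" using B(4)[of 0] by simp
  show "u \<in> set ws \<Longrightarrow> u \<in> U \<Longrightarrow> H (u # ws) = 0"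
    using ws by (intro alternating_eqs(3)[OF A]) (auto simp: tuples_Cons)
  assume u: "u \<in> U"
  then have t': "u # ws \<in> tuples (Suc k) U" using ws by (simp add: tuples_Cons)
  have "H (u # ws[l := fun_scale ((ws ! l) d) (\<phi> g)]) = scaleV ((ws ! l) d) (H (u # ws[l := \<phi> g]))"
    if "l < k" for l
    using alternating_eqs(2)[OF A t', of "Suc l" "\<phi> g" "(ws ! l) d"] that pair_mem_U by simp
  then show "\<rho> (g \<otimes>\<^sub>Z d) (H (u # ws)) =
      scaleV (u d) (H (\<phi> g # ws)) + (\<Sum>l<k. scaleV ((ws ! l) d) (H (u # ws[l := \<phi> g])))"
    unfolding equivariant_alternatingD(2)[OF H t'] sum.lessThan_Suc_shift
    by (simp add: scale[OF pair_mem_U])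
qed

text \<open>Extends the action of \<open>g \<otimes>\<^sub>Z d\<close> from group elements to
  functionals by complex linearity over the dual basis. On an exterior power of \<open>U\<close> it
  is contraction by \<open>d\<close> followed by exterior multiplication by
  \<open>u\<close>.\<close>

definition T :: "('d \<Rightarrow> complex) \<Rightarrow> 'd \<Rightarrow> 'v \<Rightarrow> 'v" where
  "T u d v = (\<Sum>i<r. scaleV (u (e i)) (\<rho> (a i \<otimes>\<^sub>Z d) v))"

lemma T_simps:
  "T (u + u') d v = T u d v + T u' d v" "T (fun_scale c u) d v = scaleV c (T u d v)"
  "T u d (v + w) = T u d v + T u d w" "T u d (v - w) = T u d v - T u d w"
  "T u d (scaleV c v) = scaleV c (T u d v)" "T u d 0 = 0"
  by (simp_all add: T_def act_simps L.V.scale_left_distrib L.V.scale_right_distrib sum.distrib sum_subtractf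
      L.V.scale_right_diff_distrib L.V.scale_sum_right mult.commute)

lemma not_simple_exterior:
  assumes H: "equivariant_alternating (Suc k) H" and span: "L.V.span (H ` tuples (Suc k) U) = UNIV"
    and nz: "(v0 :: 'v) \<noteq> 0" and \<sigma>: "\<And>d. d \<in> Ker2 \<phi> \<Longrightarrow> \<sigma> d = 0"
    and k: "Suc k < r \<or> \<sigma> \<in> range \<phi>"
  shows "\<not> simple_\<Gamma>"
proof -
  interpret F: vector_space "fun_scale :: _ \<Rightarrow> ('d \<Rightarrow> complex) \<Rightarrow> _" by (rule vector_space_fun_scale)
  have \<sigma>U: "\<sigma> \<in> U" using linear_\<sigma> \<sigma> by (simp add: bar_dual_def)
  have \<beta>U: "\<phi> b + \<sigma> \<in> U" for b by (rule F.subspace_add[OF subspace_U pair_mem_U \<sigma>U])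
  note HC = equivariant_alternating_Cons[OF H]
  have nz_tuple: "\<exists>us\<in>tuples (Suc k) U. H us \<noteq> 0"
  proof (rule ccontr)
    assume "\<not> ?thesis"
    then have "H ` tuples (Suc k) U \<subseteq> {0}" by auto
    then have "L.V.span (H ` tuples (Suc k) U) \<subseteq> {0}" by (intro L.V.span_minimal) auto
    then show False using span nz by auto
  qed
  define M where "M b = L.V.span ((\<lambda>ws. H ((\<phi> b + \<sigma>) # ws)) ` tuples k U)" for b
  have sub: "L.V.subspace (M b)" for b unfolding M_def by (rule L.V.subspace_span)
  have base: "H ((\<phi> b + \<sigma>) # ws) \<in> M b" if "ws \<in> tuples k U" for b ws
    unfolding M_def using that by (intro L.V.span_base imageI)
  have step: "scaleV (\<phi> b d + \<sigma> d) v + \<rho> (x \<otimes>\<^sub>Z d) v \<in> M (x + b)" if "v \<in> M b" for b x d v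
    using that unfolding M_def[of b]
  proof (induction rule: L.V.span_induct_alt)
    case base
    then show ?case by (simp add: act_simps L.V.subspace_0[OF sub])
  next
    case (step c v w)
    then obtain ws where ws: "ws \<in> tuples k U" "v = H ((\<phi> b + \<sigma>) # ws)" by blast
    have eq: "\<phi> (x + b) + \<sigma> = \<phi> x + (\<phi> b + \<sigma>)" by (simp add: fun_eq_iff additive_left)
    have add: "H ((\<phi> (x + b) + \<sigma>) # ws') = H (\<phi> x # ws') + H ((\<phi> b + \<sigma>) # ws')" if "ws' \<in> tuples k U" for ws'
      unfolding eq by (rule HC(1)[OF that pair_mem_U \<beta>U])
    have upd: "ws[l := \<phi> x] \<in> tuples k U" for l by (rule tuples_update[OF ws(1) pair_mem_U])
    \<comment> \<open>The two heads differ by \<open>\<phi> x\<close>, which already stands in slot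
      \<open>l\<close>, so alternation allows the head to be changed.\<close>
    have sum: "H ((\<phi> b + \<sigma>) # ws[l := \<phi> x]) = H ((\<phi> (x + b) + \<sigma>) # ws[l := \<phi> x])" if "l < k" for l
      using HC(5)[OF upd _ pair_mem_U, of x l] add[OF upd, of l] that ws(1)
      by (simp add: tuples_def set_update_memI)
    have "scaleV (\<phi> b d + \<sigma> d) v + \<rho> (x \<otimes>\<^sub>Z d) v = scaleV ((\<phi> b + \<sigma>) d) (H ((\<phi> (x + b) + \<sigma>) # ws))
        + (\<Sum>l<k. scaleV ((ws ! l) d) (H ((\<phi> (x + b) + \<sigma>) # ws[l := \<phi> x])))"
      unfolding ws(2) HC(6)[OF ws(1) \<beta>U] add[OF ws(1)]
      by (simp add: sum L.V.scale_right_distrib)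
    also have "\<dots> \<in> M (x + b)"
      by (intro L.V.subspace_add[OF sub] L.V.subspace_sum[OF sub] L.V.subspace_scale[OF sub] base upd ws)
    finally have m: "scaleV (\<phi> b d + \<sigma> d) v + \<rho> (x \<otimes>\<^sub>Z d) v \<in> M (x + b)" .
    have "scaleV c (scaleV (\<phi> b d + \<sigma> d) v + \<rho> (x \<otimes>\<^sub>Z d) v) + (scaleV (\<phi> b d + \<sigma> d) w + \<rho> (x \<otimes>\<^sub>Z d) w) \<in> M (x + b)"
      by (rule L.V.subspace_add[OF sub L.V.subspace_scale[OF sub m] step(2)])
    then show ?case by (simp add: act_simps L.V.scale_right_distrib algebra_simps)
  qed
  have "\<exists>b. \<exists>v\<in>M b. v \<noteq> 0"
  proof (rule ccontr)
    assume neg: "\<not> ?thesis"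
    \<comment> \<open>Comparing the degrees \<open>x\<close> and \<open>0\<close> removes
      \<open>\<sigma>\<close> from the head; expanding the head in the \<open>\<phi> (a j)\<close>
      then forces \<open>H us = 0\<close>.\<close>
    have \<phi>0: "H (\<phi> x # ws) = 0" if ws: "ws \<in> tuples k U" for x ws
    proof -
      have "H ((\<phi> x + \<sigma>) # ws) = 0" "H ((\<phi> 0 + \<sigma>) # ws) = 0" using neg base[OF ws] by blast+
      moreover have "\<phi> 0 = 0" by (simp add: fun_eq_iff)
      ultimately show ?thesis using HC(1)[OF ws pair_mem_U \<sigma>U, of x] by simp
    qed
    obtain us where us: "us \<in> tuples (Suc k) U" "H us \<noteq> 0" using nz_tuple by blast
    then obtain u ws where uw: "us = u # ws" by (cases us) (auto simp: tuples_def)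
    have u: "u \<in> U" and ws: "ws \<in> tuples k U" using us uw by (auto simp: tuples_Cons)
    interpret A: alternating_mod scaleV fun_scale U "Suc k" "{0}" H by (rule equivariant_alternatingD(1)[OF H])
    have "H us - (\<Sum>j<r. scaleV (u (e j)) (H (us[0 := \<phi> (a j)]))) \<in> {0}"
      using A.sum_slot[OF us(1), of 0 "{..<r}" "\<lambda>j. \<phi> (a j)" "\<lambda>j. u (e j)"] pair_mem_U U_expand[OF u] uw by simp
    then show False using us uw \<phi>0[OF ws] by simp
  qed
  then obtain b v where v: "v \<in> M b" "v \<noteq> 0" by blast
  moreover have "\<exists>c w. w \<notin> M c"
  proof (cases "\<sigma> \<in> range \<phi>")
    case True
    then obtain s where s: "\<sigma> = \<phi> s" by blast
    have "\<phi> (- s) + \<sigma> = 0" by (simp add: s fun_eq_iff pair_uminus)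
    then have "M (- s) \<subseteq> {0}"
      unfolding M_def using HC(4) by (intro L.V.span_minimal) auto
    then show ?thesis using nz by blast
  next
    case False
    show ?thesis
    proof (rule ccontr)
      assume neg: "\<not> ?thesis"
      \<comment> \<open>\<open>T u d\<close> acts as the derivation that sends an entry
        \<open>w\<close> to the multiple \<open>w d\<close> of \<open>u\<close>.\<close>
      have TH: "T u d (H us) = (\<Sum>l<Suc k. scaleV ((us ! l) d) (H (us[l := u])))"
        if u: "u \<in> U" and us: "us \<in> tuples (Suc k) U" for u d us
      proof -
        interpret A: alternating_mod scaleV fun_scale U "Suc k" "{0}" H by (rule equivariant_alternatingD(1)[OF H])
        have slot: "H (us[l := u]) = (\<Sum>i<r. scaleV (u (e i)) (H (us[l := \<phi> (a i)])))" if "l < Suc k" for l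
          using A.sum_slot[OF us that, of "{..<r}" "\<lambda>j. \<phi> (a j)" "\<lambda>j. u (e j)"] pair_mem_U U_expand[OF u] by simp
        have act: "\<rho> (a i \<otimes>\<^sub>Z d) (H us) = (\<Sum>l<Suc k. scaleV ((us ! l) d) (H (us[l := \<phi> (a i)])))" for i
          unfolding equivariant_alternatingD(2)[OF H us]
          by (intro sum.cong refl alternating_eqs(2)[OF equivariant_alternatingD(1)[OF H] us] pair_mem_U) simp
        have "T u d (H us) = (\<Sum>i<r. \<Sum>l<Suc k. scaleV ((us ! l) d) (scaleV (u (e i)) (H (us[l := \<phi> (a i)]))))"
          unfolding T_def act L.V.scale_sum_right by (intro sum.cong refl) (simp only: L.V.scale_left_commute)
        also have "\<dots> = (\<Sum>l<Suc k. scaleV ((us ! l) d) (H (us[l := u])))"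
          by (subst sum.swap, intro sum.cong refl) (simp add: slot L.V.scale_sum_right)
        finally show ?thesis .
      qed
      \<comment> \<open>Every vector is now a combination of wedges with head
        \<open>\<phi> b + \<sigma>\<close>. The derivation contributes only at the head, since in
        any other slot it repeats that entry.\<close>
      have T\<beta>: "T (\<phi> b + \<sigma>) d v = scaleV ((\<phi> b + \<sigma>) d) v" for b d v
      proof -
        have "v \<in> M b" using neg by blast
        then show ?thesis unfolding M_def
        proof (induction rule: L.V.span_induct_alt)
          case base
          then show ?case by (simp add: T_def act_simps)
        next
          case (step c v w)
          then obtain ws where ws: "ws \<in> tuples k U" "v = H ((\<phi> b + \<sigma>) # ws)" by blast
          have "H ((\<phi> b + \<sigma>) # ws[l := \<phi> b + \<sigma>]) = 0" if "l < k" for l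
            by (rule HC(5)[OF tuples_update[OF ws(1) \<beta>U] _ \<beta>U])
              (use that ws(1) in \<open>simp add: tuples_def set_update_memI\<close>)
          then have Tv: "T (\<phi> b + \<sigma>) d v = scaleV ((\<phi> b + \<sigma>) d) v"
            using TH[OF \<beta>U, of "(\<phi> b + \<sigma>) # ws" b d] ws \<beta>U
            by (simp add: tuples_Cons sum.lessThan_Suc_shift del: sum.lessThan_Suc)
          show ?case
            unfolding T_simps(3) T_simps(5) Tv step(2)
            by (simp only: L.V.scale_right_distrib L.V.scale_scale mult.commute)
        qed
      qed
      have T\<phi>: "T (\<phi> x) d v = scaleV (\<phi> x d) v" for x d v
      proof -
        have "\<phi> 0 = 0" by (simp add: fun_eq_iff)
        then have "T \<sigma> d v = scaleV (\<sigma> d) v" using T\<beta>[of 0 d v] by simp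
        then show ?thesis using T\<beta>[of x d v] unfolding T_simps(1) by (simp add: L.V.scale_left_distrib)
      qed
      obtain us where us: "us \<in> tuples (Suc k) U" "H us \<noteq> 0" using nz_tuple by blast
      have expand_slot: "(\<Sum>j<r. scaleV ((us ! l) (e j)) (H (us[l := \<phi> (a j)]))) = H us" if "l < Suc k" for l
      proof -
        interpret A: alternating_mod scaleV fun_scale U "Suc k" "{0}" H by (rule equivariant_alternatingD(1)[OF H])
        have "us ! l \<in> U" by (rule A.nth_mem_U[OF us(1) that])
        then show ?thesis
          using A.sum_slot[OF us(1) that, of "{..<r}" "\<lambda>j. \<phi> (a j)" "\<lambda>j. (us ! l) (e j)"] pair_mem_U U_expand[of "us ! l"] by simp
      qed
      \<comment> \<open>The sum of the \<open>T (\<phi> (a j)) (e j)\<close> is the degree operator: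
        it gives \<open>Suc k\<close> by the derivation rule, and \<open>r\<close> because each of
        its \<open>r\<close> summands acts as the scalar one.\<close>
      have "scaleV (of_nat r) (H us) = (\<Sum>j<r. T (\<phi> (a j)) (e j) (H us))"
        by (simp add: T\<phi> dual L.V.sum_constant_scale)
      also have "\<dots> = (\<Sum>l<Suc k. \<Sum>j<r. scaleV ((us ! l) (e j)) (H (us[l := \<phi> (a j)])))"
        unfolding TH[OF pair_mem_U us(1)] by (rule sum.swap)
      also have "\<dots> = (\<Sum>l<Suc k. H us)" by (intro sum.cong refl expand_slot) simp
      also have "\<dots> = scaleV (of_nat (Suc k)) (H us)" by (simp only: L.V.sum_constant_scale card_lessThan)
      finally have "r = Suc k" using us(2) by (simp only: L.V.scale_cancel_right of_nat_eq_iff) simp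
      then show False using k False by simp
    qed
  qed
  ultimately show ?thesis using not_simple_if_graded[of M, OF sub step] by blast
qed

lemma act_trivial:
  assumes H: "equivariant_alternating 0 H" and span: "L.V.span (H ` tuples 0 U) = UNIV"
  shows "\<rho> (x \<otimes>\<^sub>Z d) v = 0"
proof -
  have "v \<in> L.V.span (H ` tuples 0 U)" using span by simp
  then show ?thesis
  proof (induction rule: L.V.span_induct_alt)
    case (step c v w)
    then show ?case using equivariant_alternatingD(2)[OF H] by (auto simp: act_simps)
  qed (simp add: act_simps)
qed

lemma not_simple_trivial:
  assumes H: "equivariant_alternating 0 H" and span: "L.V.span (H ` tuples 0 U) = UNIV"
    and nz: "(v0 :: 'v) \<noteq> 0" and \<sigma>: "\<sigma> \<in> range \<phi>" and G: "(g0 :: 'g) \<noteq> 0"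
  shows "\<not> simple_\<Gamma>"
proof -
  obtain s where s: "\<sigma> = \<phi> s" using \<sigma> by blast
  have "\<rho> (x \<otimes>\<^sub>Z d) v = 0" for x d v by (rule act_trivial[OF H span])
  \<comment> \<open>Only degree \<open>- s\<close> is kept: all operators vanish on it because
    \<open>\<phi> (- s) d + \<sigma> d = 0\<close>. The nonzero \<open>g0\<close> supplies a degree
    that is left out.\<close>
  then show ?thesis
    using nz G s
    by (intro not_simple_if_graded[of "\<lambda>b. if b = - s then UNIV else {0}" v0 "- s" v0 "g0 - s"])
      (auto simp: pair_uminus L.V.subspace_UNIV split: if_splits)
qed

end

section \<open>Proper submodules force exterior powers\<close>

locale witt_proper_submodule = witt_gamma scaleD \<phi> r a e scaleV \<rho> \<sigma>
  for scaleD :: "complex \<Rightarrow> 'd::ab_group_add \<Rightarrow> 'd"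
    and \<phi> :: "'g::ab_group_add \<Rightarrow> 'd \<Rightarrow> complex"
    and r :: nat and a :: "nat \<Rightarrow> 'g" and e :: "nat \<Rightarrow> 'd"
    and scaleV :: "complex \<Rightarrow> 'v::ab_group_add \<Rightarrow> 'v"
    and \<rho> :: "('g, 'd) tensor \<Rightarrow> 'v \<Rightarrow> 'v"
    and \<sigma> :: "'d \<Rightarrow> complex" +
  fixes M :: "('g \<Rightarrow>\<^sub>0 'v) set"
  assumes Ker1: "Ker1 \<phi> = {0}"
    and simple: "simple_lie_module (L_scale scaleD) (L_bracket scaleD \<phi>) scaleV \<rho>"
    and finite_dim: "\<exists>Basis. finite_dimensional_vector_space scaleV Basis"
    and M: "lie_submodule (fscale scaleV) \<Gamma> M" and M_proper: "M \<noteq> {0}" "M \<noteq> UNIV"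
begin

section \<open>Homogeneous components of a proper submodule\<close>

lemma subspace_M: "G.V.subspace M" and \<Gamma>_mem: "p \<in> M \<Longrightarrow> \<Gamma> x p \<in> M"
  using M by (auto simp: lie_submodule_def)

definition C :: "'g \<Rightarrow> 'v set" where "C b = {v. Poly_Mapping.single b v \<in> M}"

lemma zero_tensor_left: "0 \<otimes>\<^sub>Z d = (0 :: ('g, 'd) tensor)"
  using pure_tensor_add_left[of 0 0 d] by simp

lemma uminus_tensor_left: "(- x) \<otimes>\<^sub>Z d = - (x \<otimes>\<^sub>Z d)" for x :: 'g and d :: 'd
  using pure_tensor_add_left[of x "- x" d] by (simp add: zero_tensor_left eq_neg_iff_add_eq_0 add.commute)

lemma diff_tensor_left: "(x - y) \<otimes>\<^sub>Z d = x \<otimes>\<^sub>Z d - y \<otimes>\<^sub>Z d" for x :: 'g and d :: 'd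
  using pure_tensor_add_left[of x "- y" d] by (simp add: uminus_tensor_left)

lemma separate: "b \<noteq> c \<Longrightarrow> \<exists>d. \<phi> b d \<noteq> \<phi> c d"
proof (rule ccontr)
  assume "b \<noteq> c" "\<nexists>d. \<phi> b d \<noteq> \<phi> c d"
  then have "b - c \<in> Ker1 \<phi>" by (simp add: Ker1_def pair_diff_left)
  then show False using Ker1 \<open>b \<noteq> c\<close> by simp
qed

lemma fscale_single_V: "fscale scaleV c (Poly_Mapping.single b v) = Poly_Mapping.single b (scaleV c v)"
  by (rule fscale_single) simp

text \<open>Degree \<open>b\<close> is the weight space of weight
  \<open>\<phi> b d + \<sigma> d\<close> under the operators of degree zero, and these weights are
  distinct because \<open>Ker1 \<phi>\<close> is zero.\<close>

lemma lookup_mem_C: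
  assumes p: "p \<in> M"
  shows "Poly_Mapping.lookup p b \<in> C b"
proof (cases "b \<in> Poly_Mapping.keys p")
  case True
  let ?v = "\<lambda>b. Poly_Mapping.single b (Poly_Mapping.lookup p b)"
  have "?v b \<in> M"
  proof (rule G.V.weight_components_mem[where D = "\<lambda>d. \<Gamma> (Poly_Mapping.single 0 d)" and I = UNIV
        and w = "\<lambda>d b. \<phi> b d + \<sigma> d" and J = "Poly_Mapping.keys p"])
    show "G.V.subspace M" by (rule subspace_M)
    show "\<Gamma> (Poly_Mapping.single 0 d) w \<in> M" if "w \<in> M" for d w using that by (rule \<Gamma>_mem)
    show "Vector_Spaces.linear (fscale scaleV) (fscale scaleV) (\<Gamma> (Poly_Mapping.single 0 d))" for d
      by (rule G.act_linear_right)
    show "\<exists>d\<in>UNIV. \<phi> j d + \<sigma> d \<noteq> \<phi> l d + \<sigma> d" if "j \<noteq> l" for j l using separate[OF that] by simp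
    show "\<Gamma> (Poly_Mapping.single 0 d) (?v j) = fscale scaleV (\<phi> j d + \<sigma> d) (?v j)" for d j
      by (simp add: \<Gamma>_single zero_tensor_left act_left_simps fscale_single_V)
    have "sum ?v (Poly_Mapping.keys p) = p"
      by (rule poly_mapping_eqI) (simp add: lookup_sum lookup_single when_def in_keys_iff)
    then show "sum ?v (Poly_Mapping.keys p) \<in> M" using p by simp
  qed (use True in simp_all)
  then show ?thesis by (simp add: C_def)
next
  case False
  then show ?thesis using G.V.subspace_0[OF subspace_M] by (simp add: C_def in_keys_iff)
qed

lemma subspace_C: "L.V.subspace (C b)"
  unfolding L.V.subspace_def C_def
  using G.V.subspace_0[OF subspace_M] G.V.subspace_add[OF subspace_M] G.V.subspace_scale[OF subspace_M]
  by (auto simp: single_add simp flip: fscale_single_V)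

lemma C_step: "v \<in> C b \<Longrightarrow> scaleV (\<phi> b d + \<sigma> d) v + \<rho> (x \<otimes>\<^sub>Z d) v \<in> C (x + b)"
  using \<Gamma>_mem[of "Poly_Mapping.single b v" "Poly_Mapping.single x d"] by (simp add: C_def \<Gamma>_single)

lemma C_nonzero: obtains b v where "v \<in> C b" "v \<noteq> 0"
proof -
  obtain p where p: "p \<in> M" "p \<noteq> 0" using M_proper(1) G.V.subspace_0[OF subspace_M] by blast
  then obtain b where "Poly_Mapping.lookup p b \<noteq> 0" by (metis lookup_zero poly_mapping_eqI)
  then show ?thesis using that lookup_mem_C[OF p(1)] by blast
qed

lemma submodule_trivial:
  assumes N: "L.V.subspace N" and step: "\<And>x d v. v \<in> N \<Longrightarrow> \<rho> (x \<otimes>\<^sub>Z d) v \<in> N"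
    and v: "v \<in> N" "v \<noteq> 0"
  shows "w \<in> N"
proof -
  have "\<rho> x v \<in> N" if "v \<in> N" for x v
  proof (induction x rule: tensor_induct)
    case zero
    then show ?case by (simp add: act_left_simps L.V.subspace_0[OF N])
  next
    case (pure x d)
    then show ?case by (rule step[OF that])
  next
    case (diff x y)
    then show ?case by (simp add: act_left_simps L.V.subspace_diff[OF N])
  qed
  then have "lie_submodule scaleV \<rho> N" using N by (simp add: lie_submodule_def)
  then have "N = {0} \<or> N = UNIV" using simple unfolding simple_lie_module_def by blast
  then show ?thesis using v by blast
qed

text \<open>For a vector in every \<open>C c\<close>, the step into \<open>C c\<close> and its
  scalar part both lie in \<open>C c\<close>, hence so does its image under
  \<open>x \<otimes>\<^sub>Z d\<close>. The intersection is therefore an \<open>L\<close>-submodule,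
  and if it were nonzero, \<open>M\<close> would be everything.\<close>

lemma C_inter:
  assumes v: "\<And>c. v \<in> C c"
  shows "v = 0"
proof (rule ccontr)
  assume nz: "v \<noteq> 0"
  let ?N = "\<Inter>c. C c"
  have N: "L.V.subspace ?N" by (rule L.V.subspace_Inter) (use subspace_C in blast)
  have "\<rho> (x \<otimes>\<^sub>Z d) w \<in> C c" if w: "w \<in> ?N" for x d w c
  proof -
    have "scaleV (\<phi> (c - x) d + \<sigma> d) w + \<rho> (x \<otimes>\<^sub>Z d) w \<in> C c"
      using C_step[of w "c - x" d x] w by auto
    moreover have "scaleV (\<phi> (c - x) d + \<sigma> d) w \<in> C c"
      using w by (intro L.V.subspace_scale[OF subspace_C]) auto
    ultimately show ?thesis using L.V.subspace_diff[OF subspace_C] by fastforce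
  qed
  then have all: "w \<in> C c" for w c using submodule_trivial[OF N _ _ nz, of w] v by blast
  have "p \<in> M" for p
    by (induction p rule: pm_induct)
      (use all in \<open>auto simp: C_def intro: G.V.subspace_0[OF subspace_M] G.V.subspace_diff[OF subspace_M]\<close>)
  then show False using M_proper(2) by blast
qed

lemma not_C_constant: "\<not> (\<forall>b c. C b \<subseteq> C c)"
  by (metis C_inter C_nonzero subsetD)

text \<open>The polarised form, in \<open>x\<close> and \<open>y\<close>, of
  \<open>\<rho> (x \<otimes>\<^sub>Z d) - \<phi> x d\<close> composed with
  \<open>\<rho> (x \<otimes>\<^sub>Z d')\<close>.\<close>

definition Q :: "'g \<Rightarrow> 'g \<Rightarrow> 'd \<Rightarrow> 'd \<Rightarrow> 'v \<Rightarrow> 'v" where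
  "Q x y d d' v = \<rho> (x \<otimes>\<^sub>Z d) (\<rho> (y \<otimes>\<^sub>Z d') v) - scaleV (\<phi> x d) (\<rho> (y \<otimes>\<^sub>Z d') v)
     + \<rho> (y \<otimes>\<^sub>Z d) (\<rho> (x \<otimes>\<^sub>Z d') v) - scaleV (\<phi> y d) (\<rho> (x \<otimes>\<^sub>Z d') v)"

text \<open>Moving from degree \<open>b\<close> to degree \<open>c\<close> in two steps through \<open>c - x\<close> is quadratic in \<open>x\<close>;
  the second difference isolates the leading part, which does not depend on \<open>b\<close> and \<open>c\<close>.\<close>

lemma quadratic_mem_C:
  assumes v: "v \<in> C b"
  shows "\<rho> (x \<otimes>\<^sub>Z d) (\<rho> (x \<otimes>\<^sub>Z d') v) - scaleV (\<phi> x d) (\<rho> (x \<otimes>\<^sub>Z d') v) \<in> C c" (is "?q \<in> _")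
proof -
  define m where "m = c - b"
  \<comment> \<open>\<open>P x\<close> goes from degree \<open>b\<close> to degree \<open>c\<close>
    through \<open>c - x\<close>. Its part quadratic in \<open>x\<close> is \<open>- ?q\<close>,
    which the values at \<open>0\<close>, \<open>x\<close> and \<open>- x\<close> isolate.\<close>
  define P where "P x = scaleV (\<phi> (m - x + b) d + \<sigma> d) (scaleV (\<phi> b d' + \<sigma> d') v + \<rho> ((m - x) \<otimes>\<^sub>Z d') v)
      + \<rho> (x \<otimes>\<^sub>Z d) (scaleV (\<phi> b d' + \<sigma> d') v + \<rho> ((m - x) \<otimes>\<^sub>Z d') v)" for x
  have P: "P x \<in> C c" for x
    using C_step[OF C_step[OF v, of d' "m - x"], of d x] by (simp add: P_def m_def add.assoc)
  have "P 0 - P x + (P 0 - P (- x)) = ?q + ?q"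
    by (simp add: P_def diff_tensor_left uminus_tensor_left zero_tensor_left act_simps act_left_simps
        additive_left pair_diff_left pair_uminus L.V.scale_left_distrib L.V.scale_left_diff_distrib
        L.V.scale_right_distrib L.V.scale_right_diff_distrib pure_tensor_add_left algebra_simps)
  moreover have "P 0 - P x + (P 0 - P (- x)) \<in> C c"
    using P by (intro L.V.subspace_add[OF subspace_C] L.V.subspace_diff[OF subspace_C])
  ultimately have "scaleV (1 / 2) (?q + ?q) \<in> C c"
    using L.V.subspace_scale[OF subspace_C] by metis
  then show ?thesis by (simp only: L.V.scale_right_distrib flip: L.V.scale_left_distrib) simp
qed

lemma Q_eq_0_on_C:
  assumes v: "v \<in> C b"
  shows "Q x y d d' v = 0"
proof (rule C_inter)
  fix c
  let ?q = "\<lambda>x. \<rho> (x \<otimes>\<^sub>Z d) (\<rho> (x \<otimes>\<^sub>Z d') v) - scaleV (\<phi> x d) (\<rho> (x \<otimes>\<^sub>Z d') v)"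
  have eq: "Q x y d d' v = ?q (x + y) - ?q x - ?q y"
    by (simp add: Q_def act_simps act_left_simps additive_left L.V.scale_left_distrib
        L.V.scale_right_distrib pure_tensor_add_left algebra_simps)
  show "Q x y d d' v \<in> C c"
    unfolding eq by (intro L.V.subspace_diff[OF subspace_C, OF L.V.subspace_diff[OF subspace_C]] quadratic_mem_C[OF v])
qed

text \<open>All correction terms are again values of \<open>Q\<close>, so the common kernel of the
  \<open>Q x y d d'\<close> is an \<open>L\<close>-submodule; it is nonzero because it contains
  every \<open>C b\<close>.\<close>

lemma Q_comm: "Q x y d d' (\<rho> (z \<otimes>\<^sub>Z f) v) = \<rho> (z \<otimes>\<^sub>Z f) (Q x y d d' v)
    - scaleV (\<phi> x f) (Q z y d d' v) - scaleV (\<phi> y f) (Q z x d d' v)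
    + scaleV (\<phi> z d') (Q x y d f v) + scaleV (\<phi> z d) (Q x y f d' v)"
proof -
  note R = act_pure_comm[where y = z and d' = f]
  show ?thesis
    unfolding Q_def
    by (simp add: R[where x = x and d = d] R[where x = x and d = d'] R[where x = y and d = d]
        R[where x = y and d = d'] act_simps L.V.scale_right_distrib L.V.scale_right_diff_distrib
        L.V.scale_left_distrib algebra_simps)
qed

lemma Q_eq_0: "Q x y d d' v = 0"
proof -
  let ?K = "{v. \<forall>x y d d'. Q x y d d' v = 0}"
  have Qlin: "Q x y d d' (v + w) = Q x y d d' v + Q x y d d' w" "Q x y d d' (scaleV c v) = scaleV c (Q x y d d' v)"
    "Q x y d d' 0 = 0" for x y d d' v w c
    by (simp_all add: Q_def act_simps L.V.scale_right_distrib L.V.scale_right_diff_distrib L.V.scale_left_commute algebra_simps)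
  have K: "L.V.subspace ?K" by (simp add: L.V.subspace_def Qlin)
  obtain b w where w: "w \<in> C b" "w \<noteq> 0" by (rule C_nonzero)
  have "v \<in> ?K"
  proof (rule submodule_trivial[OF K])
    show "\<rho> (z \<otimes>\<^sub>Z f) u \<in> ?K" if "u \<in> ?K" for z f u
      using that by (simp add: Q_comm act_simps)
    show "w \<in> ?K" using Q_eq_0_on_C[OF w(1)] by simp
    show "w \<noteq> 0" by fact
  qed
  then show ?thesis by blast
qed

text \<open>In the model where \<open>x \<otimes>\<^sub>Z d\<close> is contraction by
  \<open>d\<close> followed by exterior multiplication by \<open>x\<close>, this expresses that the
  multiplications by \<open>x\<close> and \<open>y\<close> anticommute.\<close>

lemma anticomm: "\<rho> (x \<otimes>\<^sub>Z d) (\<rho> (y \<otimes>\<^sub>Z d') v) + \<rho> (y \<otimes>\<^sub>Z d) (\<rho> (x \<otimes>\<^sub>Z d') v) =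
    scaleV (\<phi> x d) (\<rho> (y \<otimes>\<^sub>Z d') v) + scaleV (\<phi> y d) (\<rho> (x \<otimes>\<^sub>Z d') v)"
  using Q_eq_0[of x y d d' v] by (simp add: Q_def algebra_simps)

text \<open>Finite dimension provides a nonzero common kernel of the operators; \<open>step\<close>
  makes it an \<open>L\<close>-submodule, hence all of \<open>V\<close>.\<close>

lemma square_zero_ideal_acts_trivially:
  assumes lin: "\<And>t. t \<in> S \<Longrightarrow> Vector_Spaces.linear scaleV scaleV t"
    and comm: "\<And>s t v. s \<in> S \<Longrightarrow> t \<in> S \<Longrightarrow> s (t v) = t (s v)" and sq: "\<And>t v. t \<in> S \<Longrightarrow> t (t v) = 0"
    and step: "\<And>t x d v. t \<in> S \<Longrightarrow> \<forall>s\<in>S. s v = 0 \<Longrightarrow> t (\<rho> (x \<otimes>\<^sub>Z d) v) = 0"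
    and t: "t \<in> S"
  shows "t v = 0"
proof -
  obtain Basis where "finite_dimensional_vector_space scaleV Basis" using finite_dim by blast
  then interpret FD: finite_dimensional_vector_space scaleV Basis .
  obtain v0 :: 'v where nz: "v0 \<noteq> 0" using simple by (auto simp: simple_lie_module_def)
  have "\<exists>w. w \<noteq> 0 \<and> (\<forall>t\<in>S. t w = 0)"
  proof (rule FD.commuting_square_zero_common_kernel[OF _ _ _ nz])
    show "Vector_Spaces.linear scaleV scaleV t" if "t \<in> S" for t by (rule lin[OF that])
    show "s (t v) = t (s v)" if "s \<in> S" "t \<in> S" for s t v by (rule comm[OF that])
    show "t (t v) = 0" if "t \<in> S" for t v by (rule sq[OF that])
  qed
  then obtain w where w: "w \<noteq> 0" "\<forall>t\<in>S. t w = 0" by blast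
  let ?K = "{v. \<forall>t\<in>S. t v = 0}"
  have K: "L.V.subspace ?K"
    unfolding L.V.subspace_def
  proof (intro conjI ballI allI CollectI)
    fix t assume t: "t \<in> S"
    interpret t: Vector_Spaces.linear scaleV scaleV t by (rule lin[OF t])
    show "t 0 = 0" by (rule t.zero)
    have z: "t u = 0" if "u \<in> ?K" for u using that t by blast
    show "t (u + v) = 0" if "u \<in> ?K" "v \<in> ?K" for u v by (simp add: t.add z[OF that(1)] z[OF that(2)])
    show "t (scaleV c u) = 0" if "u \<in> ?K" for c u by (simp add: t.scale z[OF that])
  qed
  have "v \<in> ?K"
  proof (rule submodule_trivial[OF K])
    show "\<rho> (x \<otimes>\<^sub>Z d) u \<in> ?K" if "u \<in> ?K" for x d u using that step by blast
    show "w \<in> ?K" "w \<noteq> 0" using w by simp_all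
  qed
  then show ?thesis using t by blast
qed

text \<open>For vectors of \<open>Ker2 \<phi>\<close> the scalar terms in the two relations vanish,
  so these operators commute and square to zero; a bracket with any element of \<open>L\<close>
  stays among their multiples.\<close>

lemma act_Ker2:
  assumes "d \<in> Ker2 \<phi>"
  shows "\<rho> (x \<otimes>\<^sub>Z d) v = 0"
proof -
  have [simp]: "\<phi> x d = 0" if "d \<in> Ker2 \<phi>" for x d using that by (simp add: Ker2_def)
  let ?S = "{\<rho> (x \<otimes>\<^sub>Z d) | x d. d \<in> Ker2 \<phi>}"
  show ?thesis
  proof (rule square_zero_ideal_acts_trivially[where S = ?S and t = "\<rho> (x \<otimes>\<^sub>Z d)"])
    show "s (t v) = t (s v)" if st: "s \<in> ?S" "t \<in> ?S" for s t v
    proof -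
      obtain x d y f where "s = \<rho> (x \<otimes>\<^sub>Z d)" "d \<in> Ker2 \<phi>" "t = \<rho> (y \<otimes>\<^sub>Z f)" "f \<in> Ker2 \<phi>"
        using st by blast
      then show ?thesis using act_pure_comm[of x d y f v] by simp
    qed
    show "t (t v) = 0" if tS: "t \<in> ?S" for t v
    proof -
      obtain x d where t: "t = \<rho> (x \<otimes>\<^sub>Z d)" "d \<in> Ker2 \<phi>" using tS by blast
      have "t (t v) + t (t v) = 0" using anticomm[of x d x d v] t by simp
      then have "scaleV 2 (t (t v)) = 0" by (metis L.V.scale_left_distrib L.V.scale_one one_add_one)
      then show ?thesis by simp
    qed
    show "t (\<rho> (x \<otimes>\<^sub>Z d) v) = 0" if tS: "t \<in> ?S" "\<forall>s\<in>?S. s v = 0" for t x d v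
    proof -
      obtain y f where t: "t = \<rho> (y \<otimes>\<^sub>Z f)" "f \<in> Ker2 \<phi>" using tS(1) by blast
      then have "\<rho> (z \<otimes>\<^sub>Z f) v = 0" for z using tS(2) by blast
      then show ?thesis using t act_pure_comm[of y f x d v] by (simp add: act_simps)
    qed
    show "Vector_Spaces.linear scaleV scaleV t" if "t \<in> ?S" for t using that linear_act by blast
    show "\<rho> (x \<otimes>\<^sub>Z d) \<in> ?S" using assms by blast
  qed
qed

section \<open>Relations for arbitrary functionals\<close>

lemma linear_T: "Vector_Spaces.linear scaleV scaleV (T u d)"
  by (simp add: Vector_Spaces.linear_iff T_simps L.V.vector_space_axioms)

text \<open>The commutation relation extends linearly from the \<open>a i\<close>, and the dual
  expansion gathers the coefficients \<open>u (e i) * \<phi> (a i) f\<close> into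
  \<open>u f\<close>.\<close>

lemma T_act_comm:
  assumes "u \<in> U"
  shows "T u d (\<rho> (z \<otimes>\<^sub>Z f) v) =
    \<rho> (z \<otimes>\<^sub>Z f) (T u d v) + scaleV (\<phi> z d) (T u f v) - scaleV (u f) (\<rho> (z \<otimes>\<^sub>Z d) v)"
proof -
  have "T u d (\<rho> (z \<otimes>\<^sub>Z f) v) = \<rho> (z \<otimes>\<^sub>Z f) (T u d v)
     + scaleV (\<phi> z d) (T u f v) - scaleV (\<Sum>i<r. u (e i) * \<phi> (a i) f) (\<rho> (z \<otimes>\<^sub>Z d) v)"
    unfolding T_def act_pure_comm[where y = z and d' = f]
    by (simp add: act_simps L.V.scale_right_distrib L.V.scale_right_diff_distrib sum.distrib sum_subtractf
        L.V.scale_sum_right L.V.scale_sum_left mult.commute)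
  then show ?thesis by (simp flip: U_expand_apply[OF assms])
qed

lemma T_anticomm:
  assumes "u \<in> U"
  shows "T u d (\<rho> (y \<otimes>\<^sub>Z d') v) + \<rho> (y \<otimes>\<^sub>Z d) (T u d' v) =
    scaleV (u d) (\<rho> (y \<otimes>\<^sub>Z d') v) + scaleV (\<phi> y d) (T u d' v)"
proof -
  have "T u d (\<rho> (y \<otimes>\<^sub>Z d') v) + \<rho> (y \<otimes>\<^sub>Z d) (T u d' v) =
    (\<Sum>i<r. scaleV (u (e i)) (\<rho> (a i \<otimes>\<^sub>Z d) (\<rho> (y \<otimes>\<^sub>Z d') v) + \<rho> (y \<otimes>\<^sub>Z d) (\<rho> (a i \<otimes>\<^sub>Z d') v)))"
    by (simp add: T_def act_simps L.V.scale_right_distrib sum.distrib)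
  also have "\<dots> = scaleV (\<Sum>i<r. u (e i) * \<phi> (a i) d) (\<rho> (y \<otimes>\<^sub>Z d') v) + scaleV (\<phi> y d) (T u d' v)"
    unfolding anticomm
    by (simp add: T_def L.V.scale_right_distrib sum.distrib L.V.scale_sum_left L.V.scale_sum_right mult.commute)
  finally show ?thesis by (simp flip: U_expand_apply[OF assms])
qed

text \<open>Taking the anticommutation relation with \<open>u\<close> in both places gives twice the
  claim.\<close>

lemma T_square:
  assumes "u \<in> U"
  shows "T u d (T u d' v) = scaleV (u d) (T u d' v)"
proof -
  have "T u d (T u d' v) + T u d (T u d' v) =
    (\<Sum>i<r. scaleV (u (e i)) (T u d (\<rho> (a i \<otimes>\<^sub>Z d') v) + \<rho> (a i \<otimes>\<^sub>Z d) (T u d' v)))"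
  proof -
    interpret Tl: Vector_Spaces.linear scaleV scaleV "T u d" by (rule linear_T)
    have "T u d (T u d' v) = (\<Sum>i<r. scaleV (u (e i)) (T u d (\<rho> (a i \<otimes>\<^sub>Z d') v)))"
      unfolding T_def[of u d' v] by (simp add: Tl.sum Tl.scale)
    moreover have "T u d (T u d' v) = (\<Sum>i<r. scaleV (u (e i)) (\<rho> (a i \<otimes>\<^sub>Z d) (T u d' v)))"
      by (rule T_def)
    ultimately show ?thesis by (simp add: L.V.scale_right_distrib sum.distrib)
  qed
  also have "\<dots> = scaleV (u d) (T u d' v) + scaleV (\<Sum>i<r. u (e i) * \<phi> (a i) d) (T u d' v)"
  proof -
    have "(\<Sum>i<r. scaleV (u (e i)) (scaleV (u d) (\<rho> (a i \<otimes>\<^sub>Z d') v))) = scaleV (u d) (T u d' v)"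
      by (simp add: T_def L.V.scale_sum_right mult.commute)
    then show ?thesis
      unfolding T_anticomm[OF assms] L.V.scale_right_distrib sum.distrib
      by (simp add: L.V.scale_sum_left)
  qed
  also have "\<dots> = scaleV (u d) (T u d' v) + scaleV (u d) (T u d' v)"
    by (simp flip: U_expand_apply[OF assms])
  finally have "scaleV 2 (T u d (T u d' v)) = scaleV 2 (scaleV (u d) (T u d' v))"
    by (metis L.V.scale_left_distrib L.V.scale_one one_add_one)
  then show ?thesis by (simp only: L.V.scale_cancel_left) simp
qed

text \<open>The operators \<open>Z g d\<close> measure the failure of the action to be complex linear in \<open>g\<close>.\<close>

definition Z :: "'g \<Rightarrow> 'd \<Rightarrow> 'v \<Rightarrow> 'v" where
  "Z g d v = \<rho> (g \<otimes>\<^sub>Z d) v - T (\<phi> g) d v"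

lemma linear_Z: "Vector_Spaces.linear scaleV scaleV (Z g d)"
  by (simp add: Z_def Vector_Spaces.linear_iff T_simps act_simps L.V.vector_space_axioms L.V.scale_right_diff_distrib)

text \<open>The terms with \<open>\<rho> (z \<otimes>\<^sub>Z d)\<close> cancel between the action
  and \<open>T\<close>, so commutators with \<open>L\<close> yield only multiples of operators
  \<open>Z g f\<close>, as the square-zero argument requires.\<close>

lemma Z_act_comm:
  "Z g d (\<rho> (z \<otimes>\<^sub>Z f) v) = \<rho> (z \<otimes>\<^sub>Z f) (Z g d v) + scaleV (\<phi> z d) (Z g f v)"
  unfolding Z_def T_act_comm[OF pair_mem_U] act_pure_comm[of g d z f v]
  by (simp add: act_simps L.V.scale_right_diff_distrib algebra_simps)

lemma Z_T_comm:
  assumes "u \<in> U"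
  shows "Z g d (T u f v) = T u f (Z g d v) + scaleV (u d) (Z g f v)"
proof -
  interpret Zl: Vector_Spaces.linear scaleV scaleV "Z g d" by (rule linear_Z)
  have "Z g d (T u f v) = T u f (Z g d v) + scaleV (\<Sum>i<r. u (e i) * \<phi> (a i) d) (Z g f v)"
    by (simp add: T_def Zl.sum Zl.scale Z_act_comm L.V.scale_right_distrib sum.distrib L.V.scale_sum_left)
  then show ?thesis by (simp flip: U_expand_apply[OF assms])
qed

lemma act_eq_T: "\<rho> (g \<otimes>\<^sub>Z d) v = T (\<phi> g) d v"
proof -
  \<comment> \<open>The anticommutation relations for \<open>g\<close> and for
    \<open>\<phi> g\<close> are subtracted. Moving \<open>Z g d\<close> past the action, with the
    same \<open>d\<close> in both factors, then leaves twice this product.\<close>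
  have act_Z: "\<rho> (y \<otimes>\<^sub>Z d) (Z g d v) = 0" for y g d v
  proof -
    have "Z g d (\<rho> (y \<otimes>\<^sub>Z d) v) + \<rho> (y \<otimes>\<^sub>Z d) (Z g d v) = scaleV (\<phi> y d) (Z g d v)"
      using anticomm[of g d y d v] T_anticomm[OF pair_mem_U, of g d y d v]
      by (simp add: Z_def act_simps L.V.scale_right_diff_distrib algebra_simps)
    then have "\<rho> (y \<otimes>\<^sub>Z d) (Z g d v) + \<rho> (y \<otimes>\<^sub>Z d) (Z g d v) = 0"
      by (simp add: Z_act_comm algebra_simps)
    then have "scaleV 2 (\<rho> (y \<otimes>\<^sub>Z d) (Z g d v)) = 0"
      by (metis L.V.scale_left_distrib L.V.scale_one one_add_one)
    then show ?thesis by simp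
  qed
  let ?S = "{Z g d | g d. True}"
  have "Z g d v = 0"
  proof (rule square_zero_ideal_acts_trivially[where S = ?S and t = "Z g d"])
    show "Vector_Spaces.linear scaleV scaleV t" if "t \<in> ?S" for t using that linear_Z by blast
    show "s (t v) = t (s v)" if st: "s \<in> ?S" "t \<in> ?S" for s t v
    proof -
      obtain g d h f where eq: "s = Z g d" "t = Z h f" using st by blast
      interpret Zl: Vector_Spaces.linear scaleV scaleV "Z g d" by (rule linear_Z)
      have "Z g d (Z h f v) = Z h f (Z g d v)"
        unfolding Z_def[of h f] Zl.diff Z_act_comm Z_T_comm[OF pair_mem_U] by simp
      then show ?thesis by (simp add: eq)
    qed
    show "t (t v) = 0" if tS: "t \<in> ?S" for t v
    proof -
      obtain g d where "t = Z g d" using tS by blast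
      \<comment> \<open>\<open>Z g d\<close> is a combination of actions with this same
        \<open>d\<close>, and each of them kills its values.\<close>
      then show ?thesis using act_Z by (simp add: Z_def[of g d "Z g d v"] T_def[of _ d "Z g d v"])
    qed
    show "t (\<rho> (x \<otimes>\<^sub>Z d) v) = 0" if tS: "t \<in> ?S" "\<forall>s\<in>?S. s v = 0" for t x d v
    proof -
      obtain g f where t: "t = Z g f" using tS(1) by blast
      have "Z h k v = 0" for h k using tS(2) by blast
      then show ?thesis by (simp add: t Z_act_comm act_simps)
    qed
    show "Z g d \<in> ?S" by blast
  qed
  then show ?thesis by (simp add: Z_def)
qed

text \<open>For such \<open>d\<close> every step from degree \<open>b\<close> to degree
  \<open>c\<close> is multiplication by \<open>\<sigma> d\<close>; a nonzero scalar would make all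
  components equal.\<close>

lemma \<sigma>_Ker2:
  assumes d: "d \<in> Ker2 \<phi>"
  shows "\<sigma> d = 0"
proof (rule ccontr)
  assume nz: "\<sigma> d \<noteq> 0"
  have "C b \<subseteq> C c" for b c
  proof
    fix v assume v: "v \<in> C b"
    have "scaleV (\<sigma> d) v \<in> C c"
      using C_step[OF v, of d "c - b"] d act_Ker2[OF d] by (simp add: Ker2_def)
    from L.V.subspace_scale[OF subspace_C this, of "inverse (\<sigma> d)"] nz show "v \<in> C c" by simp
  qed
  then show False using not_C_constant by blast
qed

text \<open>Normally ordered products: in terms of exterior multiplication and contraction,
  \<open>F v [d\<^sub>1, \<dots>, d\<^sub>k] [x\<^sub>1, \<dots>, x\<^sub>k]\<close> is \<open>x\<^sub>1 \<and> \<dots> \<and> x\<^sub>k \<and> \<iota>(d\<^sub>k) \<dots> \<iota>(d\<^sub>1) v\<close> up to sign.\<close>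

primrec F :: "'v \<Rightarrow> 'd list \<Rightarrow> ('d \<Rightarrow> complex) list \<Rightarrow> 'v" where
  "F v [] = (\<lambda>xs. v)"
| "F v (d # ds) = (\<lambda>xs. T (hd xs) d (F v ds (tl xs)) -
    (\<Sum>l<length ds. F v ds ((tl xs)[l := fun_scale ((tl xs ! l) d) (hd xs)])))"

text \<open>In the tail, \<open>T y d\<close> is linear and the correction is a derivation, so
  alternation is inherited. A head repeated in the tail is handled by \<open>T_square\<close>, that
  is, by the anticommutation relation.\<close>

lemma alternating_F: "alternating_mod scaleV fun_scale U (length ds) {0} (F v ds)"
\<comment> \<open>Induction on the length, because besides the tails of the list also
  \<open>d # ds''\<close>, with the second vector omitted, is needed.\<close>
proof (induction ds rule: length_induct)
  case (1 ds)
  interpret FS: vector_space "fun_scale :: _ \<Rightarrow> ('d \<Rightarrow> complex) \<Rightarrow> _" by (rule vector_space_fun_scale)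
  show ?case
  proof (cases ds)
    case Nil
    show ?thesis unfolding Nil
      by unfold_locales (auto simp: tuples_def subspace_U)
  next
    case (Cons d ds')
    define n where "n = length ds'"
    define f where "f = F v ds'"
    define B where "B y xs = T y d (f xs) - (\<Sum>l<n. f (xs[l := fun_scale ((xs ! l) d) y]))" for y xs
    have F_Cons: "F v ds (y # xs) = B y xs" for y xs by (simp add: Cons B_def f_def n_def)
    have f: "alternating_mod scaleV fun_scale U n {0} f"
      using 1 Cons by (simp add: f_def n_def)
    interpret f: alternating_mod scaleV fun_scale U n "{0}" f by (rule f)
    have B: "alternating_mod scaleV fun_scale U n {0} (B y)" if y: "y \<in> U" for y
      unfolding B_def
    proof (rule alternating_mod_diff)
      have "T y d ` {0} = {0}" by (simp add: T_simps)
      then show "alternating_mod scaleV fun_scale U n {0} (\<lambda>us. T y d (f us))"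
        using f.comp_linear[OF linear_T, of y d] by simp
      show "alternating_mod scaleV fun_scale U n {0} (\<lambda>us. \<Sum>l<n. f (us[l := fun_scale ((us ! l) d) y]))"
      proof (rule f.derivation[where X = "\<lambda>u. fun_scale (u d) y"])
        show "fun_scale (u d) y \<in> U" for u by (rule FS.subspace_scale[OF subspace_U y])
        show "fun_scale ((u + u') d) y = fun_scale (u d) y + fun_scale (u' d) y" for u u'
          by (simp add: fun_eq_iff algebra_simps)
        show "fun_scale (fun_scale c u d) y = fun_scale c (fun_scale (u d) y)" for c u
          by (simp add: fun_eq_iff)
      qed
    qed
    note fe = alternating_eqs[OF f]
    have Badd: "B (x + y) xs = B x xs + B y xs" if "x \<in> U" "y \<in> U" "xs \<in> tuples n U" for x y xs
    proof -
      have "f (xs[l := fun_scale c (x + y)]) = f (xs[l := fun_scale c x]) + f (xs[l := fun_scale c y])"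
        if "l < n" for l c
      proof -
        have "fun_scale c (x + y) = fun_scale c x + fun_scale c y" by (simp add: fun_eq_iff algebra_simps)
        then show ?thesis
          using fe(1)[OF \<open>xs \<in> tuples n U\<close> that FS.subspace_scale[OF subspace_U \<open>x \<in> U\<close>, of c]
              FS.subspace_scale[OF subspace_U \<open>y \<in> U\<close>, of c]] by simp
      qed
      then show ?thesis by (simp add: B_def T_simps sum.distrib)
    qed
    have Bscale: "B (fun_scale c x) xs = scaleV c (B x xs)" if "x \<in> U" "xs \<in> tuples n U" for c x xs
    proof -
      have "f (xs[l := fun_scale c' (fun_scale c x)]) = scaleV c (f (xs[l := fun_scale c' x]))"
        if "l < n" for l c'
      proof -
        have eq: "fun_scale c' (fun_scale c x) = fun_scale c (fun_scale c' x)" by (simp add: fun_eq_iff)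
        show ?thesis
          unfolding eq by (rule fe(2)[OF \<open>xs \<in> tuples n U\<close> that FS.subspace_scale[OF subspace_U \<open>x \<in> U\<close>]])
      qed
      then show ?thesis by (simp add: B_def T_simps L.V.scale_right_diff_distrib L.V.scale_sum_right)
    qed
    have head: "B y (y # zs) = 0" if yzs: "y # zs \<in> tuples n U" for y zs
    proof -
      have y: "y \<in> U" and len: "length zs = n - 1" "0 < n" using yzs by (auto simp: tuples_def)
      obtain d' ds'' where ds': "ds' = d' # ds''" using len by (cases ds') (simp_all add: n_def)
      define m where "m = length ds''"
      have n: "n = Suc m" by (simp add: n_def m_def ds')
      have zs: "zs \<in> tuples m U" using yzs by (simp add: n tuples_Cons)
      define g where "g = F v ds''"
      have g: "alternating_mod scaleV fun_scale U m {0} g"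
        using 1 Cons ds' by (simp add: g_def m_def)
      note ge = alternating_eqs[OF g]
      have FD: "alternating_mod scaleV fun_scale U n {0} (F v (d # ds''))"
        using 1[THEN spec, of "d # ds''"] Cons ds' by (simp add: n m_def del: F.simps)
      \<comment> \<open>By the induction hypothesis \<open>F v (d # ds'')\<close> vanishes at
        \<open>y # ws\<close>, where \<open>y\<close> is repeated. So \<open>T y d (g ws)\<close>
        equals the correction sum, to which only the slot holding \<open>y\<close>
        contributes.\<close>
      have g0: "T y d (g ws) = scaleV (y d) (g ws)" if ws: "ws \<in> tuples m U" and yws: "y \<in> set ws" for ws
      proof -
        obtain l where l: "l < m" "ws ! l = y" using ws yws by (auto simp: in_set_conv_nth tuples_def)
        have lw: "length ws = m" using ws by (simp add: tuples_def)
        have "g (ws[k := fun_scale ((ws ! k) d) y]) = (if k = l then scaleV (y d) (g ws) else 0)" if k: "k < m" for k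
        proof (cases "k = l")
          case True
          then show ?thesis using ge(2)[OF ws k y, of "(ws ! k) d"] l by (metis list_update_id)
        next
          case False
          have "g (ws[k := y]) = 0"
            using False k l lw by (intro ge(3) tuples_update ws y not_distinct_if_nth_eq[of k _ l]) auto
          then show ?thesis using ge(2)[OF ws k y, of "(ws ! k) d"] False by simp
        qed
        then have "(\<Sum>k<m. g (ws[k := fun_scale ((ws ! k) d) y])) = scaleV (y d) (g ws)"
          using l(1) by simp
        moreover have "F v (d # ds'') (y # ws) = 0"
          using ws yws y by (intro alternating_eqs(3)[OF FD]) (auto simp: n tuples_Cons)
        ultimately show ?thesis by (simp add: g_def m_def)
      qed
      have fy: "f (y # xs) = T y d' (g xs) - (\<Sum>l<m. g (xs[l := fun_scale ((xs ! l) d') y]))" for xs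
        by (simp add: f_def ds' g_def m_def)
      have g1: "T y d (g (zs[l := fun_scale c y])) = scaleV (y d) (g (zs[l := fun_scale c y]))" if l: "l < m" for l c
      proof -
        have "y \<in> set (zs[l := y])" using l zs by (intro set_update_memI) (simp add: tuples_def)
        then show ?thesis
          using g0[OF tuples_update[OF zs y]] ge(2)[OF zs l y, of c] by (simp add: T_simps L.V.scale_left_commute)
      qed
      \<comment> \<open>In \<open>f (y # zs)\<close> the leading term is a value of
        \<open>T y d'\<close>, to which \<open>T_square\<close> applies; in every other term a
        multiple of \<open>y\<close> is an entry of \<open>g\<close>.\<close>
      have "T y d (f (y # zs)) = scaleV (y d) (f (y # zs))"
      proof -
        interpret Tl: Vector_Spaces.linear scaleV scaleV "T y d" by (rule linear_T)
        show ?thesis unfolding fy Tl.diff Tl.sum T_square[OF y]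
          by (simp add: g1 L.V.scale_right_diff_distrib L.V.scale_sum_right)
      qed
      moreover have "f (fun_scale c y # zs) = scaleV c (f (y # zs))" for c
        using fe(2)[OF yzs len(2) y, of c] by simp
      moreover have "f (y # zs[l := fun_scale c y]) = 0" if l: "l < m" for l c
      proof -
        have "y \<in> set (zs[l := y])" using l zs by (intro set_update_memI) (simp add: tuples_def)
        then have "f (y # zs[l := y]) = 0"
          using tuples_update[OF zs y, of l] y by (intro fe(3)) (auto simp: n tuples_Cons)
        then show ?thesis using fe(2)[OF yzs, of "Suc l" y c] l y n by simp
      qed
      \<comment> \<open>The summand of slot zero cancels the leading term, and all other summands
        have \<open>y\<close> repeated.\<close>
      ultimately show ?thesis by (simp add: B_def n sum.lessThan_Suc_shift del: sum.lessThan_Suc)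
    qed
    \<comment> \<open>A repetition further along is first moved to the front of \<open>xs\<close> by
      a swap.\<close>
    have repeat: "B y xs = 0" if y: "y \<in> set xs" and xs: "xs \<in> tuples n U" for y xs
    proof -
      have yU: "y \<in> U" and lx: "length xs = n" using y xs by (auto simp: tuples_def)
      interpret B: alternating_mod scaleV fun_scale U n "{0}" "B y" by (rule B[OF yU])
      obtain i where i: "i < n" "xs ! i = y" using y lx by (auto simp: in_set_conv_nth)
      show ?thesis
      proof (cases "i = 0")
        case True
        then show ?thesis using i lx head[of y "tl xs"] xs by (cases xs) auto
      next
        case False
        have "0 < n" using i by simp
        have "B y (xs[0 := xs ! 0, i := y]) + B y (xs[0 := y, i := xs ! 0]) \<in> {0}"
          by (rule B.swap_slots[OF xs \<open>0 < n\<close> i(1) _ B.nth_mem_U[OF xs \<open>0 < n\<close>] yU]) (use False in simp)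
        moreover have "B y (xs[0 := y, i := xs ! 0]) = 0"
        proof -
          have t: "xs[0 := y, i := xs ! 0] \<in> tuples n U"
            by (intro tuples_update xs yU B.nth_mem_U \<open>0 < n\<close>)
          obtain x zs where "xs = x # zs" using lx \<open>0 < n\<close> by (cases xs) auto
          then obtain zs' where "xs[0 := y, i := xs ! 0] = y # zs'" using False by (cases i) auto
          then show ?thesis using head t by metis
        qed
        moreover have "xs[0 := xs ! 0, i := y] = xs" using i(2) by (metis list_update_id)
        ultimately show ?thesis by simp
      qed
    qed
    have Fd: "F v ds us = B (hd us) (tl us)" if "us \<in> tuples (length ds) U" for us
      using that Cons F_Cons[of "hd us" "tl us"] by (cases us) (auto simp: tuples_def)
    have len: "length ds = Suc n" by (simp add: Cons n_def)
    show ?thesis unfolding len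
    proof
      show "FS.subspace U" by (rule subspace_U)
      show "L.V.subspace {0}" by simp
      fix us assume us: "us \<in> tuples (Suc n) U"
      then obtain y xs where yxs: "us = y # xs" "y \<in> U" "xs \<in> tuples n U"
        by (cases us) (auto simp: tuples_def)
      interpret B: alternating_mod scaleV fun_scale U n "{0}" "B y" by (rule B[OF yxs(2)])
      show "F v ds (us[k := x + x']) - F v ds (us[k := x]) - F v ds (us[k := x']) \<in> {0}"
        if "k < Suc n" "x \<in> U" "x' \<in> U" for k x x'
      proof (cases k)
        case 0
        then show ?thesis using Badd[OF that(2,3) yxs(3)] by (simp add: yxs F_Cons)
      next
        case (Suc l)
        then show ?thesis using B.add_slot[OF yxs(3), of l x x'] that by (simp add: yxs F_Cons)
      qed
      show "F v ds (us[k := fun_scale c x]) - scaleV c (F v ds (us[k := x])) \<in> {0}"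
        if "k < Suc n" "x \<in> U" for k x c
      proof (cases k)
        case 0
        then show ?thesis using Bscale[OF that(2) yxs(3)] by (simp add: yxs F_Cons)
      next
        case (Suc l)
        then show ?thesis using B.scale_slot[OF yxs(3), of l x c] that by (simp add: yxs F_Cons)
      qed
      assume "\<not> distinct us"
      then show "F v ds us \<in> {0}"
        using repeat[OF _ yxs(3), of y] B.alt[OF yxs(3)] by (auto simp: yxs F_Cons)
    qed
  qed
qed

text \<open>For a nonvanishing product of maximal length \<open>k\<close>, the products with one
  further vector \<open>d\<close> vanish, and this vanishing is precisely equivariance. The length
  is bounded since \<open>E\<close> has only \<open>r\<close> elements.\<close>

lemma ex_equivariant_alternating:
  obtains k H us where "k \<le> r" "equivariant_alternating k H" "us \<in> tuples k U" "H us \<noteq> 0"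
proof -
  obtain v :: 'v where v: "v \<noteq> 0" using simple by (auto simp: simple_lie_module_def)
  define P where "P k \<longleftrightarrow> (\<exists>ds us. length ds = k \<and> us \<in> tuples k U \<and> F v ds us \<noteq> 0)" for k
  have P0: "P 0" unfolding P_def by (rule exI[of _ "[]"], rule exI[of _ "[]"]) (simp add: tuples_def v)
  have bound: "k \<le> r" if "P k" for k
  proof (rule ccontr)
    assume k: "\<not> k \<le> r"
    obtain ds us where ds: "length ds = k" "us \<in> tuples k U" "F v ds us \<noteq> 0"
      using \<open>P k\<close> unfolding P_def by blast
    interpret A: alternating_mod scaleV fun_scale U k "{0}" "F v ds"
      using alternating_F[of ds v] ds(1) by simp
    have "F v ds us \<in> {0}"
    proof (rule A.mem_if_basis_mem[OF finite_E E_subset U_span _ ds(2)])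
      fix xs assume xs: "distinct xs" "set xs \<subseteq> E" "length xs = k"
      have "length xs \<le> card E" using card_mono[OF finite_E xs(2)] xs(1) by (simp add: distinct_card)
      then show "F v ds xs \<in> {0}" using k xs(3) card_E by simp
    qed
    then show False using ds(3) by simp
  qed
  define k where "k = (GREATEST k. P k)"
  have "P k" unfolding k_def using P0 bound by (rule GreatestI_nat)
  then obtain ds us where ds: "length ds = k" "us \<in> tuples k U" "F v ds us \<noteq> 0"
    unfolding P_def by blast
  have max: "\<not> P (Suc k)"
    using Greatest_le_nat[of P "Suc k" r] bound by (auto simp: k_def)
  have "equivariant_alternating k (F v ds)"
    unfolding equivariant_alternating_def
  proof (intro conjI ballI allI)
    show "alternating_mod scaleV fun_scale U k {0} (F v ds)" using alternating_F[of ds v] ds(1) by simp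
    fix xs g d assume xs: "xs \<in> tuples k U"
    then have "\<phi> g # xs \<in> tuples (Suc k) U" by (simp add: tuples_Cons pair_mem_U)
    then have "F v (d # ds) (\<phi> g # xs) = 0" using max ds(1) unfolding P_def by (metis length_Cons)
    then show "\<rho> (g \<otimes>\<^sub>Z d) (F v ds xs) = (\<Sum>l<k. F v ds (xs[l := fun_scale ((xs ! l) d) (\<phi> g)]))"
      by (simp add: act_eq_T ds(1))
  qed
  then show ?thesis using that ds bound[OF \<open>P k\<close>] by blast
qed

text \<open>A basis tuple of length \<open>r\<close> contains all of \<open>E\<close>, so putting
  \<open>\<phi> (a j)\<close> into a slot creates a repetition unless it stands there already.
  \<open>L\<close> thus acts by the trace.\<close>

lemma act_top:
  assumes H: "equivariant_alternating r H" and span: "L.V.span (H ` tuples r U) = UNIV"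
  shows "\<rho> (x \<otimes>\<^sub>Z d) v = scaleV (\<phi> x d) v"
proof -
  have basis: "\<rho> (a j \<otimes>\<^sub>Z d) v = scaleV (\<phi> (a j) d) v" if j: "j < r" for j v
  proof -
    note A = equivariant_alternatingD(1)[OF H]
    interpret A: alternating_mod scaleV fun_scale U r "{0}" H by (rule A)
    define N where "N v = \<rho> (a j \<otimes>\<^sub>Z d) v - scaleV (\<phi> (a j) d) v" for v
    have N: "Vector_Spaces.linear scaleV scaleV N"
      by (simp add: N_def Vector_Spaces.linear_iff act_simps L.V.vector_space_axioms
          L.V.scale_right_distrib L.V.scale_right_diff_distrib mult.commute)
    interpret Nl: Vector_Spaces.linear scaleV scaleV N by (rule N)
    have "N ` {0} = {0}" by (simp add: Nl.zero)
    then interpret AN: alternating_mod scaleV fun_scale U r "{0}" "\<lambda>us. N (H us)"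
      using A.comp_linear[OF N] by simp
    have "N (H us) \<in> {0}" if us: "us \<in> tuples r U" for us
    proof (rule AN.mem_if_basis_mem[OF finite_E E_subset U_span _ us])
      fix xs assume xs: "distinct xs" "set xs \<subseteq> E" "length xs = r"
      then have "set xs = E" by (intro card_subset_eq finite_E) (simp_all add: card_E distinct_card)
      then obtain l where l: "l < r" "xs ! l = \<phi> (a j)"
        using j xs(3) by (metis E_def image_eqI in_set_conv_nth lessThan_iff)
      have tup: "xs \<in> tuples r U" using xs E_subset by (auto simp: tuples_def)
      have "H (xs[m := fun_scale ((xs ! m) d) (\<phi> (a j))]) = (if m = l then scaleV (\<phi> (a j) d) (H xs) else 0)"
        if m: "m < r" for m
      proof (cases "m = l")
        case True
        then show ?thesis
          using alternating_eqs(2)[OF A tup m pair_mem_U, of "(xs ! m) d" "a j"] l by (metis list_update_id)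
      next
        case False
        have "H (xs[m := \<phi> (a j)]) = 0"
          using False l m xs(3)
          by (intro alternating_eqs(3)[OF A] tuples_update tup pair_mem_U not_distinct_if_nth_eq[of m _ l]) auto
        then show ?thesis
          using alternating_eqs(2)[OF A tup m pair_mem_U, of "(xs ! m) d" "a j"] False by simp
      qed
      then show "N (H xs) \<in> {0}" using l(1) by (simp add: N_def equivariant_alternatingD(2)[OF H tup])
    qed
    then have "H ` tuples r U \<subseteq> {v. N v = 0}" by blast
    moreover have "L.V.subspace {v. N v = 0}" by (simp add: L.V.subspace_def Nl.add Nl.scale Nl.zero)
    ultimately have "L.V.span (H ` tuples r U) \<subseteq> {v. N v = 0}" by (rule L.V.span_minimal)
    then have "N v = 0" using span by blast
    then show ?thesis by (simp add: N_def)
  qed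
  have "\<rho> (x \<otimes>\<^sub>Z d) v = T (\<phi> x) d v" by (rule act_eq_T)
  also have "\<dots> = scaleV (\<Sum>i<r. \<phi> x (e i) * \<phi> (a i) d) v"
    by (simp add: T_def basis L.V.scale_sum_left)
  also have "\<dots> = scaleV (\<phi> x d) v" by (simp flip: expand)
  finally show ?thesis .
qed

text \<open>If \<open>\<sigma>\<close> is not in the range, then no
  \<open>\<phi> c + \<sigma>\<close> vanishes. The step from \<open>b\<close> to \<open>c\<close>
  multiplies by \<open>\<phi> b d + \<sigma> d\<close> for \<open>k = 0\<close> and by
  \<open>\<phi> c d + \<sigma> d\<close> for \<open>k = r\<close>, so all components would
  agree.\<close>

lemma \<sigma>_mem_range:
  assumes k: "k \<in> {0, r}" and H: "equivariant_alternating k H" and nz: "us \<in> tuples k U" "H us \<noteq> 0"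
  shows "\<sigma> \<in> range \<phi>"
proof (rule ccontr)
  assume \<sigma>: "\<sigma> \<notin> range \<phi>"
  have span: "L.V.span (H ` tuples k U) = UNIV" by (rule span_equivariant_alternating[OF simple H nz])
  have ex: "\<exists>d. \<phi> c d + \<sigma> d \<noteq> 0" for c
  proof (rule ccontr)
    assume "\<not> ?thesis"
    then have "\<sigma> d = \<phi> (- c) d" for d by (simp add: pair_uminus eq_neg_iff_add_eq_0 add.commute)
    then have "\<sigma> = \<phi> (- c)" by (simp add: fun_eq_iff)
    then show False using \<sigma> by blast
  qed
  have "v \<in> C c" if v: "v \<in> C b" for v b c
  proof -
    have "\<exists>z. z \<noteq> 0 \<and> scaleV z v \<in> C c"
    proof (cases "k = 0")
      case True
      obtain d where "\<phi> b d + \<sigma> d \<noteq> 0" using ex by blast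
      then show ?thesis
        using C_step[OF v, of d "c - b"] act_trivial[of H] H span True by auto
    next
      case False
      then have "k = r" using k by simp
      obtain d where "\<phi> c d + \<sigma> d \<noteq> 0" using ex by blast
      moreover have "scaleV (\<phi> b d + \<sigma> d) v + scaleV (\<phi> (c - b) d) v = scaleV (\<phi> c d + \<sigma> d) v"
        by (simp add: pair_diff_left flip: L.V.scale_left_distrib)
      ultimately show ?thesis
        using C_step[OF v, of d "c - b"] act_top[of H "c - b" d v] H span \<open>k = r\<close> by auto
    qed
    then obtain z where z: "z \<noteq> 0" "scaleV z v \<in> C c" by blast
    from L.V.subspace_scale[OF subspace_C z(2), of "inverse z"] z(1) show ?thesis by simp
  qed
  then show False using not_C_constant by blast
qed

end

theorem theorem3p6:
  fixes scaleD :: "complex \<Rightarrow> 'd::ab_group_add \<Rightarrow> 'd"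
    and \<phi> :: "'g::ab_group_add \<Rightarrow> 'd \<Rightarrow> complex"
    and Dbar :: "'d set" and r :: nat
    and \<sigma> :: "'d \<Rightarrow> complex"
    and scaleV :: "complex \<Rightarrow> 'v::ab_group_add \<Rightarrow> 'v"
    and \<rho> :: "('g, 'd) tensor \<Rightarrow> 'v \<Rightarrow> 'v"
  assumes G_nonzero: "\<exists>a::'g. a \<noteq> 0"
    and pairing: "pairing scaleD \<phi>"
    and Dbar_subspace: "module.subspace scaleD Dbar"
    and Dbar_complement: "Dbar \<inter> Ker2 \<phi> = {0}" "{x + y | x y. x \<in> Dbar \<and> y \<in> Ker2 \<phi>} = UNIV"
    and Ker1_zero: "Ker1 \<phi> = {0}"
    and Dbar_finite_dim: "\<exists>B. finite B \<and> module.span scaleD B = Dbar"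
    and Dbar_dim: "vector_space.dim scaleD Dbar = r"
    and \<sigma>_dual: "Vector_Spaces.linear scaleD (*) \<sigma>"
    and V_simple: "simple_lie_module (L_scale scaleD) (L_bracket scaleD \<phi>) scaleV \<rho>"
    and V_finite_dim: "\<exists>Basis. finite_dimensional_vector_space scaleV Basis"
  shows "\<not> simple_lie_module (fscale scaleD) (W_bracket scaleD \<phi>)
             (fscale scaleV) (Gamma_act \<phi> scaleV \<rho> \<sigma>) \<longleftrightarrow>
    (\<exists>i\<in>{1..r - 1}.
        lie_module_iso \<lparr>points = UNIV, madd = (+), msmult = scaleV, mact = \<rho>\<rparr>
          (exterior_bar_dual scaleD \<phi> i) \<and>
        (\<forall>d\<in>Ker2 \<phi>. \<sigma> d = 0)) \<or>
    (\<exists>i\<in>{0, r}.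
        lie_module_iso \<lparr>points = UNIV, madd = (+), msmult = scaleV, mact = \<rho>\<rparr>
          (exterior_bar_dual scaleD \<phi> i) \<and>
        \<sigma> \<in> range \<phi>)"
  (is "?lhs \<longleftrightarrow> ?mid \<or> ?ends")
proof -
  interpret pairing scaleD \<phi> by (rule pairing)
  obtain B where B: "finite B" "span B = Dbar" using Dbar_finite_dim by blast
  obtain a e where "dual_system scaleD \<phi> r a e"
    using ex_dual_system[OF Dbar_subspace Dbar_complement B Dbar_dim] by blast
  then interpret dual_system scaleD \<phi> r a e .
  have Vmod: "lie_module (L_scale scaleD) (L_bracket scaleD \<phi>) scaleV \<rho>"
    using V_simple by (simp add: simple_lie_module_def)
  interpret witt_gamma scaleD \<phi> r a e scaleV \<rho> \<sigma>
    by (intro witt_gamma.intro witt_rep.intro witt_gamma_axioms.intro dual_system_axioms Vmod \<sigma>_dual)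
  obtain v0 :: 'v where v0: "v0 \<noteq> 0" using V_simple by (auto simp: simple_lie_module_def)
  obtain g0 :: 'g where g0: "g0 \<noteq> 0" using G_nonzero by blast
  show ?thesis
  proof
    assume ?lhs
    \<comment> \<open>The module laws hold and the module is nonzero, so simplicity can only fail
      through a proper nonzero submodule.\<close>
    have "Poly_Mapping.single 0 v0 \<noteq> (0 :: 'g \<Rightarrow>\<^sub>0 'v)" using v0 by (metis lookup_single_eq lookup_zero)
    with \<open>?lhs\<close> obtain M where M: "lie_submodule (fscale scaleV) (Gamma_act \<phi> scaleV \<rho> \<sigma>) M"
      "M \<noteq> {0}" "M \<noteq> UNIV"
      using G.lie_module_axioms unfolding simple_lie_module_def by blast
    interpret witt_proper_submodule scaleD \<phi> r a e scaleV \<rho> \<sigma> M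
      by unfold_locales (rule Ker1_zero V_simple V_finite_dim M)+
    obtain k H us where k: "k \<le> r" and H: "equivariant_alternating k H" and us: "us \<in> tuples k U" "H us \<noteq> 0"
      by (rule ex_equivariant_alternating)
    note iso = iso_if_equivariant_alternating[OF V_simple H us]
    show "?mid \<or> ?ends"
    proof (cases "k \<in> {0, r}")
      case True
      then show ?thesis using iso \<sigma>_mem_range[OF True H us] by blast
    next
      case False
      \<comment> \<open>Here \<open>0 < k < r\<close>, so the truncated difference
        \<open>r - 1\<close> is the usual one.\<close>
      then have "k \<in> {1..r - 1}" using k by auto
      then show ?thesis using iso \<sigma>_Ker2 by blast
    qed
  next
    assume "?mid \<or> ?ends"
    then obtain i where iso: "lie_module_iso \<lparr>points = UNIV, madd = (+), msmult = scaleV, mact = \<rho>\<rparr>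
          (exterior_bar_dual scaleD \<phi> i)"
      and i: "i \<in> {1..r - 1} \<and> (\<forall>d\<in>Ker2 \<phi>. \<sigma> d = 0) \<or> i \<in> {0, r} \<and> \<sigma> \<in> range \<phi>"
      by blast
    \<comment> \<open>In the second case \<open>\<sigma>\<close> is some \<open>\<phi> s\<close>,
      which vanishes on \<open>Ker2 \<phi>\<close>.\<close>
    have K2: "\<sigma> d = 0" if "d \<in> Ker2 \<phi>" for d using i that by (auto simp: Ker2_def)
    obtain H where H: "equivariant_alternating i H" "L.V.span (H ` tuples i U) = UNIV"
      by (rule equivariant_alternating_if_iso[OF iso])
    show ?lhs
    proof (cases i)
      case 0
      then have "\<sigma> \<in> range \<phi>" using i by auto
      then show ?thesis using not_simple_trivial[OF H[unfolded 0] v0 _ g0] by blast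
    next
      case (Suc k)
      then have "Suc k < r \<or> \<sigma> \<in> range \<phi>" using i by auto
      then show ?thesis using not_simple_exterior[OF H[unfolded Suc] v0 K2] by blast
    qed
  qed
qed

end
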